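(* Let $f$ and $g$ be the following functions of a positive integer $x$: $$f(x) = 2x+2x^2 + \left(\binom{x}{2}+x\right)\cdot s(x) + \ell^\star\!\left(x+\left\lceil\tfrac{1}{2}s(x)\right\rceil,3\right), \qquad g(x)= 19x.$$ For all integers $k\ge 1$ and $d\ge 1$, and for every graph $G$, either $G$ contains a $d$-packing of $k$ cycles or there exists $X\subseteq V(G)$ with $|X|\leq f(k)$ such that $G-B_G(X,g(d))$ is a forest.
   Context: Graphs are finite, simple and undirected. $\mathrm{dist}_G(x,y)$ is the number of edges of a shortest path in $G$ between $x$ and $y$, or $\infty$ if there is none; for nonempty $X,Y\subseteq V(G)$, $\mathrm{dist}_G(X,Y):=\min\{\mathrm{dist}_G(x,y): x\in X, y\in Y\}$. For an integer $r\ge 0$ and $x\in V(G)$, $B_G(x,r):=\{y\in V(G):\mathrm{dist}_G(x,y)\le r\}$, and for $X\subseteq V(G)$, $B_G(X,r):=\bigcup_{x\in X}B_G(x,r)$. For $S\subseteq V(G)$, $G-S$ is the subgraph of $G$ induced by $V(G)\setminus S$. For a nonnegative integer $d$, a set $\mathcal{C}$ of cycles in $G$ is a $d$-packing if $\mathrm{dist}_G(V(C),V(C'))>d$ for every two distinct $C,C'\in\mathcal{C}$. The function $s$ on positive integers is $s(1):=2$ and $s(k):=\lceil 4k(\log k+\log\log k+4)\rceil$ for $k\ge 2$, where $\log$ is the base-$2$ logarithm. $\ell^\star:\mathbb{N}\times\mathbb{N}\to\mathbb{N}$ is a function (which exists by a theorem of Gyárfás and Lehel) with the following property: for all integers $k,c\ge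 1$, for every forest $F$ and every set $\mathcal{A}$ of subgraphs of $F$, each having at least one vertex and at most $c$ connected components, either there are $k$ pairwise vertex-disjoint members of $\mathcal{A}$, or there exists $X\subseteq V(F)$ with $|X|\le\ell^\star(k,c)$ such that $X\cap V(A)\ne\emptyset$ for each $A\in\mathcal{A}$. *)

theory Defs
  imports Complex_Main "HOL-Library.Extended_Nat"
begin

record 'a graph =
  verts :: "'a set"
  edges :: "'a set set"

definition simple_graph :: "'a graph \<Rightarrow> bool" where
  "simple_graph G \<longleftrightarrow> finite (verts G) \<and> (\<forall>e\<in>edges G. e \<subseteq> verts G \<and> card e = 2)"

definition subgraph :: "'a graph \<Rightarrow> 'a graph \<Rightarrow> bool" where
  "subgraph H G \<longleftrightarrow> simple_graph H \<and> verts H \<subseteq> verts G \<and> edges H \<subseteq> edges G"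

definition delete_verts :: "'a graph \<Rightarrow> 'a set \<Rightarrow> 'a graph" where
  "delete_verts G S = \<lparr>verts = verts G - S, edges = {e \<in> edges G. e \<subseteq> verts G - S}\<rparr>"

text \<open>A path is given by its nonempty list of vertices; it has one edge fewer than vertices.\<close>

definition is_path :: "'a graph \<Rightarrow> 'a \<Rightarrow> 'a list \<Rightarrow> 'a \<Rightarrow> bool" where
  "is_path G x p y \<longleftrightarrow>
     p \<noteq> [] \<and> hd p = x \<and> last p = y \<and> distinct p \<and> set p \<subseteq> verts G \<and>
     (\<forall>i. Suc i < length p \<longrightarrow> {p ! i, p ! Suc i} \<in> edges G)"

text \<open>The infimum of the empty set of type \<^typ>\<open>enat\<close> is \<open>\<infinity>\<close>.\<close>

definition dist_graph :: "'a graph \<Rightarrow> 'a \<Rightarrow> 'a \<Rightarrow> enat" where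
  "dist_graph G x y = (INF p\<in>{p. is_path G x p y}. enat (length p - 1))"

definition dist_sets :: "'a graph \<Rightarrow> 'a set \<Rightarrow> 'a set \<Rightarrow> enat" where
  "dist_sets G X Y = (INF x\<in>X. INF y\<in>Y. dist_graph G x y)"

definition ball_vertex :: "'a graph \<Rightarrow> 'a \<Rightarrow> nat \<Rightarrow> 'a set" where
  "ball_vertex G x r = {y \<in> verts G. dist_graph G x y \<le> enat r}"

definition ball_set :: "'a graph \<Rightarrow> 'a set \<Rightarrow> nat \<Rightarrow> 'a set" where
  "ball_set G X r = (\<Union>x\<in>X. ball_vertex G x r)"

definition is_cycle :: "'a graph \<Rightarrow> bool" where
  "is_cycle C \<longleftrightarrow>
     (\<exists>p. 3 \<le> length p \<and> distinct p \<and> verts C = set p \<and>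
          edges C = {{p ! i, p ! (Suc i mod length p)} | i. i < length p})"

definition cycle_in :: "'a graph \<Rightarrow> 'a graph \<Rightarrow> bool" where
  "cycle_in G C \<longleftrightarrow> is_cycle C \<and> subgraph C G"

definition forest :: "'a graph \<Rightarrow> bool" where
  "forest G \<longleftrightarrow> simple_graph G \<and> \<not> (\<exists>C. cycle_in G C)"

definition d_packing :: "nat \<Rightarrow> 'a graph \<Rightarrow> 'a graph set \<Rightarrow> bool" where
  "d_packing d G \<C> \<longleftrightarrow>
     (\<forall>C\<in>\<C>. cycle_in G C) \<and>
     (\<forall>C\<in>\<C>. \<forall>C'\<in>\<C>. C \<noteq> C' \<longrightarrow> dist_sets G (verts C) (verts C') > enat d)"

definition components :: "'a graph \<Rightarrow> 'a set set" where
  "components G = verts G // {(x, y). \<exists>p. is_path G x p y}"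

text \<open>
  The property of the function of Gyarfas and Lehel. Since every finite graph is isomorphic to
  one with vertices in \<^typ>\<open>nat\<close>, forests on \<^typ>\<open>nat\<close> account for all forests, whereas a type
  variable here would be fixed by the theorem using the property, and could even be finite.
\<close>

definition gyarfas_lehel :: "(nat \<Rightarrow> nat \<Rightarrow> nat) \<Rightarrow> bool" where
  "gyarfas_lehel l \<longleftrightarrow>
     (\<forall>k c. k \<ge> 1 \<longrightarrow> c \<ge> 1 \<longrightarrow>
       (\<forall>(F :: nat graph) \<A>.
          forest F \<longrightarrow>
          (\<forall>A\<in>\<A>. subgraph A F \<and> verts A \<noteq> {} \<and> card (components A) \<le> c) \<longrightarrow>
          (\<exists>\<B>\<subseteq>\<A>. card \<B> = k \<and> pairwise (\<lambda>A B. disjnt (verts A) (verts B)) \<B>) \<or>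
          (\<exists>X\<subseteq>verts F. card X \<le> l k c \<and> (\<forall>A\<in>\<A>. X \<inter> verts A \<noteq> {}))))"

text \<open>Only meant for positive arguments.\<close>

definition s_fun :: "nat \<Rightarrow> nat" where
  "s_fun k = (if k = 1 then 2
          else nat \<lceil>4 * real k * (log 2 (real k) + log 2 (log 2 (real k)) + 4)\<rceil>)"

definition f_bound :: "(nat \<Rightarrow> nat \<Rightarrow> nat) \<Rightarrow> nat \<Rightarrow> nat" where
  "f_bound l x = 2 * x + 2 * x\<^sup>2 + ((x choose 2) + x) * s_fun x + l (x + nat \<lceil>1 / 2 * real (s_fun x)\<rceil>) 3"

definition g_radius :: "nat \<Rightarrow> nat" where
  "g_radius x = 19 * x"

end

theory Submission imports Defs begin

text \<open>
Choose cycles greedily, each one shortest among the cycles that avoid the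
\<open>4 d\<close>-neighbourhood of the earlier ones except on a segment of fewer than \<open>4 d\<close> vertices.
The exceptional segment is the device that makes the argument work: because of it, a
shortcut of a chosen cycle could always be used to produce a shorter candidate, so every chosen
cycle is geodesic in \<open>G\<close> up to distance \<open>2 d\<close> (\<open>minimal_admissible_geodesic\<close>), even where
it runs along earlier cycles; and because the segment is short, different chosen cycles still have
distance more than \<open>2 d\<close>. Hence there are fewer than \<open>k\<close> of them. Let \<open>C\<close> be the set of their
vertices; every cycle of \<open>G\<close> comes within \<open>4 d\<close> of \<open>C\<close>.

Search \<open>G\<close> from \<open>C\<close> breadth first up to level \<open>5 d\<close>. If all edges between these levels
were tree edges or edges of chosen cycles, this part of \<open>G\<close> would consist of cycles with trees
attached. Any other edge is bad; minimality of the chosen cycles shows that a bad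
edge is close to a short chosen cycle or to a bridge, an edge whose two tree paths lead to different
chosen cycles (\<open>bad_cover\<close>). Take a maximal family of bridges whose tree paths are far apart. If
it has \<open>s_fun k / 2\<close> members, then these paths are ears on the chosen cycles, and
together they form a graph of maximum degree 3 with at least \<open>s_fun k\<close> vertices of degree 3. By
Simonovits' theorem (\<open>disjoint_cycles\<close>) it has \<open>k\<close> disjoint cycles, and the distances between
the ears make them a packing in \<open>G\<close> (\<open>fat_ears\<close>). Otherwise, boundedly many vertices
come within \<open>13 d\<close> of every bad edge (\<open>hitting_pts_cover\<close>).

A cycle of \<open>G\<close> at distance more than \<open>19 d\<close> from these has to leave level \<open>5 d\<close> upwards,
and an excursion above this level, prolonged at both ends by tree paths down to \<open>C\<close>, is an
ear as well. Ears of this kind may be arbitrarily long, and they are packed or hit with the theorem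
of Gyarfas and Lehel in the following forest \<open>F\<close>: all of \<open>G\<close> above level \<open>4 d\<close>, which is
acyclic, the tree edges below, and the chosen cycles without one edge each. The ball of radius
\<open>2 d\<close> in \<open>F\<close> around an ear has at most three components, one above level \<open>4 d\<close> and one for
either end. If a set of vertices meets all these balls, it completes the set \<open>X\<close>. If there
are \<open>k + s_fun k / 2\<close> disjoint balls, then their ears are far apart not only in \<open>F\<close> but also in
\<open>G\<close> (\<open>ears_near_F\<close>). Either \<open>k\<close> of these ears have both ends at nearly the same place of \<open>C\<close>;
closing them up gives \<open>k\<close> cycles. Or \<open>s_fun k / 2\<close> of them have ends far apart, and \<open>fat_ears\<close>
applies again.
\<close>

section \<open>Walks and bounded distances\<close>

abbreviation adj :: "'a graph \<Rightarrow> 'a \<Rightarrow> 'a \<Rightarrow> bool" where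
  "adj G x y \<equiv> {x, y} \<in> edges G"

abbreviation walk :: "'a graph \<Rightarrow> 'a list \<Rightarrow> bool" where
  "walk G p \<equiv> successively (adj G) p"

lemma simple_adjD:
  assumes "simple_graph G" "adj G x y"
  shows "x \<in> verts G" "y \<in> verts G" "x \<noteq> y"
proof -
  have "{x,y} \<subseteq> verts G" "card {x,y} = 2"
    using assms unfolding simple_graph_def by auto
  then show "x \<in> verts G" "y \<in> verts G" "x \<noteq> y" by auto
qed

lemma adj_sym: "adj G x y \<longleftrightarrow> adj G y x"
  by (simp add: insert_commute)

lemma walk_rev [simp]: "walk G (rev p) \<longleftrightarrow> walk G p"
  by (simp add: successively_rev insert_commute)

lemma simple_finite_edges: "simple_graph G \<Longrightarrow> finite (edges G)"
  unfolding simple_graph_def by (metis Pow_iff finite_Pow_iff finite_subset subsetI)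

lemma is_path_iff:
  "is_path G x p y \<longleftrightarrow>
     p \<noteq> [] \<and> hd p = x \<and> last p = y \<and> distinct p \<and> set p \<subseteq> verts G \<and> walk G p"
  unfolding is_path_def by (auto simp: successively_conv_nth)

text \<open>
Distances are only ever compared with natural numbers, so the relation \<open>dist \<le> n\<close> is all
that is needed; the recursion makes it additive and avoids infinite distances. It is reflexive
also outside of the graph, which is harmless because it preserves membership in the vertex set.
\<close>

fun near :: "'a graph \<Rightarrow> nat \<Rightarrow> 'a \<Rightarrow> 'a \<Rightarrow> bool" where
  "near G 0 x y \<longleftrightarrow> x = y"
| "near G (Suc n) x y \<longleftrightarrow> near G n x y \<or> (\<exists>z. near G n x z \<and> adj G z y)"

lemma near_refl [simp]: "near G n x x"
  by (induction n) auto

lemma near_mono: "near G m x y \<Longrightarrow> m \<le> n \<Longrightarrow> near G n x y"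
  by (induction n) (auto simp: le_Suc_eq)

lemma near_trans: "near G m x y \<Longrightarrow> near G n y z \<Longrightarrow> near G (m + n) x z"
  by (induction n arbitrary: z) auto

lemma near_adj: "adj G x y \<Longrightarrow> near G 1 x y"
  by auto

lemma near_sym: "near G n x y \<Longrightarrow> near G n y x"
proof (induction n arbitrary: y)
  case (Suc n)
  show ?case
  proof (cases "near G n x y")
    case True
    then show ?thesis using Suc.IH by auto
  next
    case False
    then obtain z where "near G n x z" "adj G z y" using Suc.prems by auto
    then have "near G n z x" "near G 1 y z"
      using Suc.IH by (auto simp: insert_commute)
    then have "near G (1 + n) y x" by (rule near_trans[rotated])
    then show ?thesis by simp
  qed
qed simp

lemma near_split: "near G (m + n) x y \<Longrightarrow> \<exists>z. near G m x z \<and> near G n z y"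
proof (induction n arbitrary: y)
  case (Suc n)
  show ?case
  proof (cases "near G (m + n) x y")
    case True
    then show ?thesis using Suc.IH by (meson near.simps(2))
  next
    case False
    then obtain u where "near G (m + n) x u" "adj G u y" using Suc.prems by auto
    then show ?thesis using Suc.IH by (meson near.simps(2))
  qed
qed auto

lemma near_subgraph: "near H n x y \<Longrightarrow> edges H \<subseteq> edges G \<Longrightarrow> near G n x y"
  by (induction n arbitrary: y) auto

lemma near_verts:
  "near G n x y \<Longrightarrow> simple_graph G \<Longrightarrow> x \<in> verts G \<Longrightarrow> y \<in> verts G"
  by (induction n arbitrary: y) (auto dest: simple_adjD)

lemma walk_near:
  "walk G (x # p) \<Longrightarrow> near G (length p) x (last (x # p))"
proof (induction p rule: rev_induct)
  case (snoc y p)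
  then have "walk G (x # p)" "adj G (last (x # p)) y"
    by (auto simp: successively_append_iff successively_Cons hd_append split: if_splits)
  then show ?case using snoc.IH by auto
qed simp

lemma near_walk:
  "near G n x y \<Longrightarrow> \<exists>p. p \<noteq> [] \<and> hd p = x \<and> last p = y \<and> length p \<le> Suc n \<and> walk G p"
proof (induction n arbitrary: y)
  case 0
  then show ?case by (intro exI[of _ "[x]"]) auto
next
  case (Suc n)
  show ?case
  proof (cases "near G n x y")
    case True
    then show ?thesis using Suc.IH by (meson le_Suc_eq)
  next
    case False
    then obtain z where z: "near G n x z" "adj G z y" using Suc.prems by auto
    then obtain p where "p \<noteq> []" "hd p = x" "last p = z" "length p \<le> Suc n" "walk G p"
      using Suc.IH by blast
    then show ?thesis using z
      by (intro exI[of _ "p @ [y]"]) (auto simp: successively_append_iff)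
  qed
qed

lemma walk_nth_near:
  assumes "walk G p" "i \<le> j" "j < length p"
  shows "near G (j - i) (p ! i) (p ! j)"
  using assms(2,3)
proof (induction j)
  case (Suc j)
  show ?case
  proof (cases "i = Suc j")
    case False
    then have "near G (j - i) (p ! i) (p ! j)" using Suc by auto
    moreover have "adj G (p ! j) (p ! Suc j)"
      using assms(1) Suc.prems by (auto simp: successively_conv_nth)
    ultimately have "near G (Suc (j - i)) (p ! i) (p ! Suc j)" by auto
    then show ?thesis using False Suc.prems by (simp add: Suc_diff_le)
  qed simp
qed simp

lemma near_path:
  assumes "near G n x y"
  shows "\<exists>p. p \<noteq> [] \<and> hd p = x \<and> last p = y \<and> length p \<le> Suc n \<and> walk G p \<and> distinct p"
proof -
  let ?P = "\<lambda>p. p \<noteq> [] \<and> hd p = x \<and> last p = y \<and> length p \<le> Suc n \<and> walk G p"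
  obtain p0 where "?P p0" using near_walk[OF assms] by blast
  then obtain p where p: "?P p" "\<And>q. ?P q \<Longrightarrow> length p \<le> length q"
    using ex_has_least_nat[of ?P p0 length] by blast
  have "distinct p"
  proof (rule ccontr)
    assume "\<not> distinct p"
    then obtain as b bs cs where d: "p = as @ [b] @ bs @ [b] @ cs"
      using not_distinct_decomp by blast
    have "?P (as @ b # cs)"
    proof -
      have "walk G (as @ [b] @ bs @ [b] @ cs)" using p(1) d by simp
      then have "walk G (as @ b # cs)"
        unfolding successively_append_iff successively_Cons by fastforce
      moreover have "hd (as @ b # cs) = x" using p(1) d by (cases as) simp_all
      moreover have "last (as @ b # cs) = y" using p(1) d by (cases cs) simp_all
      moreover have "length (as @ b # cs) \<le> Suc n" using p(1) d by simp
      ultimately show ?thesis by simp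
    qed
    from p(2)[OF this] show False unfolding d by simp
  qed
  then show ?thesis using p(1) by blast
qed

lemma walk_verts:
  assumes "walk G p" "simple_graph G" "p \<noteq> []" "hd p \<in> verts G"
  shows "set p \<subseteq> verts G"
proof
  fix y assume "y \<in> set p"
  then obtain i where i: "i < length p" "p ! i = y" by (auto simp: in_set_conv_nth)
  have "near G (i - 0) (p ! 0) (p ! i)" using walk_nth_near[OF assms(1)] i by blast
  then show "y \<in> verts G" using near_verts[OF _ assms(2)] i assms(3,4) by (simp add: hd_conv_nth)
qed

lemma INF_enat_le_iff:
  "(INF p\<in>A. enat (f p)) \<le> enat n \<longleftrightarrow> (\<exists>p\<in>A. f p \<le> n)"
proof
  assume le: "(INF p\<in>A. enat (f p)) \<le> enat n"
  show "\<exists>p\<in>A. f p \<le> n"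
  proof (rule ccontr)
    assume "\<not> ?thesis"
    then have "enat (Suc n) \<le> (INF p\<in>A. enat (f p))"
      by (intro INF_greatest) (auto simp: not_le)
    then have "enat (Suc n) \<le> enat n" using le by (rule order_trans)
    then show False by simp
  qed
qed (meson INF_lower2 enat_ord_simps(1))

text \<open>
The recursion describes walks, the distance of the statement is defined by paths; a
shortest walk is a path.
\<close>

lemma dist_le_iff:
  assumes "simple_graph G" "x \<in> verts G"
  shows "dist_graph G x y \<le> enat n \<longleftrightarrow> near G n x y"
proof
  assume "dist_graph G x y \<le> enat n"
  then obtain p where p: "is_path G x p y" "length p - 1 \<le> n"
    unfolding dist_graph_def INF_enat_le_iff by auto
  then obtain q where q: "p = x # q" unfolding is_path_iff by (cases p) auto
  then have "near G (length q) x y" using p walk_near[of G x q] by (auto simp: is_path_iff)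
  then show "near G n x y" using p q near_mono by (metis diff_Suc_1 length_Cons)
next
  assume "near G n x y"
  then obtain p where p: "p \<noteq> []" "hd p = x" "last p = y" "length p \<le> Suc n" "walk G p" "distinct p"
    using near_path by metis
  then have "is_path G x p y"
    using walk_verts[OF p(5) assms(1) p(1)] assms(2) by (simp add: is_path_iff)
  then show "dist_graph G x y \<le> enat n"
    unfolding dist_graph_def INF_enat_le_iff using p(4) by (intro bexI[of _ p]) auto
qed

lemma connected_iff_near:
  assumes "simple_graph G" "x \<in> verts G"
  shows "(\<exists>p. is_path G x p y) \<longleftrightarrow> (\<exists>n. near G n x y)"
proof
  assume "\<exists>p. is_path G x p y"
  then obtain p where p: "is_path G x p y" ..
  then have "dist_graph G x y \<le> enat (length p - 1)"
    unfolding dist_graph_def INF_enat_le_iff by auto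
  then show "\<exists>n. near G n x y" using dist_le_iff[OF assms] by auto
next
  assume "\<exists>n. near G n x y"
  then obtain n where "dist_graph G x y \<le> enat n" using dist_le_iff[OF assms] by auto
  then show "\<exists>p. is_path G x p y" unfolding dist_graph_def INF_enat_le_iff by auto
qed

section \<open>Cycles as cyclic lists of vertices\<close>

text \<open>
The cycle itself is the graph \<open>cyc_graph p\<close>; \<open>cycle_in_iff\<close> relates the two views. The list
is only determined up to rotation and reversal, hence \<open>cyc_rotate\<close>.
\<close>

definition cyc :: "'a graph \<Rightarrow> 'a list \<Rightarrow> bool" where
  "cyc G p \<longleftrightarrow> 3 \<le> length p \<and> distinct p \<and> walk G p \<and> adj G (last p) (hd p)"

definition cyc_graph :: "'a list \<Rightarrow> 'a graph" where
  "cyc_graph p = \<lparr>verts = set p, edges = {{p ! i, p ! (Suc i mod length p)} | i. i < length p}\<rparr>"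

lemma cyc_graph_verts [simp]: "verts (cyc_graph p) = set p"
  by (simp add: cyc_graph_def)

lemma cyc_graph_edges:
  assumes "p \<noteq> []"
  shows "edges (cyc_graph p) = {{p ! i, p ! Suc i} | i. Suc i < length p} \<union> {{last p, hd p}}"
proof -
  have "{{p ! i, p ! (Suc i mod length p)} | i. i < length p}
      = (\<lambda>i. {p ! i, p ! (Suc i mod length p)}) ` {..<length p}" by auto
  also have "{..<length p} = {i. Suc i < length p} \<union> {length p - 1}"
    using assms by (cases p) auto
  also have "(\<lambda>i. {p ! i, p ! (Suc i mod length p)}) ` \<dots>
      = (\<lambda>i. {p ! i, p ! Suc i}) ` {i. Suc i < length p} \<union> {{last p, hd p}}"
    using assms by (auto simp: last_conv_nth hd_conv_nth)
  also have "\<dots> = {{p ! i, p ! Suc i} | i. Suc i < length p} \<union> {{last p, hd p}}" by auto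
  finally show ?thesis by (simp add: cyc_graph_def)
qed

lemma cyc_iff_edges:
  "cyc G p \<longleftrightarrow> 3 \<le> length p \<and> distinct p \<and> edges (cyc_graph p) \<subseteq> edges G"
proof (cases "p = []")
  case False
  then show ?thesis
    unfolding cyc_def cyc_graph_edges[OF False] by (auto simp: successively_conv_nth)
qed (simp add: cyc_def)

lemma cyc_cyc_graph: "cyc G p \<Longrightarrow> cyc (cyc_graph p) p"
  by (simp add: cyc_iff_edges)

lemma cyc_subset: "cyc G p \<Longrightarrow> edges G \<subseteq> edges H \<Longrightarrow> cyc H p"
  by (auto simp: cyc_iff_edges)

lemma cyc_rotate: "cyc G (xs @ ys) \<Longrightarrow> cyc G (ys @ xs)"
  unfolding cyc_def
  by (cases "xs = []"; cases "ys = []")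
     (auto simp: successively_append_iff hd_append last_append)

lemma cyc_nonempty: "cyc G p \<Longrightarrow> p \<noteq> []"
  by (auto simp: cyc_def)

lemma cyc_two_nbrs:
  assumes "cyc G p" "v \<in> set p"
  shows "\<exists>a\<in>set p. \<exists>b\<in>set p. a \<noteq> b \<and> a \<noteq> v \<and> b \<noteq> v \<and> adj G v a \<and> adj G v b"
proof -
  obtain xs ys where p: "p = xs @ v # ys" using split_list[OF assms(2)] by blast
  have c: "cyc G (v # ys @ xs)" using cyc_rotate[of G xs "v # ys"] assms(1) p by simp
  obtain a b zs where z: "ys @ xs = a # zs @ [b]"
  proof -
    have "2 \<le> length (ys @ xs)" using c by (auto simp: cyc_def)
    then show ?thesis using that
      by (metis One_nat_def Suc_1 Suc_le_length_iff append_butlast_last_id neq_Nil_conv list.distinct(1))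
  qed
  have "a \<noteq> b" "adj G v a" "adj G v b" "a \<noteq> v" "b \<noteq> v"
    using c unfolding z cyc_def by (auto simp: successively_Cons insert_commute)
  moreover have "a \<in> set p" "b \<in> set p"
    using arg_cong[OF z, of set] unfolding p by auto
  ultimately show ?thesis by blast
qed

lemma simple_cyc_graph:
  assumes "cyc G p"
  shows "simple_graph (cyc_graph p)"
  unfolding simple_graph_def
proof (intro conjI ballI)
  fix e assume e: "e \<in> edges (cyc_graph p)"
  have p: "p \<noteq> []" "distinct p" "3 \<le> length p" using assms by (auto simp: cyc_def)
  have lh: "last p \<noteq> hd p"
    using p by (auto simp: last_conv_nth hd_conv_nth nth_eq_iff_index_eq)
  show "e \<subseteq> verts (cyc_graph p)" using e p unfolding cyc_graph_edges[OF p(1)] by auto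
  show "card e = 2"
    using e p lh unfolding cyc_graph_edges[OF p(1)] by (auto simp: nth_eq_iff_index_eq)
qed auto

lemma cycle_in_iff:
  assumes "simple_graph G"
  shows "cycle_in G C \<longleftrightarrow> (\<exists>p. cyc G p \<and> C = cyc_graph p)"
proof
  assume "cycle_in G C"
  then obtain p where p: "3 \<le> length p" "distinct p" "verts C = set p"
    "edges C = {{p ! i, p ! (Suc i mod length p)} | i. i < length p}" "edges C \<subseteq> edges G"
    unfolding cycle_in_def is_cycle_def subgraph_def by blast
  then have "C = cyc_graph p" by (simp add: cyc_graph_def)
  moreover have "cyc G p" using p \<open>C = cyc_graph p\<close> by (simp add: cyc_iff_edges)
  ultimately show "\<exists>p. cyc G p \<and> C = cyc_graph p" by blast
next
  assume "\<exists>p. cyc G p \<and> C = cyc_graph p"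
  then obtain p where p: "cyc G p" "C = cyc_graph p" by blast
  have "set p \<subseteq> verts G"
  proof
    fix v assume "v \<in> set p"
    then obtain a where "adj G v a" using cyc_two_nbrs[OF p(1)] by blast
    then show "v \<in> verts G" using simple_adjD[OF assms] by blast
  qed
  then show "cycle_in G C"
    unfolding cycle_in_def is_cycle_def subgraph_def p(2)
    using p(1) simple_cyc_graph[OF p(1)] by (auto simp: cyc_iff_edges cyc_graph_def)
qed

lemma cyc_verts:
  assumes "simple_graph G" "cyc G p"
  shows "set p \<subseteq> verts G"
proof
  fix v assume "v \<in> set p"
  then obtain a where "adj G v a" using cyc_two_nbrs[OF assms(2)] by blast
  then show "v \<in> verts G" using simple_adjD[OF assms(1)] by blast
qed

lemma forest_iff:
  "simple_graph G \<Longrightarrow> forest G \<longleftrightarrow> (\<forall>p. \<not> cyc G p)"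
  unfolding forest_def by (auto simp: cycle_in_iff)

text \<open>
From the last vertex of their common initial part on, follow the first path until it meets
the second one again, and return along the second.
\<close>

lemma two_paths_cycle:
  assumes "distinct p" "distinct q" "p \<noteq> q" "p \<noteq> []" "q \<noteq> []" "walk G p" "walk G q"
    "hd p = hd q" "last p = last q"
  shows "\<exists>c. cyc G c \<and> set c \<subseteq> set p \<union> set q"
  using assms
proof (induction p arbitrary: q)
  case (Cons x p' q)
  then obtain q' where q: "q = x # q'" by (cases q) auto
  have ne: "p' \<noteq> []" "q' \<noteq> []"
    using Cons.prems unfolding q by (auto split: if_splits)
  show ?case
  proof (cases "hd p' = hd q'")
    case True
    have "\<exists>c. cyc G c \<and> set c \<subseteq> set p' \<union> set q'"
      by (rule Cons.IH) (use Cons.prems ne True in \<open>auto simp: q successively_Cons\<close>)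
    then show ?thesis unfolding q by auto
  next
    case False
    have "last p' \<in> set q'" using Cons.prems ne unfolding q by auto
    then have "\<exists>z\<in>set p'. z \<in> set q'" using ne last_in_set by blast
    then obtain p1 z p2 where p': "p' = p1 @ z # p2" "z \<in> set q'" "\<forall>y\<in>set p1. y \<notin> set q'"
      using split_list_first_prop[of p' "\<lambda>z. z \<in> set q'"] by blast
    obtain q1 q2 where q': "q' = q1 @ z # q2" using split_list[OF p'(2)] by blast
    have "p1 \<noteq> [] \<or> q1 \<noteq> []" using False unfolding p' q' by auto
    then have len: "3 \<le> length (x # p1 @ z # rev q1)" by (cases p1; cases q1) auto
    have dis: "distinct (x # p1 @ z # rev q1)"
      using Cons.prems(1,2) p'(3) unfolding q p' q' by auto
    have w1: "walk G (x # p1 @ [z])" "walk G (x # q1 @ [z])"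
      using Cons.prems(6,7) unfolding q p' q'
      by (auto simp: successively_append_iff successively_Cons hd_append split: if_splits)
    have w2: "walk G (z # rev q1)"
      using w1(2) walk_rev[of G "q1 @ [z]"] by (auto simp: successively_Cons)
    have w3: "walk G (x # p1 @ z # rev q1)"
      using w1(1) w2
        by (auto simp: successively_append_iff successively_Cons hd_append split: if_splits)
    have "adj G (last (x # p1 @ z # rev q1)) x"
      using w1(2) by (cases q1) (auto simp: insert_commute)
    then have "cyc G (x # p1 @ z # rev q1)" using len dis w3 by (simp add: cyc_def)
    then show ?thesis unfolding q p' q' by (intro exI[of _ "x # p1 @ z # rev q1"]) auto
  qed
qed simp

section \<open>Degrees\<close>

definition deg :: "'a graph \<Rightarrow> 'a \<Rightarrow> nat" where
  "deg G v = card {e \<in> edges G. v \<in> e}"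

text \<open>
An edge contributes the number of its ends in \<open>W\<close>: one if it meets \<open>W\<close>, and another one
if it lies inside \<open>W\<close>.
\<close>

lemma sum_deg:
  assumes "simple_graph G" "finite W"
  shows "(\<Sum>v\<in>W. deg G v) = card {e \<in> edges G. e \<inter> W \<noteq> {}} + card {e \<in> edges G. e \<subseteq> W}"
proof -
  have fE: "finite (edges G)" using assms by (rule_tac simple_finite_edges)
  have "(\<Sum>v\<in>W. deg G v) = (\<Sum>v\<in>W. \<Sum>e\<in>edges G. if v \<in> e then 1 else 0)"
    unfolding deg_def using fE by (simp add: sum.If_cases Int_def)
  also have "\<dots> = (\<Sum>e\<in>edges G. \<Sum>v\<in>W. if v \<in> e then 1 else 0)" by (rule sum.swap)
  also have "\<dots> = (\<Sum>e\<in>edges G. (if e \<inter> W \<noteq> {} then 1 else 0) + (if e \<subseteq> W then 1 else 0))"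
  proof (rule sum.cong[OF refl])
    fix e assume "e \<in> edges G"
    then have "card e = 2" using assms by (auto simp: simple_graph_def)
    then obtain a b where e: "e = {a, b}" "a \<noteq> b" by (auto simp: card_2_iff)
    have "(\<Sum>v\<in>W. if v \<in> e then 1 else 0) = card (W \<inter> e)"
      using assms(2) by (simp add: sum.If_cases Int_def)
    also have "\<dots> = (if e \<inter> W \<noteq> {} then 1 else 0) + (if e \<subseteq> W then 1 else 0)"
      unfolding e by (cases "a \<in> W"; cases "b \<in> W") (use e(2) in \<open>auto simp: Int_insert_right\<close>)
    finally show "(\<Sum>v\<in>W. if v \<in> e then 1 else 0) = \<dots>" .
  qed
  also have "\<dots> = card {e \<in> edges G. e \<inter> W \<noteq> {}} + card {e \<in> edges G. e \<subseteq> W}"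
    using fE by (simp add: sum.distrib sum.If_cases Int_def)
  finally show ?thesis .
qed

lemma cyc_deg_ge2:
  assumes "simple_graph G" "cyc G p" "v \<in> set p"
  shows "2 \<le> card {e \<in> edges (cyc_graph p). v \<in> e}"
proof -
  obtain a b where ab: "a \<noteq> b" "a \<noteq> v" "b \<noteq> v" "adj (cyc_graph p) v a" "adj (cyc_graph p) v b"
    using cyc_two_nbrs[OF cyc_cyc_graph[OF assms(2)] assms(3)] by blast
  then have "{{v,a},{v,b}} \<subseteq> {e \<in> edges (cyc_graph p). v \<in> e}" by auto
  moreover have "card {{v,a},{v,b}} = 2" using ab by (simp add: doubleton_eq_iff)
  moreover have "finite {e \<in> edges (cyc_graph p). v \<in> e}"
    using simple_finite_edges[OF simple_cyc_graph[OF assms(2)]] by auto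
  ultimately show ?thesis by (metis card_mono)
qed

text \<open>
Every vertex has two neighbours on the cycle and there are at most as many edges as vertices,
so the degree sum leaves no room for more.
\<close>

lemma cyc_deg:
  assumes "cyc G p"
  shows "card (edges (cyc_graph p)) = length p" "v \<in> set p \<Longrightarrow> deg (cyc_graph p) v = 2"
proof -
  have s: "simple_graph (cyc_graph p)" by (rule simple_cyc_graph[OF assms])
  have dist: "card (set p) = length p" using assms by (simp add: cyc_def distinct_card)
  have "{{p ! i, p ! (Suc i mod length p)} | i. i < length p}
      = (\<lambda>i. {p ! i, p ! (Suc i mod length p)}) ` {..<length p}" by auto
  then have le: "card (edges (cyc_graph p)) \<le> length p"
    unfolding cyc_graph_def using card_image_le[of "{..<length p}"] by simp
  have ge: "2 \<le> deg (cyc_graph p) u" if "u \<in> set p" for u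
    using cyc_deg_ge2[OF s cyc_cyc_graph[OF assms] that] by (simp add: deg_def)
  have e: "e \<subseteq> set p \<and> e \<inter> set p \<noteq> {}" if "e \<in> edges (cyc_graph p)" for e
  proof -
    have "e \<subseteq> set p" "card e = 2" using s that unfolding simple_graph_def by auto
    then show ?thesis by (metis Int_absorb2 card.empty zero_neq_numeral)
  qed
  then have sets: "{e \<in> edges (cyc_graph p). e \<inter> set p \<noteq> {}} = edges (cyc_graph p)"
     "{e \<in> edges (cyc_graph p). e \<subseteq> set p} = edges (cyc_graph p)" by blast+
  have eq: "(\<Sum>v\<in>set p. deg (cyc_graph p) v) = 2 * card (edges (cyc_graph p))"
    using sum_deg[OF s, of "set p"] unfolding sets by simp
  have sge: "(\<Sum>v\<in>set p. 2) \<le> (\<Sum>v\<in>set p. deg (cyc_graph p) v)" using ge by (intro sum_mono) auto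
  then show c: "card (edges (cyc_graph p)) = length p" using eq le dist by simp
  show "deg (cyc_graph p) v = 2" if v: "v \<in> set p"
  proof (rule ccontr)
    assume "deg (cyc_graph p) v \<noteq> 2"
    then have "(\<Sum>v\<in>set p. 2) < (\<Sum>v\<in>set p. deg (cyc_graph p) v)"
      using ge v by (intro sum_strict_mono_ex1) (auto intro!: bexI[of _ v] simp: le_neq_implies_less)
    then show False using eq c dist by simp
  qed
qed

section \<open>Cycles with few branch vertices\<close>

lemma is_path_prefix:
  assumes "is_path G x (a @ v # b) u"
  shows "is_path G x (a @ [v]) v"
  using assms unfolding is_path_iff
  by (cases a) (auto simp: successively_append_iff successively_Cons hd_append split: if_splits)

lemma is_path_extend:
  assumes "simple_graph G" "is_path G x p u" "adj G u v" "v \<notin> set p"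
  shows "is_path G x (p @ [v]) v"
  using assms simple_adjD[OF assms(1,3)] unfolding is_path_iff
  by (auto simp: successively_append_iff)

lemma sum_two_three:
  assumes "finite W" "\<And>v. v \<in> W \<Longrightarrow> f v = 2 + (if v \<in> T then 1 else 0 :: nat)"
  shows "sum f W = 2 * card W + card (W \<inter> T)"
proof -
  have "sum f W = (\<Sum>v\<in>W. 2 + (if v \<in> T then 1 else 0))" using assms(2) by (rule sum.cong[OF refl])
  also have "\<dots> = (\<Sum>v\<in>W. 2) + (\<Sum>v\<in>W. if v \<in> T then 1 else 0)" by (rule sum.distrib)
  also have "(\<Sum>v\<in>W. if v \<in> T then 1 else 0) = card (W \<inter> T)"
    using assms(1) by (simp add: sum.If_cases)
  finally show ?thesis by simp
qed

lemma edge_in_verts: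
  assumes "simple_graph G" "e \<in> edges G"
  shows "e \<subseteq> verts G" "e \<inter> verts G \<noteq> {}"
proof -
  have e: "e \<subseteq> verts G" "card e = 2" using assms unfolding simple_graph_def by auto
  then show "e \<subseteq> verts G" by simp
  have "e \<noteq> {}" using e by auto
  then show "e \<inter> verts G \<noteq> {}" using e by auto
qed

text \<open>
A Moore bound that counts only branch vertices, that is, vertices of degree 3, and so needs no
suppression of vertices of degree 2. Let \<open>B t\<close> be the set of vertices reachable from a fixed branch
vertex \<open>x\<close> by a path with at most \<open>t\<close> further branch vertices. As long as every cycle has more than
\<open>2 t + 2\<close> branch vertices, such paths are unique. Then \<open>B t\<close> spans at most \<open>|B t| - 1\<close> edges, one
for the last step of each path; if \<open>B t\<close> has \<open>b\<close> branch vertices, the degree sum leaves at least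
\<open>b + 2\<close> edges that go out of \<open>B t\<close>, and they lead to different new branch vertices. So \<open>b + 2\<close>
doubles with each \<open>t\<close>, and a cycle with few branch vertices must appear after logarithmically many
steps. The bound \<open>2 ^ c \<le> n\<^sup>2\<close> says \<open>c \<le> 2 log n\<close>.
\<close>

lemma few_branch_cycle:
  fixes H :: "'a graph"
  assumes S: "simple_graph H" and dg: "\<And>v. v \<in> verts H \<Longrightarrow> deg H v = 2 \<or> deg H v = 3"
    and T: "T = {v \<in> verts H. deg H v = 3}" and n2: "2 \<le> card T"
  shows "\<exists>c. cyc H c \<and> 2 ^ card (set c \<inter> T) \<le> (card T)\<^sup>2"
proof -
  define big where "big m \<longleftrightarrow> (\<forall>c. cyc H c \<longrightarrow> m < card (set c \<inter> T))" for m
  have finV: "finite (verts H)" using S by (simp add: simple_graph_def)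
  have finT: "finite T" using finV T by auto
  obtain x where xT: "x \<in> T" using n2 by fastforce
  have xV: "x \<in> verts H" using xT T by auto
  define wt where "wt p = card (set p \<inter> T - {x})" for p
  define B where "B t = {y. \<exists>p. is_path H x p y \<and> wt p \<le> t}" for t
  have B_sub: "B t \<subseteq> verts H" for t
    unfolding B_def is_path_iff using last_in_set by fastforce
  have finB: "finite (B t)" for t using finite_subset[OF B_sub finV] .
  have uniq: "p = q" if bg: "big m" and pq: "is_path H x p y" "is_path H x q y"
      and cm: "card ((set p \<union> set q) \<inter> T) \<le> m" for p q y m
  proof (rule ccontr)
    assume "p \<noteq> q"
    then obtain c where c: "cyc H c" "set c \<subseteq> set p \<union> set q"
      using two_paths_cycle[of p q H] pq unfolding is_path_iff by auto
    have "card (set c \<inter> T) \<le> card ((set p \<union> set q) \<inter> T)"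
      using c(2) by (intro card_mono) auto
    then show False using bg cm c(1) unfolding big_def by force
  qed
  have wt2: "card ((set p \<union> set q) \<inter> T) \<le> Suc (wt p + wt q)" for p q
  proof -
    have "(set p \<union> set q) \<inter> T \<subseteq> insert x ((set p \<inter> T - {x}) \<union> (set q \<inter> T - {x}))" by auto
    then have "card ((set p \<union> set q) \<inter> T) \<le> card (insert x ((set p \<inter> T - {x}) \<union> (set q \<inter> T - {x})))"
      by (intro card_mono) auto
    also have "\<dots> \<le> Suc (card ((set p \<inter> T - {x}) \<union> (set q \<inter> T - {x})))"
      by (simp add: card_insert_if)
    also have "\<dots> \<le> Suc (wt p + wt q)" unfolding wt_def by (simp add: card_Un_le)
    finally show ?thesis .
  qed
  have grow: "2 * card (B t \<inter> T) + 2 \<le> card (B (Suc t) \<inter> T)" if big: "big (2 * t + 2)" for t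
  proof -
    define P where "P y = (SOME p. is_path H x p y \<and> wt p \<le> t)" for y
    have P: "is_path H x (P y) y" "wt (P y) \<le> t" if "y \<in> B t" for y
      using someI_ex[of "\<lambda>p. is_path H x p y \<and> wt p \<le> t"] that unfolding B_def P_def by auto
    define par where "par y = last (butlast (P y))" for y
    let ?in = "{e \<in> edges H. e \<subseteq> B t}"
    let ?bd = "{e \<in> edges H. e \<inter> B t \<noteq> {} \<and> \<not> e \<subseteq> B t}"
    have finE: "finite (edges H)" by (rule simple_finite_edges[OF S])
    have xB: "x \<in> B t"
    proof -
      have "is_path H x [x] x" "wt [x] \<le> t"
        using xV unfolding is_path_iff wt_def by (auto simp: Int_insert_left)
      then show ?thesis unfolding B_def by blast
    qed
    have parent: "(par v = u \<and> v \<noteq> x) \<or> (par u = v \<and> u \<noteq> x)"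
      if uv: "u \<in> B t" "v \<in> B t" "adj H u v" for u v
    proof (cases "v \<in> set (P u)")
      case False
      have q: "is_path H x (P u @ [v]) v" by (rule is_path_extend[OF S P(1)[OF uv(1)] uv(3) False])
      have "v \<in> set (P v)" using P(1)[OF uv(2)] unfolding is_path_iff by (metis last_in_set)
      then have "(set (P u @ [v]) \<union> set (P v)) \<inter> T = (set (P u) \<union> set (P v)) \<inter> T" by auto
      then have "card ((set (P u @ [v]) \<union> set (P v)) \<inter> T) \<le> 2 * t + 2"
        using wt2[of "P u" "P v"] P(2)[OF uv(1)] P(2)[OF uv(2)] by simp
      then have eq: "P u @ [v] = P v" using uniq[OF big q P(1)[OF uv(2)]] by simp
      have "x \<in> set (P u)" "last (P u) = u"
        using P(1)[OF uv(1)] unfolding is_path_iff by (metis hd_in_set, blast)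
      then have "v \<noteq> x" "par v = u" using False eq[symmetric] unfolding par_def by auto
      then show ?thesis by blast
    next
      case True
      then obtain a b where ab: "P u = a @ v # b" by (meson split_list)
      have lst: "last (P u) = u" "distinct (P u)" "hd (P u) = x"
        using P(1)[OF uv(1)] by (auto simp: is_path_iff)
      have uv': "u \<noteq> v" using simple_adjD[OF S uv(3)] by auto
      then have b: "b \<noteq> []" "u \<in> set b" using lst(1) unfolding ab by (auto split: if_splits)
      have "is_path H x (a @ [v]) v" using is_path_prefix P(1)[OF uv(1)] ab by metis
      moreover have "u \<notin> set (a @ [v])" using lst(2) b(2) unfolding ab by auto
      ultimately have q: "is_path H x ((a @ [v]) @ [u]) u"
        using is_path_extend[OF S, of x "a @ [v]" v u] uv(3) by (simp add: insert_commute)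
      have "(set ((a @ [v]) @ [u]) \<union> set (P u)) \<inter> T = (set (P u) \<union> set (P u)) \<inter> T"
        using b(2) unfolding ab by auto
      then have "card ((set ((a @ [v]) @ [u]) \<union> set (P u)) \<inter> T) \<le> 2 * t + 2"
        using wt2[of "P u" "P u"] P(2)[OF uv(1)] by simp
      then have eq: "(a @ [v]) @ [u] = P u" using uniq[OF big q P(1)[OF uv(1)]] by simp
      then have "par u = v" unfolding par_def by (metis butlast_snoc last_snoc)
      moreover have "u \<noteq> x"
        using lst(2,3) unfolding eq[symmetric] by (cases a) auto
      ultimately show ?thesis by blast
    qed
    have "?in \<subseteq> (\<lambda>y. {y, par y}) ` (B t - {x})"
    proof
      fix e assume e: "e \<in> ?in"
      then have "card e = 2" using S by (auto simp: simple_graph_def)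
      then obtain u v where uv: "e = {u, v}" by (auto simp: card_2_iff)
      then have "u \<in> B t" "v \<in> B t" "adj H u v" using e by auto
      then show "e \<in> (\<lambda>y. {y, par y}) ` (B t - {x})"
        using parent[of u v] unfolding uv by (auto simp: insert_commute)
    qed
    then have "card ?in \<le> card (B t - {x})"
      using finB[of t] by (intro order_trans[OF card_mono card_image_le]) auto
    then have in_le: "card ?in + 1 \<le> card (B t)"
      using xB finB[of t] by (metis Suc_eq_plus1 card_Suc_Diff1 Suc_le_mono)
    have degsum: "(\<Sum>v\<in>B t. deg H v) = 2 * card (B t) + card (B t \<inter> T)"
    proof (rule sum_two_three[OF finB])
      fix v assume "v \<in> B t"
      then have "v \<in> verts H" using B_sub by blast
      then show "deg H v = 2 + (if v \<in> T then 1 else 0)" using dg[of v] unfolding T by auto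
    qed
    have "{e \<in> edges H. e \<inter> B t \<noteq> {}} = ?bd \<union> ?in"
    proof -
      have "e \<noteq> {}" if "e \<in> edges H" for e using that S unfolding simple_graph_def by fastforce
      then show ?thesis by fastforce
    qed
    then have "card {e \<in> edges H. e \<inter> B t \<noteq> {}} = card ?bd + card ?in"
      using finE by (simp add: card_Un_disjoint disjoint_iff)
    then have bd: "card (B t \<inter> T) + 2 \<le> card ?bd"
      using degsum sum_deg[OF S finB[of t]] in_le by linarith
    \<comment> \<open>A second light path to the outer end of a boundary edge would close a cycle with at most
      \<open>2 * t + 2\<close> branch vertices, so the outer ends are all different. They have degree 3, since a
      vertex of degree 2 next to \<open>B t\<close> would belong to it.\<close>
    have out: "y \<in> T \<and> is_path H x (P u @ [y]) y \<and> wt (P u @ [y]) \<le> Suc t"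
      if "u \<in> B t" "y \<notin> B t" "adj H u y" for u y
    proof -
      have ny: "y \<notin> set (P u)"
      proof
        assume "y \<in> set (P u)"
        then obtain a b where ab: "P u = a @ y # b" by (meson split_list)
        have "is_path H x (a @ [y]) y" using is_path_prefix P(1)[OF that(1)] ab by metis
        moreover have "wt (a @ [y]) \<le> wt (P u)"
          unfolding wt_def ab by (intro card_mono) auto
        ultimately have "y \<in> B t" using P(2)[OF that(1)] unfolding B_def by force
        then show False using that by simp
      qed
      have q: "is_path H x (P u @ [y]) y" by (rule is_path_extend[OF S P(1)[OF that(1)] that(3) ny])
      have yT: "y \<in> T"
      proof (rule ccontr)
        assume "y \<notin> T"
        then have "wt (P u @ [y]) = wt (P u)" unfolding wt_def by (intro arg_cong[where f=card]) auto
        then show False using q P(2)[OF that(1)] that(2) unfolding B_def by auto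
      qed
      have "set (P u @ [y]) \<inter> T - {x} \<subseteq> insert y (set (P u) \<inter> T - {x})" by auto
      then have "wt (P u @ [y]) \<le> card (insert y (set (P u) \<inter> T - {x}))"
        unfolding wt_def by (intro card_mono) auto
      also have "\<dots> \<le> Suc (wt (P u))" unfolding wt_def by (simp add: card_insert_if)
      finally show ?thesis using q yT P(2)[OF that(1)] by auto
    qed
    define out_v where "out_v e = (SOME y. y \<in> e \<and> y \<notin> B t)" for e
    have ov: "\<exists>u. u \<in> B t \<and> out_v e \<notin> B t \<and> e = {u, out_v e} \<and> adj H u (out_v e)" if e: "e \<in> ?bd" for e
    proof -
      have "card e = 2" using S e by (auto simp: simple_graph_def)
      then obtain a b where ab: "e = {a, b}" by (auto simp: card_2_iff)
      have "\<exists>y. y \<in> e \<and> y \<notin> B t" using e by auto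
      then have "out_v e \<in> e \<and> out_v e \<notin> B t" unfolding out_v_def by (rule someI_ex)
      moreover obtain u where "u \<in> e" "u \<in> B t" using e by auto
      ultimately have "u \<in> B t \<and> out_v e \<notin> B t \<and> e = {u, out_v e}" using ab by auto
      then show ?thesis using e by auto
    qed
    have inj: "inj_on out_v ?bd"
    proof (rule inj_onI)
      fix e e' assume e: "e \<in> ?bd" "e' \<in> ?bd" "out_v e = out_v e'"
      let ?y = "out_v e"
      obtain u where u: "u \<in> B t" "?y \<notin> B t" "e = {u, ?y}" "adj H u ?y" using ov[OF e(1)] by blast
      obtain u' where u': "u' \<in> B t" "e' = {u', ?y}" "adj H u' ?y" using ov[OF e(2)] e(3) by metis
      note o = out[OF u(1,2,4)] and o' = out[OF u'(1) u(2) u'(3)]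
      have "(set (P u @ [?y]) \<union> set (P u' @ [?y])) \<inter> T \<subseteq> insert ?y ((set (P u) \<union> set (P u')) \<inter> T)"
        by auto
      then have "card ((set (P u @ [?y]) \<union> set (P u' @ [?y])) \<inter> T)
          \<le> card (insert ?y ((set (P u) \<union> set (P u')) \<inter> T))" by (intro card_mono) auto
      also have "\<dots> \<le> Suc (card ((set (P u) \<union> set (P u')) \<inter> T))" by (simp add: card_insert_if)
      also have "\<dots> \<le> 2 * t + 2" using wt2[of "P u" "P u'"] P(2)[OF u(1)] P(2)[OF u'(1)] by linarith
      finally have "P u @ [?y] = P u' @ [?y]" using uniq[OF big] o o' by blast
      then have "u = u'" using P(1)[OF u(1)] P(1)[OF u'(1)] by (simp add: is_path_iff)
      then show "e = e'" using u(3) u'(2) by simp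
    qed
    have img: "out_v ` ?bd \<subseteq> B (Suc t) \<inter> T - B t"
    proof
      fix y assume "y \<in> out_v ` ?bd"
      then obtain e where e: "e \<in> ?bd" "y = out_v e" by blast
      obtain u where u: "u \<in> B t" "y \<notin> B t" "adj H u y" using ov[OF e(1)] e(2) by blast
      then show "y \<in> B (Suc t) \<inter> T - B t" using out[OF u] unfolding B_def by blast
    qed
    have "card ?bd \<le> card (B (Suc t) \<inter> T - B t)"
      using card_inj_on_le[OF inj img] finB by auto
    moreover have "card (B (Suc t) \<inter> T) = card (B t \<inter> T) + card (B (Suc t) \<inter> T - B t)"
    proof -
      have "B t \<subseteq> B (Suc t)" unfolding B_def by force
      then have "B (Suc t) \<inter> T = (B t \<inter> T) \<union> (B (Suc t) \<inter> T - B t)" by auto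
      then show ?thesis using finT by (metis (no_types, lifting) Diff_disjoint Int_assoc Int_commute
            card_Un_disjoint finite_Diff finite_Int inf_bot_right)
    qed
    ultimately show ?thesis using bd by linarith
  qed
  have lower: "big (2 * t) \<Longrightarrow> 3 * 2 ^ t \<le> card (B t \<inter> T) + 2" for t
  proof (induction t)
    case 0
    have "x \<in> B 0 \<inter> T"
    proof -
      have "is_path H x [x] x" "wt [x] \<le> 0"
        using xV unfolding is_path_iff wt_def by (auto simp: Int_insert_left)
      then show ?thesis using xT unfolding B_def by blast
    qed
    then have "1 \<le> card (B 0 \<inter> T)" using finB
      by (metis One_nat_def Suc_leI card_gt_0_iff empty_iff finite_Int)
    then show ?case by simp
  next
    case (Suc t)
    then have "big (2 * t + 2)" by simp
    moreover from this have "big (2 * t)" unfolding big_def by fastforce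
    ultimately show ?case using Suc.IH grow[of t] by simp
  qed
  have upper: "card (B t \<inter> T) \<le> card T" for t using finT by (simp add: card_mono)
  have "\<exists>t. \<not> big (2 * t)"
  proof (rule ccontr)
    assume "\<not> ?thesis"
    then have "3 * 2 ^ card T \<le> card T + 2" using lower upper by (meson add_le_mono1 le_trans)
    moreover have "card T < 2 ^ card T" by (rule less_exp)
    ultimately show False using n2 by linarith
  qed
  then obtain t where t: "\<not> big (2 * t)" "\<And>s. s < t \<Longrightarrow> big (2 * s)"
    using exists_least_iff[of "\<lambda>t. \<not> big (2 * t)"] by blast
  then obtain c where c: "cyc H c" "card (set c \<inter> T) \<le> 2 * t" unfolding big_def by force
  have "2 ^ t \<le> card T"
  proof (cases t)
    case (Suc s)
    have "3 * 2 ^ s \<le> card T + 2" using lower[of s] upper[of s] t(2)[of s] Suc by simp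
    moreover have "2 * 2 ^ s \<le> (3 * 2 ^ s - 2 :: nat)" if "s \<noteq> 0"
    proof -
      have "(2::nat) ^ 1 \<le> 2 ^ s" using that by (intro power_increasing) auto
      then show ?thesis by simp
    qed
    ultimately show ?thesis using n2 Suc by (cases "s = 0") auto
  qed (use n2 in simp)
  then have "(2 ^ t)\<^sup>2 \<le> (card T)\<^sup>2" by (rule power_mono) simp
  moreover have "(2::nat) ^ card (set c \<inter> T) \<le> (2 ^ t)\<^sup>2"
    using c(2) power_increasing[of "card (set c \<inter> T)" "2 * t" "2::nat"]
      by (simp add: power_mult mult.commute)
  ultimately have "2 ^ card (set c \<inter> T) \<le> (card T)\<^sup>2" by (rule order_trans[rotated])
  then show ?thesis using c(1) by blast
qed

section \<open>Estimates for the function of Simonovits\<close>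

text \<open>
The derivative \<open>1 - 4 / (x ln 2)\<close> is positive for \<open>x \<ge> 8\<close> because \<open>ln 2 \<ge> 1/2\<close>.
\<close>

lemma minus_log_mono:
  fixes x y :: real
  assumes "8 \<le> y" "y \<le> x"
  shows "y - 4 * log 2 y \<le> x - 4 * log 2 x"
proof -
  have "log 2 x - log 2 y = log 2 (x / y)" using assms by (simp add: log_divide)
  also have "\<dots> = ln (1 + (x - y) / y) / ln 2" using assms by (simp add: log_def field_simps)
  also have "\<dots> \<le> ((x - y) / y) / ln 2"
    using assms by (intro divide_right_mono ln_add_one_self_le_self) auto
  also have "\<dots> = (x - y) / (y * ln 2)" by simp
  also have "\<dots> \<le> (x - y) / 4"
  proof -
    have "(exp (1/2 :: real))\<^sup>2 \<le> 2\<^sup>2"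
      using exp_le by (simp add: power2_eq_square flip: exp_add)
    then have "exp (1/2 :: real) \<le> 2" by (rule power2_le_imp_le) simp
    then have "(1/2 :: real) \<le> ln 2" by (subst ln_ge_iff) auto
    then have "8 * (1/2) \<le> y * ln 2" using assms by (intro mult_mono) auto
    then show ?thesis using assms by (intro divide_left_mono) auto
  qed
  finally show ?thesis by simp
qed

text \<open>
For \<open>k \<ge> 2\<close>, \<open>s_fun k\<close> is \<open>4 k\<close> times this rate, rounded up.
\<close>

definition simonovits_rate :: "nat \<Rightarrow> real" where
  "simonovits_rate k = log 2 (real k) + log 2 (log 2 (real k)) + 4"

lemma log_ge1: "2 \<le> k \<Longrightarrow> 1 \<le> log 2 (real k)"
  by (simp add: le_log_iff)

lemma simonovits_rate_ge: "2 \<le> k \<Longrightarrow> 5 \<le> simonovits_rate k"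
  using log_ge1[of k] unfolding simonovits_rate_def
    by (simp add: zero_le_log_cancel_iff add_increasing2)

lemma simonovits_rate_mono: 
  assumes "2 \<le> k" shows "simonovits_rate k \<le> simonovits_rate (Suc k)"
proof -
  have a: "log 2 (real k) \<le> log 2 (real (Suc k))" using assms by simp
  have "log 2 (log 2 (real k)) \<le> log 2 (log 2 (real (Suc k)))"
    using log_ge1[OF assms] a assms by (subst log_le_cancel_iff) auto
  then show ?thesis using a unfolding simonovits_rate_def by linarith
qed

text \<open>
This is \<open>log log k + 4 \<le> 3 log k\<close> in disguise. It fails for \<open>k = 2\<close> and is nearly tight for
\<open>k = 3\<close>, where it amounts to \<open>3 ^ 16 \<le> 2 ^ 27\<close>.
\<close>

lemma log_le_cube:
  assumes "3 \<le> k" shows "log 2 (real k) \<le> real k ^ 3 / 16"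
proof (cases "k = 3")
  case True
  have "log 2 (3::real) = log 2 (3 ^ 16) / 16" by (subst log_nat_power) auto
  also have "\<dots> \<le> log 2 (2 ^ 27) / 16"
    by (intro divide_right_mono) (subst log_le_cancel_iff, auto)
  also have "\<dots> = 27 / 16" by (subst log_nat_power) auto
  finally show ?thesis using True by simp
next
  case False
  have "real k \<le> 2 ^ k" by (metis less_exp less_imp_le of_nat_le_iff of_nat_numeral of_nat_power)
  then have "log 2 (real k) \<le> log 2 (2 ^ k)" using assms by (subst log_le_cancel_iff) auto
  also have "\<dots> = real k" by (subst log_nat_power) auto
  also have "\<dots> \<le> real k * (real k * real k) / 16"
  proof -
    have "4 * 4 \<le> real k * real k" using False assms by (intro mult_mono) auto
    then have "real k * 16 \<le> real k * (real k * real k)" by (intro mult_left_mono) auto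
    then show ?thesis by simp
  qed
  finally show ?thesis by (simp add: power3_eq_cube)
qed

text \<open>
The right-hand side is the logarithm of \<open>16 k log k\<close>, and the rate is at most \<open>4 log k\<close>.
\<close>

lemma log_simonovits:
  assumes "3 \<le> k" shows "log 2 (4 * real k * simonovits_rate k) \<le> simonovits_rate k"
proof -
  have l: "1 \<le> log 2 (real k)" using log_ge1 assms by simp
  have "log 2 (log 2 (real k)) \<le> log 2 (real k ^ 3 / 16)"
    using log_le_cube[OF assms] l assms by (subst log_le_cancel_iff) auto
  also have "\<dots> = 3 * log 2 (real k) - log 2 (2 ^ 4)"
    using assms by (subst log_divide) (auto simp: log_nat_power)
  also have "log 2 (2 ^ 4 :: real) = 4" by (subst log_nat_power) auto
  finally have r: "simonovits_rate k \<le> 4 * log 2 (real k)" unfolding simonovits_rate_def by simp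
  have "4 * real k * simonovits_rate k \<le> 4 * real k * (4 * log 2 (real k))"
    using r by (intro mult_left_mono) auto
  then have "log 2 (4 * real k * simonovits_rate k) \<le> log 2 (2 ^ 4 * (real k * log 2 (real k)))"
    using simonovits_rate_ge[of k] assms l by (subst log_le_cancel_iff) auto
  also have "\<dots> = 4 + (log 2 (real k) + log 2 (log 2 (real k)))"
  proof -
    have "log 2 (2 ^ 4 * (real k * log 2 (real k))) = log 2 (2 ^ 4) + log 2 (real k * log 2 (real k))"
      using assms l by (intro log_mult_pos) (auto intro!: mult_pos_pos)
    also have "log 2 (real k * log 2 (real k)) = log 2 (real k) + log 2 (log 2 (real k))"
      using assms l by (intro log_mult_pos) auto
    also have "log 2 (2 ^ 4 :: real) = 4" by (subst log_nat_power) auto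
    finally show ?thesis .
  qed
  finally show ?thesis unfolding simonovits_rate_def by simp
qed

lemma s_fun_ge: "1 \<le> k \<Longrightarrow> 2 \<le> s_fun k"
proof -
  assume k: "1 \<le> k"
  show ?thesis
  proof (cases "k = 1")
    case False
    then have "2 \<le> k" using k by simp
    then have "4 * 2 * 5 \<le> 4 * real k * simonovits_rate k" using simonovits_rate_ge[of k]
      by (intro mult_mono) auto
    then have "2 \<le> nat \<lceil>4 * real k * simonovits_rate k\<rceil>" by linarith
    then show ?thesis using False unfolding s_fun_def simonovits_rate_def by simp
  qed (simp add: s_fun_def)
qed

text \<open>
The loss caused by removing a cycle with \<open>c \<le> 2 log n\<close> branch vertices from a graph with \<open>n\<close>
branch vertices. Since \<open>n - 4 log n\<close> increases, the worst case is \<open>n = 4 k r\<close> for the rate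
\<open>r\<close> (or the integer above). For \<open>k \<ge> 3\<close> then \<open>log n \<le> r\<close>, while passing from \<open>k\<close> to \<open>k - 1\<close>
gains at least \<open>4 r\<close>; for \<open>k = 2\<close> the numbers are explicit.
\<close>

lemma s_fun_step:
  assumes k: "2 \<le> k" and n: "s_fun k \<le> n" and c: "2 ^ c \<le> n\<^sup>2"
  shows "s_fun (k - 1) + 2 * c \<le> n"
proof -
  have np: "0 < n" using s_fun_ge[of k] k n by simp
  have "log 2 (2 ^ c) \<le> log 2 (real n ^ 2)"
  proof (subst log_le_cancel_iff)
    have "real (2 ^ c) \<le> real (n\<^sup>2)" using c by (subst of_nat_le_iff)
    then show "2 ^ c \<le> (real n)\<^sup>2" by simp
  qed (use np in auto)
  then have c': "real c \<le> 2 * log 2 (real n)" using np by (simp add: log_nat_power)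
  have sk: "s_fun k = nat \<lceil>4 * real k * simonovits_rate k\<rceil>" using k
    unfolding s_fun_def simonovits_rate_def by simp
  have ge: "4 * 2 * 5 \<le> 4 * real k * simonovits_rate k" using k simonovits_rate_ge[of k]
    by (intro mult_mono) auto
  have n': "4 * real k * simonovits_rate k \<le> real n" using n unfolding sk by linarith
  have mono: "4 * real k * simonovits_rate k - 4 * log 2 (4 * real k * simonovits_rate k) \<le> real n - 4 * log 2 (real n)"
    using minus_log_mono[OF _ n'] ge by simp
  show ?thesis
  proof (cases "k = 2")
    case True
    have "log 2 (40::real) \<le> log 2 (2 ^ 6)" by (subst log_le_cancel_iff) auto
    also have "\<dots> = 6" by (subst log_nat_power) auto
    finally have "log 2 (40::real) \<le> 6" .
    moreover have "40 - 4 * log 2 40 \<le> real n - 4 * log 2 (real n)"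
      using minus_log_mono[of 40 "real n"] ge n' by simp
    ultimately have "real (2 + 2 * c) \<le> real n" using c' by simp
    then show ?thesis using True unfolding s_fun_def by (simp only: of_nat_le_iff) simp
  next
    case False
    then have k3: "3 \<le> k" using k by simp
    then obtain j where j: "k = Suc j" "2 \<le> j" by (cases k) auto
    have "4 * real j * simonovits_rate j \<le> 4 * real j * simonovits_rate k"
      using simonovits_rate_mono[OF j(2)] j(1) by (intro mult_left_mono) auto
    also have "\<dots> = 4 * real k * simonovits_rate k - 4 * simonovits_rate k" unfolding j(1)
      by (simp add: algebra_simps)
    also have "\<dots> \<le> 4 * real k * simonovits_rate k - 4 * log 2 (4 * real k * simonovits_rate k)"
      using log_simonovits[OF k3] by simp
    also have "\<dots> \<le> real n - 4 * log 2 (real n)" by (rule mono)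
    also have "\<dots> \<le> real_of_int (int n - 2 * int c)" using c' by simp
    finally have "\<lceil>4 * real j * simonovits_rate j\<rceil> \<le> int n - 2 * int c" by (simp only: ceiling_le_iff)
    moreover have "0 \<le> 4 * real j * simonovits_rate j" using simonovits_rate_ge[OF j(2)] by simp
    ultimately have "int (nat \<lceil>4 * real j * simonovits_rate j\<rceil>) + 2 * int c \<le> int n" by linarith
    moreover have "s_fun (k - 1) = nat \<lceil>4 * real j * simonovits_rate j\<rceil>"
      using j unfolding s_fun_def simonovits_rate_def by simp
    ultimately show ?thesis by linarith
  qed
qed

section \<open>Disjoint cycles in graphs of maximum degree three\<close>

lemma simple_delete: "simple_graph G \<Longrightarrow> simple_graph (delete_verts G S)"
  unfolding simple_graph_def delete_verts_def by auto

lemma delete_edges: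
  assumes "simple_graph G"
  shows "edges (delete_verts G S) = {e \<in> edges G. e \<inter> S = {}}"
  using assms unfolding simple_graph_def delete_verts_def by fastforce

lemma cycle_in_delete: "simple_graph G \<Longrightarrow> cycle_in (delete_verts G S) C \<Longrightarrow> cycle_in G C \<and> verts C \<inter> S = {}"
  unfolding cycle_in_def subgraph_def delete_verts_def by auto

lemma deg_delete:
  assumes "simple_graph G" shows "deg (delete_verts G S) v \<le> deg G v"
  unfolding deg_def delete_edges[OF assms]
  using simple_finite_edges[OF assms] by (intro card_mono) auto

lemma excess_delete_vertex:
  "(E::int) \<le> E' + 1 \<Longrightarrow> V = V' + 1 \<Longrightarrow> s \<le> 2 * (E - V) \<Longrightarrow> s \<le> 2 * (E' - V')"
  by presburger

lemma excess_delete_cycle: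
  "int t = 2 * (int E - int V) \<Longrightarrow> E \<le> E' + m \<Longrightarrow> V' + l = V \<Longrightarrow> m \<le> l + c \<Longrightarrow>
   int t - 2 * int c \<le> 2 * (int E' - int V')"
  by presburger

text \<open>
Simonovits' theorem, with the number of branch vertices replaced by twice the excess
\<open>|E| - |V|\<close>; the two agree once all degrees are 2 or 3. Deleting a vertex of degree at most 1 does
not decrease the excess. Deleting the vertices of a cycle with \<open>c\<close> branch vertices decreases it by
at most \<open>c\<close>, since each branch vertex has only one edge outside of the cycle. So subdivided
edges never have to be suppressed, and the graphs remain simple.
\<close>

lemma disjoint_cycles:
  fixes H :: "'a graph"
  assumes "simple_graph H" "\<And>v. v \<in> verts H \<Longrightarrow> deg H v \<le> 3" "1 \<le> k"
    "int (s_fun k) \<le> 2 * (int (card (edges H)) - int (card (verts H)))"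
  shows "\<exists>\<C>. card \<C> = k \<and> (\<forall>C\<in>\<C>. cycle_in H C) \<and>
            (\<forall>C\<in>\<C>. \<forall>C'\<in>\<C>. C \<noteq> C' \<longrightarrow> verts C \<inter> verts C' = {})"
  using assms
proof (induction "card (verts H)" arbitrary: H k rule: less_induct)
  case less
  note S = less.prems(1) and d3 = less.prems(2) and k1 = less.prems(3) and ex = less.prems(4)
  have finV: "finite (verts H)" using S by (simp add: simple_graph_def)
  have finE: "finite (edges H)" by (rule simple_finite_edges[OF S])
  show ?case
  proof (cases "\<exists>v\<in>verts H. deg H v \<le> 1")
    case True
    then obtain v where v: "v \<in> verts H" "deg H v \<le> 1" by blast
    let ?H = "delete_verts H {v}"
    have cV: "Suc (card (verts ?H)) = card (verts H)"
      using v(1) finV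
        by (simp add: delete_verts_def card_Suc_Diff1 del: card_Diff_singleton card_Diff_insert)
    have "edges H = edges ?H \<union> {e \<in> edges H. v \<in> e}" unfolding delete_edges[OF S] by auto
    then have "card (edges H) \<le> card (edges ?H) + deg H v"
      unfolding deg_def by (metis card_Un_le)
    then have ex': "int (s_fun k) \<le> 2 * (int (card (edges ?H)) - int (card (verts ?H)))"
    proof -
      have "int (card (edges H)) \<le> int (card (edges ?H)) + 1" using \<open>card (edges H) \<le> _\<close> v(2)
        by linarith
      moreover have "int (card (verts H)) = int (card (verts ?H)) + 1" using cV by linarith
      ultimately show ?thesis by (rule excess_delete_vertex[OF _ _ ex])
    qed
    have "\<exists>\<C>. card \<C> = k \<and> (\<forall>C\<in>\<C>. cycle_in ?H C) \<and>
            (\<forall>C\<in>\<C>. \<forall>C'\<in>\<C>. C \<noteq> C' \<longrightarrow> verts C \<inter> verts C' = {})"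
    proof (rule less.hyps[OF _ simple_delete[OF S] _ k1 ex'])
      show "card (verts ?H) < card (verts H)" using cV by simp
      fix u assume "u \<in> verts ?H"
      then show "deg ?H u \<le> 3" using d3[of u] deg_delete[OF S, of "{v}" u]
        by (auto simp: delete_verts_def)
    qed
    then show ?thesis using cycle_in_delete[OF S] by blast
  next
    case False
    define T where "T = {v \<in> verts H. deg H v = 3}"
    have dg: "deg H v = 2 \<or> deg H v = 3" if "v \<in> verts H" for v
    proof -
      have "\<not> deg H v \<le> 1" using False that by blast
      then show ?thesis using d3[OF that] by linarith
    qed
    have sum2: "(\<Sum>v\<in>W. deg H v) = 2 * card W + card (W \<inter> T)" if "W \<subseteq> verts H" for W
    proof (rule sum_two_three[OF finite_subset[OF that finV]])
      fix v assume "v \<in> W"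
      then have "v \<in> verts H" using that by blast
      then show "deg H v = 2 + (if v \<in> T then 1 else 0)" using dg[of v] unfolding T_def by auto
    qed
    have "{e \<in> edges H. e \<inter> verts H \<noteq> {}} = edges H" "{e \<in> edges H. e \<subseteq> verts H} = edges H"
      using edge_in_verts[OF S] by blast+
    then have "2 * card (edges H) = 2 * card (verts H) + card (verts H \<inter> T)"
      using sum_deg[OF S finV] sum2[of "verts H"] by simp
    moreover have "verts H \<inter> T = T" unfolding T_def by auto
    ultimately have n: "int (card T) = 2 * (int (card (edges H)) - int (card (verts H)))" by simp
    then have sn: "s_fun k \<le> card T" using ex by linarith
    then have "2 \<le> card T" using s_fun_ge[OF k1] by linarith
    then obtain c where c: "cyc H c" "2 ^ card (set c \<inter> T) \<le> (card T)\<^sup>2"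
      using few_branch_cycle[OF S dg T_def] by blast
    show ?thesis
    proof (cases "k = 1")
      case True
      then show ?thesis using c(1) cycle_in_iff[OF S] by (intro exI[of _ "{cyc_graph c}"]) auto
    next
      case False
      then have k2: "2 \<le> k" using k1 by simp
      let ?H = "delete_verts H (set c)"
      have cs: "set c \<subseteq> verts H" by (rule cyc_verts[OF S c(1)])
      have cl: "card (set c) = length c" "0 < length c" using c(1) by (auto simp: cyc_def distinct_card)
      have cV: "card (verts ?H) + length c = card (verts H)"
        using cs finV cl card_mono[OF finV cs] by (simp add: delete_verts_def card_Diff_subset)
      let ?tch = "{e \<in> edges H. e \<inter> set c \<noteq> {}}" and ?ins = "{e \<in> edges H. e \<subseteq> set c}"
      have "edges H = edges ?H \<union> ?tch" unfolding delete_edges[OF S] by auto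
      then have e1: "card (edges H) \<le> card (edges ?H) + card ?tch" by (metis card_Un_le)
      have "edges (cyc_graph c) \<subseteq> ?ins"
        using c(1) simple_cyc_graph[OF c(1)] unfolding cyc_iff_edges simple_graph_def by auto
      then have "length c \<le> card ?ins"
        using cyc_deg(1)[OF c(1)] finE card_mono[of ?ins "edges (cyc_graph c)"] by simp
      then have "card ?tch \<le> length c + card (set c \<inter> T)"
        using sum_deg[OF S, of "set c"] sum2[OF cs] cl by simp
      then have "int (card T) - 2 * int (card (set c \<inter> T))
          \<le> 2 * (int (card (edges ?H)) - int (card (verts ?H)))"
        by (rule excess_delete_cycle[OF n e1 cV])
      then have ex': "int (s_fun (k - 1)) \<le> 2 * (int (card (edges ?H)) - int (card (verts ?H)))"
        using s_fun_step[OF k2 sn c(2)] by linarith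
      have "\<exists>\<C>. card \<C> = k - 1 \<and> (\<forall>C\<in>\<C>. cycle_in ?H C) \<and>
              (\<forall>C\<in>\<C>. \<forall>C'\<in>\<C>. C \<noteq> C' \<longrightarrow> verts C \<inter> verts C' = {})"
      proof (rule less.hyps[OF _ simple_delete[OF S] _ _ ex'])
        show "card (verts ?H) < card (verts H)"
          unfolding cV[symmetric] using cl(2) by (rule less_add_same_cancel1[THEN iffD2])
        show "1 \<le> k - 1" using k2 by simp
        fix u assume "u \<in> verts ?H"
        then show "deg ?H u \<le> 3" using d3[of u] deg_delete[OF S, of "set c" u]
          by (auto simp: delete_verts_def)
      qed
      then obtain \<C> where C: "card \<C> = k - 1" "\<forall>C\<in>\<C>. cycle_in ?H C"
        "\<forall>C\<in>\<C>. \<forall>C'\<in>\<C>. C \<noteq> C' \<longrightarrow> verts C \<inter> verts C' = {}" by blast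
      have C': "\<forall>C\<in>\<C>. cycle_in H C \<and> verts C \<inter> set c = {}" using C(2) cycle_in_delete[OF S] by blast
      have "cyc_graph c \<notin> \<C>" using C' cyc_nonempty[OF c(1)] by force
      moreover have "finite \<C>" using C(1) k2 by (intro card_ge_0_finite) simp
      ultimately have "card (insert (cyc_graph c) \<C>) = k" using C(1) k2 by simp
      then show ?thesis using C(3) C' c(1) cycle_in_iff[OF S]
        by (intro exI[of _ "insert (cyc_graph c) \<C>"]) (auto simp: Int_commute)
    qed
  qed
qed

section \<open>Distant cycles from distant ears\<close>

fun path_edges :: "'a list \<Rightarrow> 'a set set" where
  "path_edges (x # y # q) = insert {x, y} (path_edges (y # q))"
| "path_edges _ = {}"

lemma path_edges_subset_set: "e \<in> path_edges p \<Longrightarrow> e \<subseteq> set p"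
  by (induction p rule: path_edges.induct) auto

lemma finite_path_edges [simp]: "finite (path_edges p)"
  by (induction p rule: path_edges.induct) auto

lemma path_edges_subset_edges: "walk G p \<longleftrightarrow> path_edges p \<subseteq> edges G"
  by (induction p rule: path_edges.induct) (auto simp: successively_Cons)

lemma card_path_edges: "distinct p \<Longrightarrow> card (path_edges p) = length p - 1"
proof (induction p rule: path_edges.induct)
  case (1 x y q)
  have "{x, y} \<notin> path_edges (y # q)" using path_edges_subset_set[of "{x,y}" "y # q"] 1(2) by auto
  then show ?case using 1 by simp
qed auto

lemma path_edges_nth: "Suc i < length p \<Longrightarrow> {p ! i, p ! Suc i} \<in> path_edges p"
proof (induction p arbitrary: i rule: path_edges.induct)
  case (1 x y q)
  then show ?case by (cases i) auto
qed auto

lemma card_insert_Suc: "card (insert a A) \<le> Suc (card A)"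
  by (cases "finite A") (auto simp: card_insert_if)

lemma path_edges_deg:
  assumes "distinct p"
  shows "card {e \<in> path_edges p. v \<in> e} \<le> 2"
    "v = hd p \<Longrightarrow> card {e \<in> path_edges p. v \<in> e} \<le> 1"
    "v = last p \<Longrightarrow> card {e \<in> path_edges p. v \<in> e} \<le> 1"
proof -
  have "card {e \<in> path_edges p. v \<in> e} \<le> 2 \<and> (v = hd p \<longrightarrow> card {e \<in> path_edges p. v \<in> e} \<le> 1)
     \<and> (v = last p \<longrightarrow> card {e \<in> path_edges p. v \<in> e} \<le> 1)"
    using assms
  proof (induction p rule: path_edges.induct)
    case (1 x y q)
    have IH: "card {e \<in> path_edges (y # q). v \<in> e} \<le> 2"
      "v = y \<Longrightarrow> card {e \<in> path_edges (y # q). v \<in> e} \<le> 1"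
      "v = last (y # q) \<Longrightarrow> card {e \<in> path_edges (y # q). v \<in> e} \<le> 1"
      using 1 by auto
    have x: "e \<in> path_edges (y # q) \<Longrightarrow> x \<notin> e" for e using path_edges_subset_set[of e "y # q"] 1(2)
      by auto
    consider "v = x" | "v = y" "q = []" | "v = y" "q \<noteq> []" | "v \<noteq> x" "v \<noteq> y" by blast
    then show ?case
    proof cases
      case 1
      then have eq: "{e \<in> path_edges (x # y # q). v \<in> e} = {{x, y}}" using x by auto
      show ?thesis unfolding eq by simp
    next
      case 2
      then have eq: "{e \<in> path_edges (x # y # q). v \<in> e} = {{x, y}}" by auto
      show ?thesis unfolding eq by simp
    next
      case 3
      have eq: "{e \<in> path_edges (x # y # q). v \<in> e} = insert {x, y} {e \<in> path_edges (y # q). v \<in> e}"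
        using 3 by auto
      have "card {e \<in> path_edges (x # y # q). v \<in> e} \<le> Suc (card {e \<in> path_edges (y # q). v \<in> e})"
        unfolding eq by (rule card_insert_Suc)
      then have a: "card {e \<in> path_edges (x # y # q). v \<in> e} \<le> 2" using IH(2)[OF 3(1)] by linarith
      have "v \<noteq> last (x # y # q)" "v \<noteq> hd (x # y # q)" using 3 1(2) by auto
      then show ?thesis using a by blast
    next
      case 4
      then have eq: "{e \<in> path_edges (x # y # q). v \<in> e} = {e \<in> path_edges (y # q). v \<in> e}" by auto
      have "v \<noteq> hd (x # y # q)" "last (x # y # q) = last (y # q)" using 4 by auto
      then show ?thesis unfolding eq using IH by metis
    qed
  qed auto
  then show "card {e \<in> path_edges p. v \<in> e} \<le> 2"
    "v = hd p \<Longrightarrow> card {e \<in> path_edges p. v \<in> e} \<le> 1"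
    "v = last p \<Longrightarrow> card {e \<in> path_edges p. v \<in> e} \<le> 1" by auto
qed

lemma dist_sets_gt:
  assumes "simple_graph G" "X \<subseteq> verts G" "\<And>x y. x \<in> X \<Longrightarrow> y \<in> Y \<Longrightarrow> \<not> near G d x y"
  shows "enat d < dist_sets G X Y"
proof -
  have "enat (Suc d) \<le> dist_graph G x y" if "x \<in> X" "y \<in> Y" for x y
    using assms(3)[OF that] dist_le_iff[OF assms(1), of x y d] that assms(2)
    by (auto simp: Suc_ile_eq not_le[symmetric])
  then have "enat (Suc d) \<le> dist_sets G X Y"
    unfolding dist_sets_def by (intro INF_greatest) auto
  then show ?thesis by (simp add: Suc_ile_eq)
qed

lemma d_packingI:
  assumes "simple_graph G" "\<And>C. C \<in> \<C> \<Longrightarrow> cycle_in G C"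
    "\<And>C C' x y. C \<in> \<C> \<Longrightarrow> C' \<in> \<C> \<Longrightarrow> C \<noteq> C' \<Longrightarrow> x \<in> verts C \<Longrightarrow> y \<in> verts C' \<Longrightarrow> \<not> near G d x y"
  shows "d_packing d G \<C>"
  unfolding d_packing_def
proof (intro conjI ballI impI)
  fix C C' assume "C \<in> \<C>" "C' \<in> \<C>" "C \<noteq> C'"
  moreover have "verts C \<subseteq> verts G"
    using assms(2)[OF \<open>C \<in> \<C>\<close>] unfolding cycle_in_def subgraph_def by auto
  ultimately show "enat d < dist_sets G (verts C) (verts C')"
    using assms(3) by (intro dist_sets_gt[OF assms(1)]) blast+
qed (rule assms(2))

lemma family_packing:
  assumes S: "simple_graph G" and cy: "\<And>t. t \<in> K \<Longrightarrow> cyc G (q t)"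
    and far: "\<And>t t' x y. t \<in> K \<Longrightarrow> t' \<in> K \<Longrightarrow> t \<noteq> t' \<Longrightarrow> x \<in> set (q t) \<Longrightarrow> y \<in> set (q t') \<Longrightarrow> \<not> near G d x y"
  shows "\<exists>\<C>. d_packing d G \<C> \<and> card \<C> = card K"
proof -
  have "d_packing d G ((\<lambda>t. cyc_graph (q t)) ` K)"
  proof (rule d_packingI[OF S])
    fix \<Gamma> assume "\<Gamma> \<in> (\<lambda>t. cyc_graph (q t)) ` K"
    then show "cycle_in G \<Gamma>" using cy cycle_in_iff[OF S] by blast
  next
    fix \<Gamma> \<Gamma>' x y assume h: "\<Gamma> \<in> (\<lambda>t. cyc_graph (q t)) ` K" "\<Gamma>' \<in> (\<lambda>t. cyc_graph (q t)) ` K" "\<Gamma> \<noteq> \<Gamma>'"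
      "x \<in> verts \<Gamma>" "y \<in> verts \<Gamma>'"
    then obtain t t' where "t \<in> K" "t' \<in> K" "\<Gamma> = cyc_graph (q t)" "\<Gamma>' = cyc_graph (q t')" by blast
    then show "\<not> near G d x y" using h far[of t t' x y] by auto
  qed
  moreover have "inj_on (\<lambda>t. cyc_graph (q t)) K"
  proof (rule inj_onI, rule ccontr)
    fix t t' assume h: "t \<in> K" "t' \<in> K" "cyc_graph (q t) = cyc_graph (q t')" "t \<noteq> t'"
    have "set (q t) = set (q t')" using arg_cong[OF h(3), of verts] by simp
    moreover have "hd (q t) \<in> set (q t)" using cyc_nonempty[OF cy[OF h(1)]] by simp
    ultimately show False using far[OF h(1,2,4), of "hd (q t)" "hd (q t)"] by auto
  qed
  then have "card ((\<lambda>t. cyc_graph (q t)) ` K) = card K" by (rule card_image)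
  ultimately show ?thesis by blast
qed

text \<open>
The cycle occupies two edges at \<open>v\<close>, and the edge to \<open>w\<close> is a third one.
\<close>

lemma cycle_exit_deg:
  assumes S: "simple_graph H" and "cycle_in H \<Gamma>" "v \<in> verts \<Gamma>" "adj H v w" "w \<notin> verts \<Gamma>"
  shows "3 \<le> deg H v"
proof -
  obtain p where p: "cyc H p" "\<Gamma> = cyc_graph p" using assms cycle_in_iff by blast
  have "2 \<le> card {e \<in> edges (cyc_graph p). v \<in> e}" using cyc_deg_ge2[OF S p(1)] assms(3) p(2) by simp
  moreover have "{v, w} \<notin> {e \<in> edges (cyc_graph p). v \<in> e}"
    using edge_in_verts(1)[OF simple_cyc_graph[OF p(1)], of "{v,w}"] assms(5) p(2) by auto
  moreover have fin: "finite (edges H)" by (rule simple_finite_edges[OF S])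
  moreover have sub: "edges (cyc_graph p) \<subseteq> edges H" using p(1) by (simp add: cyc_iff_edges)
  ultimately have "3 \<le> card (insert {v, w} {e \<in> edges (cyc_graph p). v \<in> e})"
    using finite_subset[OF sub fin] by (simp add: card_insert_if)
  also have "\<dots> \<le> deg H v" unfolding deg_def
    using fin sub assms(4) by (intro card_mono) auto
  finally show ?thesis .
qed

text \<open>
The union \<open>H\<close> of the cycles and the ears has maximum degree 3, and every ear raises its excess
by one, so \<open>H\<close> has \<open>k\<close> disjoint cycles. They are far apart in \<open>G\<close> for the following reason.
A cycle of \<open>H\<close> that contains an inner vertex of an ear contains the whole ear. So if \<open>x\<close> and \<open>y\<close>
lie on different cycles of \<open>H\<close> and have distance at most \<open>d\<close>, then not both are inner vertices
of ears, and if \<open>x\<close> is one, it can be replaced by an end of the ear at distance at most \<open>2 d\<close>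
from \<open>y\<close>. Now both lie on the same member of \<open>\<P>\<close>, joined by an arc of length at most \<open>2 d\<close>. On
this arc, the one cycle of \<open>H\<close> is left and the other one entered, both at ends of ears; but these
are more than \<open>2 d\<close> apart.
\<close>

lemma fat_ears:
  fixes G :: "'a graph"
  assumes S: "simple_graph G" and d1: "1 \<le> d" and k1: "1 \<le> k"
    and finP: "finite \<P>" and cycP: "\<And>p. p \<in> \<P> \<Longrightarrow> cyc G p"
    and sep: "\<And>p q x y. p \<in> \<P> \<Longrightarrow> q \<in> \<P> \<Longrightarrow> p \<noteq> q \<Longrightarrow> x \<in> set p \<Longrightarrow> y \<in> set q \<Longrightarrow> \<not> near G (2 * d) x y"
    and iso: "\<And>p x y n. p \<in> \<P> \<Longrightarrow> x \<in> set p \<Longrightarrow> y \<in> set p \<Longrightarrow> near G n x y \<Longrightarrow> n \<le> 2 * d \<Longrightarrow> near (cyc_graph p) n x y"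
    and C: "C = \<Union> (set ` \<P>)"
    and finE: "finite \<E>"
    and ear: "\<And>P. P \<in> \<E> \<Longrightarrow> distinct P \<and> walk G P \<and> 2 \<le> length P \<and> hd P \<in> C \<and> last P \<in> C
        \<and> set P \<inter> C \<subseteq> {hd P, last P} \<and> \<not> near G (2 * d) (hd P) (last P)"
    and far: "\<And>P Q x y. P \<in> \<E> \<Longrightarrow> Q \<in> \<E> \<Longrightarrow> P \<noteq> Q \<Longrightarrow> x \<in> set P \<Longrightarrow> y \<in> set Q \<Longrightarrow> \<not> near G d x y"
    and att_far: "\<And>P Q x y. P \<in> \<E> \<Longrightarrow> Q \<in> \<E> \<Longrightarrow> P \<noteq> Q \<Longrightarrow> x \<in> {hd P, last P} \<Longrightarrow> y \<in> {hd Q, last Q}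
        \<Longrightarrow> \<not> near G (2 * d) x y"
    and clean: "\<And>P x y. P \<in> \<E> \<Longrightarrow> x \<in> set P \<Longrightarrow> y \<in> C \<Longrightarrow> near G d x y \<Longrightarrow>
        \<exists>a\<in>{hd P, last P}. near G (2 * d) a y"
    and many: "s_fun k \<le> 2 * card \<E>"
  shows "\<exists>\<C>. d_packing d G \<C> \<and> card \<C> = k"
proof -
  define EC where "EC = (\<Union>p\<in>\<P>. edges (cyc_graph p))"
  define EP where "EP = (\<Union>P\<in>\<E>. path_edges P)"
  define H where "H = \<lparr>verts = C \<union> \<Union> (set ` \<E>), edges = EC \<union> EP\<rparr>"
  define att where "att v \<longleftrightarrow> (\<exists>P\<in>\<E>. v \<in> {hd P, last P})" for v
  have C_cases: "\<exists>p\<in>\<P>. v \<in> set p" if "v \<in> C" for v using that C by auto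
  have uniqp: "p = q" if "p \<in> \<P>" "q \<in> \<P>" "v \<in> set p" "v \<in> set q" for p q v
    using sep[of p q v v] that by auto
  have uniqP: "P = Q" if "P \<in> \<E>" "Q \<in> \<E>" "v \<in> set P" "v \<in> set Q" for P Q v
    using far[of P Q v v] that by auto
  have EC_G: "EC \<subseteq> edges G" using cycP unfolding EC_def cyc_iff_edges by blast
  have EP_G: "EP \<subseteq> edges G" using ear path_edges_subset_edges unfolding EP_def by blast
  have HG: "edges H \<subseteq> edges G" using EC_G EP_G by (simp add: H_def)
  have EC_sub: "e \<subseteq> set p" if "p \<in> \<P>" "e \<in> edges (cyc_graph p)" for p e
    using edge_in_verts(1)[OF simple_cyc_graph[OF cycP[OF that(1)]] that(2)] by simp
  have two: "card e = 2" if "e \<in> edges G" for e using that S by (simp add: simple_graph_def)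
  have SH: "simple_graph H"
    unfolding simple_graph_def
  proof (intro conjI ballI)
    show "finite (verts H)" using finP finE unfolding H_def C by auto
    fix e assume e: "e \<in> edges H"
    then show "card e = 2" using HG two by blast
    show "e \<subseteq> verts H"
      using e EC_sub path_edges_subset_set unfolding H_def EC_def EP_def C by fastforce
  qed
  have ear_C: "v \<in> {hd P, last P}" if "P \<in> \<E>" "v \<in> set P" "v \<in> C" for P v
    using ear[OF that(1)] that by blast
  have ends_C: "v \<in> C" "v \<in> set P" if "P \<in> \<E>" "v \<in> {hd P, last P}" for P v
  proof -
    have "P \<noteq> []" using ear[OF that(1)] by auto
    then show "v \<in> C" "v \<in> set P" using ear[OF that(1)] that(2) by auto
  qed
  \<comment> \<open>The cycles have as many edges as vertices; an ear has one edge more than it has inner vertices.\<close>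
  have cardEC: "card EC = (\<Sum>p\<in>\<P>. length p)"
  proof -
    have "card EC = (\<Sum>p\<in>\<P>. card (edges (cyc_graph p)))"
      unfolding EC_def
    proof (rule card_UN_disjoint[OF finP])
      show "\<forall>i\<in>\<P>. finite (edges (cyc_graph i))" using simple_finite_edges[OF simple_cyc_graph[OF cycP]]
        by blast
      show "\<forall>i\<in>\<P>. \<forall>j\<in>\<P>. i \<noteq> j \<longrightarrow> edges (cyc_graph i) \<inter> edges (cyc_graph j) = {}"
      proof (intro ballI impI)
        fix p q assume pq: "p \<in> \<P>" "q \<in> \<P>" "p \<noteq> q"
        show "edges (cyc_graph p) \<inter> edges (cyc_graph q) = {}"
        proof (rule ccontr)
          assume "\<not> ?thesis"
          then obtain e where e: "e \<in> edges (cyc_graph p)" "e \<in> edges (cyc_graph q)" by blast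
          then have "e \<noteq> {}" using two EC_G pq(1) unfolding EC_def by fastforce
          then show False using EC_sub[OF pq(1) e(1)] EC_sub[OF pq(2) e(2)] uniqp[OF pq(1,2)] pq(3)
            by blast
        qed
      qed
    qed
    also have "\<dots> = (\<Sum>p\<in>\<P>. length p)" using cyc_deg(1)[OF cycP] by (intro sum.cong) auto
    finally show ?thesis .
  qed
  have cardEP: "card EP = (\<Sum>P\<in>\<E>. length P - 2) + card \<E>"
  proof -
    have "card EP = (\<Sum>P\<in>\<E>. card (path_edges P))"
      unfolding EP_def
    proof (rule card_UN_disjoint[OF finE])
      show "\<forall>i\<in>\<E>. \<forall>j\<in>\<E>. i \<noteq> j \<longrightarrow> path_edges i \<inter> path_edges j = {}"
      proof (intro ballI impI)
        fix p q assume pq: "p \<in> \<E>" "q \<in> \<E>" "p \<noteq> q"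
        show "path_edges p \<inter> path_edges q = {}"
        proof (rule ccontr)
          assume "\<not> ?thesis"
          then obtain e where e: "e \<in> path_edges p" "e \<in> path_edges q" by blast
          then have "e \<noteq> {}" using two EP_G pq(1) unfolding EP_def by fastforce
          then show False
            using path_edges_subset_set[OF e(1)] path_edges_subset_set[OF e(2)] uniqP[OF pq(1,2)] pq(3)
              by blast
        qed
      qed
    qed auto
    also have "\<dots> = (\<Sum>P\<in>\<E>. (length P - 2) + 1)"
    proof (rule sum.cong[OF refl])
      fix P assume "P \<in> \<E>"
      then show "card (path_edges P) = length P - 2 + 1" using ear[of P] card_path_edges[of P] by auto
    qed
    finally show ?thesis by (simp only: sum.distrib) simp
  qed
  have disjE: "EC \<inter> EP = {}"
  proof (rule ccontr)
    assume "\<not> ?thesis"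
    then obtain e p P where e: "p \<in> \<P>" "e \<in> edges (cyc_graph p)" "P \<in> \<E>" "e \<in> path_edges P"
      unfolding EC_def EP_def by blast
    have eG: "e \<in> edges G" using e(1,2) EC_G unfolding EC_def by blast
    have "e \<subseteq> set P" "e \<subseteq> C" using path_edges_subset_set[OF e(4)] EC_sub[OF e(1,2)] e(1) unfolding C
      by auto
    then have "e \<subseteq> {hd P, last P}" using ear_C[OF e(3)] by blast
    moreover have "card {hd P, last P} \<le> card e"
      unfolding two[OF eG] by (simp add: card_insert_if)
    ultimately have "e = {hd P, last P}" by (intro card_seteq) auto
    then have "near G 1 (hd P) (last P)" using eG by auto
    then show False using ear[OF e(3)] near_mono[of G 1 _ _ "2 * d"] d1 by auto
  qed
  have cardE: "card (edges H) = (\<Sum>p\<in>\<P>. length p) + ((\<Sum>P\<in>\<E>. length P - 2) + card \<E>)"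
  proof -
    have fin: "finite EC" "finite EP" using simple_finite_edges[OF S] EC_G EP_G finite_subset by blast+
    have "card (edges H) = card EC + card EP"
      unfolding H_def using card_Un_disjoint[OF fin disjE] by simp
    then show ?thesis using cardEC cardEP by simp
  qed
  have cardV: "card (verts H) \<le> (\<Sum>p\<in>\<P>. length p) + (\<Sum>P\<in>\<E>. length P - 2)"
  proof -
    have "verts H \<subseteq> (\<Union>p\<in>\<P>. set p) \<union> (\<Union>P\<in>\<E>. set P - {hd P, last P})"
      unfolding H_def using ends_C(1) C by auto
    then have "card (verts H) \<le> card ((\<Union>p\<in>\<P>. set p) \<union> (\<Union>P\<in>\<E>. set P - {hd P, last P}))"
      using finP finE by (intro card_mono) auto
    also have "\<dots> \<le> card (\<Union>p\<in>\<P>. set p) + card (\<Union>P\<in>\<E>. set P - {hd P, last P})" by (rule card_Un_le)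
    also have "\<dots> \<le> (\<Sum>p\<in>\<P>. card (set p)) + (\<Sum>P\<in>\<E>. card (set P - {hd P, last P}))"
      by (intro add_mono card_UN_le finP finE)
    also have "\<dots> = (\<Sum>p\<in>\<P>. length p) + (\<Sum>P\<in>\<E>. length P - 2)"
    proof (intro arg_cong2[where f="(+)"] sum.cong refl)
      fix p assume "p \<in> \<P>"
      then show "card (set p) = length p" using cycP[of p] by (simp add: cyc_def distinct_card)
    next
      fix P assume P: "P \<in> \<E>"
      have "hd P \<noteq> last P" using ear[OF P] near_refl by metis
      moreover have "P \<noteq> []" using ear[OF P] by auto
      ultimately show "card (set P - {hd P, last P}) = length P - 2"
        using ear[OF P] by (subst card_Diff_subset) (auto simp: distinct_card)
    qed
    finally show ?thesis .
  qed
  have excess: "int (s_fun k) \<le> 2 * (int (card (edges H)) - int (card (verts H)))"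
  proof -
    have "card (verts H) + card \<E> \<le> card (edges H)" using cardE cardV by linarith
    then have "int (card \<E>) \<le> int (card (edges H)) - int (card (verts H))" by linarith
    moreover have "int (s_fun k) \<le> 2 * int (card \<E>)" using many by linarith
    ultimately show ?thesis by presburger
  qed
  \<comment> \<open>Ears are disjoint and meet the cycles only in their ends, so only these have degree 3.\<close>
  have degH: "deg H v \<le> card {e \<in> EC. v \<in> e} + card {e \<in> EP. v \<in> e}" for v
  proof -
    have "{e \<in> edges H. v \<in> e} = {e \<in> EC. v \<in> e} \<union> {e \<in> EP. v \<in> e}" unfolding H_def by auto
    then show ?thesis unfolding deg_def by (metis card_Un_le)
  qed
  have degEC: "card {e \<in> EC. v \<in> e} \<le> 2 \<and> (v \<notin> C \<longrightarrow> card {e \<in> EC. v \<in> e} = 0)" for v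
  proof (cases "v \<in> C")
    case True
    then obtain p where p: "p \<in> \<P>" "v \<in> set p" using C_cases by blast
    have "{e \<in> EC. v \<in> e} = {e \<in> edges (cyc_graph p). v \<in> e}"
      using p EC_sub uniqp unfolding EC_def by blast
    then show ?thesis using cyc_deg(2)[OF cycP[OF p(1)] p(2)] True by (simp add: deg_def)
  next
    case False
    then have "{e \<in> EC. v \<in> e} = {}" using EC_sub unfolding EC_def C by blast
    then show ?thesis by (metis card.empty zero_le)
  qed
  have degEP: "card {e \<in> EP. v \<in> e} \<le> 2 \<and> (v \<in> C \<longrightarrow> card {e \<in> EP. v \<in> e} \<le> (if att v then 1 else 0))"
    for v
  proof (cases "\<exists>P\<in>\<E>. v \<in> set P")
    case True
    then obtain P where P: "P \<in> \<E>" "v \<in> set P" by blast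
    have eq: "{e \<in> EP. v \<in> e} = {e \<in> path_edges P. v \<in> e}"
      using P path_edges_subset_set uniqP unfolding EP_def by blast
    have dP: "distinct P" using ear[OF P(1)] by blast
    have "card {e \<in> path_edges P. v \<in> e} \<le> (if att v then 1 else 0)" if "v \<in> C"
      using ear_C[OF P that] path_edges_deg(2,3)[OF dP, of v] P(1) unfolding att_def by auto
    then show ?thesis unfolding eq using path_edges_deg(1)[OF dP, of v] by blast
  next
    case False
    then have "{e \<in> EP. v \<in> e} = {}" using path_edges_subset_set unfolding EP_def by blast
    then show ?thesis by (metis card.empty zero_le)
  qed
  have deg3: "deg H v \<le> 3" for v
    using degH[of v] degEC[of v] degEP[of v] by (cases "v \<in> C"; cases "att v") auto
  have deg2: "att v" if "3 \<le> deg H v" for v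
    using that degH[of v] degEC[of v] degEP[of v] by (cases "v \<in> C"; cases "att v") auto
  have att_C: "att v \<Longrightarrow> v \<in> C" for v unfolding att_def using ends_C(1) by blast
  have att2: "\<not> near G (2 * d) a b" if ab: "att a" "att b" "a \<noteq> b" for a b
  proof -
    obtain P Q where PQ: "P \<in> \<E>" "Q \<in> \<E>" "a \<in> {hd P, last P}" "b \<in> {hd Q, last Q}"
      using ab(1,2) unfolding att_def by blast
    show ?thesis
    proof (cases "P = Q")
      case True
      then show ?thesis using PQ ear[OF PQ(1)] ab(3) near_sym[of G "2 * d"] by blast
    qed (use att_far PQ in blast)
  qed
  obtain \<C> where CC: "card \<C> = k" "\<forall>C\<in>\<C>. cycle_in H C"
      "\<forall>C\<in>\<C>. \<forall>C'\<in>\<C>. C \<noteq> C' \<longrightarrow> verts C \<inter> verts C' = {}"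
    using disjoint_cycles[OF SH deg3 k1 excess] by blast
  have exit: "att v" if "cycle_in H \<Gamma>" "v \<in> verts \<Gamma>" "adj H v w" "w \<notin> verts \<Gamma>" for \<Gamma> v w
    using deg2 cycle_exit_deg[OF SH that] by blast
  have arc: False
    if g: "cycle_in H \<Gamma>" "cycle_in H \<Gamma>'" "verts \<Gamma> \<inter> verts \<Gamma>' = {}"
      and p: "p \<in> \<P>" and ay: "a \<in> verts \<Gamma>" "y \<in> verts \<Gamma>'" "near (cyc_graph p) (2 * d) a y"
        for \<Gamma> \<Gamma>' p a y
  proof -
    obtain w where w: "w \<noteq> []" "hd w = a" "last w = y" "length w \<le> Suc (2 * d)" "walk (cyc_graph p) w"
      using near_walk[OF ay(3)] by blast
    have "\<exists>x\<in>set w. x \<in> verts \<Gamma>" using w ay(1) by (metis hd_in_set)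
    then obtain w1 b w2 where w12: "w = w1 @ b # w2" "b \<in> verts \<Gamma>" "\<forall>z\<in>set w2. z \<notin> verts \<Gamma>"
      using split_list_last_prop[of w "\<lambda>x. x \<in> verts \<Gamma>"] by blast
    have "w2 \<noteq> []" using w12 w(3) ay(2) g(3) by auto
    then have "\<exists>x\<in>set w2. x \<in> verts \<Gamma>'" using w(3) w12(1) ay(2)
      by (metis last.simps last_appendR last_in_set list.distinct(1))
    then obtain u1 b' u2 where u: "w2 = u1 @ b' # u2" "b' \<in> verts \<Gamma>'" "\<forall>z\<in>set u1. z \<notin> verts \<Gamma>'"
      using split_list_first_prop[of w2 "\<lambda>x. x \<in> verts \<Gamma>'"] by blast
    have wk: "walk (cyc_graph p) (b # u1 @ [b'])"
      using w(5) unfolding w12(1) u(1)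
      by (auto simp: successively_append_iff successively_Cons hd_append split: if_splits)
    have sub: "edges (cyc_graph p) \<subseteq> edges H" using p unfolding H_def EC_def by auto
    have "adj (cyc_graph p) b (hd (u1 @ [b']))" using wk by (cases u1) (auto simp: successively_Cons)
    moreover have "hd (u1 @ [b']) \<notin> verts \<Gamma>" using w12(3) u(1) by (cases u1) auto
    ultimately have ab: "att b" using exit[OF g(1) w12(2)] sub by blast
    have "adj (cyc_graph p) (last (b # u1)) b'" using wk 
      by (cases u1 rule: rev_cases) (auto simp: successively_append_iff successively_Cons)
    then have "adj H b' (last (b # u1))" using sub by (auto simp: insert_commute)
    moreover have "last (b # u1) \<notin> verts \<Gamma>'" using u(3) w12(2) g(3) by auto
    ultimately have ab': "att b'" using exit[OF g(2) u(2)] by blast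
    have "near (cyc_graph p) (length (u1 @ [b'])) b b'" using walk_near[OF wk] by simp
    then have "near (cyc_graph p) (2 * d) b b'"
      by (rule near_mono) (use w(4) in \<open>simp add: w12(1) u(1)\<close>)
    then have "near G (2 * d) b b'"
      by (rule near_subgraph) (use cycP[OF p] in \<open>simp add: cyc_iff_edges\<close>)
    moreover have "b \<noteq> b'" using w12(2) u(2) g(3) by auto
    ultimately show False using att2[OF ab ab'] by blast
  qed
  have arcG: False
    if g: "cycle_in H \<Gamma>" "cycle_in H \<Gamma>'" "verts \<Gamma> \<inter> verts \<Gamma>' = {}"
      and ay: "a \<in> verts \<Gamma>" "y \<in> verts \<Gamma>'" "near G n a y" "n \<le> 2 * d" "a \<in> C" "y \<in> C" for \<Gamma> \<Gamma>' a y n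
  proof -
    obtain p where p: "p \<in> \<P>" "a \<in> set p" using C_cases ay by blast
    obtain q where q: "q \<in> \<P>" "y \<in> set q" using C_cases ay by blast
    have n2: "near G (2 * d) a y" by (rule near_mono[OF ay(3,4)])
    have "p = q" using sep[OF p(1) q(1) _ p(2) q(2)] n2 by blast
    then have "near (cyc_graph p) (2 * d) a y" using iso[OF p(1,2) _ n2] q(2) by simp
    then show False by (rule arc[OF g p(1) ay(1,2)])
  qed
  have whole: "set P \<subseteq> verts \<Gamma>"
    if g: "cycle_in H \<Gamma>" and P: "P \<in> \<E>" and v: "v \<in> set P" "v \<in> verts \<Gamma>" "v \<notin> C" for \<Gamma> P v
  proof -
    obtain i where i: "i < length P" "P ! i = v" using v by (auto simp: in_set_conv_nth)
    have eP: "distinct P" "P \<noteq> []" using ear[OF P] by auto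
    have inner: "\<not> att (P ! j)" if "0 < j" "Suc j < length P" for j
    proof
      assume "att (P ! j)"
      then have "P ! j \<in> {hd P, last P}" using ear_C[OF P] att_C that by auto
      then show False using that eP by (auto simp: hd_conv_nth last_conv_nth nth_eq_iff_index_eq)
    qed
    have adjP: "adj H (P ! j) (P ! Suc j)" if "Suc j < length P" for j
      using path_edges_nth[OF that] P unfolding H_def EP_def by auto
    have i0: "0 < i" "Suc i < length P"
    proof -
      have hl: "hd P \<in> C" "last P \<in> C" using ends_C(1)[OF P] by auto
      have "i \<noteq> 0" using hl(1) v(3) i eP(2) by (metis hd_conv_nth)
      moreover have "i \<noteq> length P - 1" using hl(2) v(3) i eP(2) by (metis last_conv_nth)
      ultimately show "0 < i" "Suc i < length P" using i by auto
    qed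
    have up: "i + j < length P \<Longrightarrow> P ! (i + j) \<in> verts \<Gamma>" for j
    proof (induction j)
      case (Suc j)
      then have "P ! (i + j) \<in> verts \<Gamma>" "\<not> att (P ! (i + j))" "adj H (P ! (i + j)) (P ! Suc (i + j))"
        using inner[of "i + j"] i0 adjP[of "i + j"] by auto
      then show ?case using exit[OF g] by auto
    qed (use i v in simp)
    have down: "P ! (i - j) \<in> verts \<Gamma>" for j
    proof (induction j)
      case (Suc j)
      show ?case
      proof (cases "j < i")
        case True
        then have s: "Suc (i - Suc j) = i - j" by simp
        have "\<not> att (P ! (i - j))" using inner[of "i - j"] True i0 by auto
        moreover have "adj H (P ! (i - Suc j)) (P ! (i - j))"
          using adjP[of "i - Suc j"] s i0 by auto
        then have "adj H (P ! (i - j)) (P ! (i - Suc j))" by (subst adj_sym)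
        ultimately show ?thesis using exit[OF g Suc] by blast
      next
        case False
        then have "i - Suc j = i - j" by simp
        then show ?thesis using Suc by simp
      qed
    qed (use i v in simp)
    show ?thesis
    proof
      fix u assume "u \<in> set P"
      then obtain j where j: "j < length P" "P ! j = u" by (auto simp: in_set_conv_nth)
      then show "u \<in> verts \<Gamma>" using up[of "j - i"] down[of "i - j"] by (cases "i \<le> j") auto
    qed
  qed
  have mixed: False
    if g: "cycle_in H \<Gamma>" "cycle_in H \<Gamma>'" "verts \<Gamma> \<inter> verts \<Gamma>' = {}"
      and xy: "x \<in> verts \<Gamma>" "y \<in> verts \<Gamma>'" "near G d x y" and xC: "x \<notin> C" for \<Gamma> \<Gamma>' x y
  proof -
    have vs: "verts \<Gamma> \<subseteq> verts H" "verts \<Gamma>' \<subseteq> verts H" using g unfolding cycle_in_def subgraph_def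
      by auto
    then obtain P where P: "P \<in> \<E>" "x \<in> set P" using xy(1) xC unfolding H_def by auto
    have sub: "set P \<subseteq> verts \<Gamma>" using whole[OF g(1) P xy(1) xC] .
    show False
    proof (cases "y \<in> C")
      case True
      then obtain a where a: "a \<in> {hd P, last P}" "near G (2 * d) a y" using clean[OF P _ xy(3)]
        by blast
      then show False using arcG[OF g _ xy(2) a(2)] True ends_C[OF P(1) a(1)] sub by blast
    next
      case False
      then obtain Q where Q: "Q \<in> \<E>" "y \<in> set Q" using xy(2) vs unfolding H_def by auto
      have subQ: "set Q \<subseteq> verts \<Gamma>'" using whole[OF g(2) Q xy(2) False] .
      show False
      proof (cases "P = Q")
        case True
        then show False using sub subQ P(2) g(3) by blast
      qed (use far P Q xy(3) in blast)
    qed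
  qed
  have "d_packing d G \<C>"
  proof (rule d_packingI[OF S])
    fix \<Gamma> assume "\<Gamma> \<in> \<C>"
    then have "cycle_in H \<Gamma>" using CC by blast
    then obtain p where "cyc H p" "\<Gamma> = cyc_graph p" using cycle_in_iff[OF SH] by blast
    then show "cycle_in G \<Gamma>" using cyc_subset[OF _ HG] cycle_in_iff[OF S] by blast
  next
    fix \<Gamma> \<Gamma>' x y assume "\<Gamma> \<in> \<C>" "\<Gamma>' \<in> \<C>" "\<Gamma> \<noteq> \<Gamma>'" and xy: "x \<in> verts \<Gamma>" "y \<in> verts \<Gamma>'"
    then have g: "cycle_in H \<Gamma>" "cycle_in H \<Gamma>'" "verts \<Gamma> \<inter> verts \<Gamma>' = {}" using CC by blast+
    then have g': "verts \<Gamma>' \<inter> verts \<Gamma> = {}" by blast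
    show "\<not> near G d x y"
    proof
      assume n: "near G d x y"
      then have n': "near G d y x" by (rule near_sym)
      have "x \<in> C" using mixed[OF g xy n] by blast
      moreover have "y \<in> C" using mixed[OF g(2,1) g' xy(2,1) n'] by blast
      ultimately show False using arcG[OF g xy n] by simp
    qed
  qed
  then show ?thesis using CC(1) by blast
qed

section \<open>Greedy choice of locally geodesic cycles\<close>

definition nbhd :: "'a graph \<Rightarrow> 'a set \<Rightarrow> nat \<Rightarrow> 'a set" where
  "nbhd G S n = {v. \<exists>c\<in>S. near G n c v}"

lemma theta_aux:
  assumes c: "cyc G (l1 @ x # l2 @ y # l3)" and w: "walk G (x # W @ [y])" and dW: "distinct W"
    and dj: "set W \<inter> set (l1 @ x # l2 @ y # l3) = {}" and ne: "l2 \<noteq> [] \<or> W \<noteq> []"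
  shows "cyc G (x # l2 @ y # rev W)"
proof -
  have "walk G (rev (x # W @ [y]))" using w by (simp only: walk_rev)
  then have w1: "walk G (y # rev W)" "adj G (last (y # rev W)) x"
    by (auto simp: successively_append_iff successively_Cons hd_append simp del: successively_rev split: if_splits)
  have w2: "walk G (x # l2 @ [y])"
    using c unfolding cyc_def
    by (auto simp: successively_append_iff successively_Cons hd_append split: if_splits)
  have "walk G ((x # l2 @ [y]) @ rev W)"
    unfolding successively_append_iff[of _ "x # l2 @ [y]"]
    using w1(1) w2 by (auto simp add: successively_Cons simp del: successively_rev)
  moreover have "distinct (x # l2 @ y # rev W)" using c dW dj unfolding cyc_def by auto
  moreover have "3 \<le> length (x # l2 @ y # rev W)" using ne by (cases l2; cases W) auto
  ultimately show ?thesis using w1(2) unfolding cyc_def by simp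
qed

text \<open>
The vertices \<open>x\<close> and \<open>y\<close> divide the cycle into two arcs, and \<open>W\<close> can replace either.
\<close>

lemma theta:
  assumes c: "cyc G (l1 @ x # l2 @ y # l3)" and w: "walk G (x # W @ [y])" and dW: "distinct W"
    and dj: "set W \<inter> set (l1 @ x # l2 @ y # l3) = {}"
  shows "l2 \<noteq> [] \<or> W \<noteq> [] \<Longrightarrow> cyc G (x # l2 @ y # rev W)"
    and "l1 \<noteq> [] \<or> l3 \<noteq> [] \<or> W \<noteq> [] \<Longrightarrow> cyc G (l1 @ x # W @ y # l3)"
proof -
  show "l2 \<noteq> [] \<or> W \<noteq> [] \<Longrightarrow> cyc G (x # l2 @ y # rev W)" by (rule theta_aux[OF assms])
next
  assume ne: "l1 \<noteq> [] \<or> l3 \<noteq> [] \<or> W \<noteq> []"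
  have "cyc G ((y # l3) @ (l1 @ x # l2))" using cyc_rotate[of G "l1 @ x # l2" "y # l3"] c by simp
  then have c': "cyc G ([] @ y # (l3 @ l1) @ x # l2)" by simp
  have w': "walk G (y # rev W @ [x])" using w walk_rev[of G "x # W @ [y]"] by simp
  have "cyc G (y # (l3 @ l1) @ x # rev (rev W))"
    by (rule theta_aux[OF c' w']) (use dW dj ne in auto)
  then have "cyc G ((y # l3) @ (l1 @ x # W))" by simp
  then show "cyc G (l1 @ x # W @ y # l3)" using cyc_rotate[of G "y # l3" "l1 @ x # W"] by simp
qed

text \<open>
The segment \<open>\<beta>\<close> may enter the forbidden set \<open>S\<close>. Without it, a shortest cycle avoiding \<open>S\<close>
could have shortcuts through \<open>S\<close>.
\<close>

definition admissible :: "'a graph \<Rightarrow> 'a set \<Rightarrow> nat \<Rightarrow> 'a list \<Rightarrow> bool" where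
  "admissible G S q p \<longleftrightarrow> cyc G p \<and> (\<exists>\<alpha> \<beta>. p = \<alpha> @ \<beta> \<and> \<alpha> \<noteq> [] \<and> set \<alpha> \<inter> S = {} \<and> length \<beta> \<le> q)"

definition minimal_admissible :: "'a graph \<Rightarrow> 'a set \<Rightarrow> nat \<Rightarrow> 'a list \<Rightarrow> bool" where
  "minimal_admissible G S q p \<longleftrightarrow> admissible G S q p \<and> (\<forall>p'. admissible G S q p' \<longrightarrow> length p \<le> length p')"

lemma admissibleI:
  "cyc G (\<alpha> @ \<beta>) \<Longrightarrow> \<alpha> \<noteq> [] \<Longrightarrow> set \<alpha> \<inter> S = {} \<Longrightarrow> length \<beta> \<le> q \<Longrightarrow> admissible G S q (\<alpha> @ \<beta>)"
  unfolding admissible_def by blast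

lemma minimal_admissible_le:
  assumes "minimal_admissible G S q p" "cyc G (\<alpha> @ \<beta>)" "\<alpha> \<noteq> []" "set \<alpha> \<inter> S = {}" "length \<beta> \<le> q"
  shows "length p \<le> length \<alpha> + length \<beta>"
  using assms admissibleI[OF assms(2-5)] unfolding minimal_admissible_def by auto

lemma split_two_cases:
  assumes "\<alpha> @ \<beta> = l1 @ x # l2 @ y # l3"
  obtains (a) \<alpha>3 where "\<alpha> = l1 @ x # l2 @ y # \<alpha>3" "l3 = \<alpha>3 @ \<beta>"
  | (b) \<alpha>2 \<beta>1 where "\<alpha> = l1 @ x # \<alpha>2" "\<beta> = \<beta>1 @ y # l3" "l2 = \<alpha>2 @ \<beta>1"
  | (c) \<beta>1 where "\<beta> = \<beta>1 @ x # l2 @ y # l3" "l1 = \<alpha> @ \<beta>1"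
  using assms
  by (auto simp: append_eq_append_conv2 append_eq_Cons_conv Cons_eq_append_conv)

lemma list_ends:
  assumes "distinct w" "w \<noteq> []" "hd w = x" "last w = y" "x \<noteq> y"
  shows "\<exists>W. w = x # W @ [y]"
proof -
  obtain w' where w': "w = x # w'" using assms by (cases w) auto
  then have "w' \<noteq> []" "last w' = y" using assms by auto
  then have "w = x # butlast w' @ [y]" using w' by (metis append_butlast_last_id)
  then show ?thesis by blast
qed

text \<open>
A shortest shortcut \<open>W\<close> has no inner vertex on \<open>p\<close> and divides \<open>p\<close> into two arcs, both longer
than itself. Replacing either arc by \<open>W\<close> gives a shorter cycle, so it remains to see that
one of the two is admissible. This is clear unless exactly one end of \<open>W\<close> is in \<open>\<beta>\<close>. In that case
the end divides the rest of \<open>\<beta>\<close> into two parts; the shorter one has at most \<open>2 d - 1\<close> vertices, and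
with the end and the at most \<open>2 d - 1\<close> inner vertices of \<open>W\<close> this makes an exceptional segment of
at most \<open>4 d - 1\<close> vertices. Here the constant \<open>4 d - 1\<close> reproduces itself.
\<close>

lemma minimal_admissible_geodesic:
  assumes m: "minimal_admissible G S (4 * d - 1) p" and d1: "1 \<le> d"
  shows "x \<in> set p \<Longrightarrow> y \<in> set p \<Longrightarrow> near G n x y \<Longrightarrow> n \<le> 2 * d \<Longrightarrow> near (cyc_graph p) n x y"
proof (induction n arbitrary: x y rule: less_induct)
  case (less n)
  have cp: "cyc G p" using m unfolding minimal_admissible_def admissible_def by auto
  have key: False
    if pl: "p = l1 @ x # l2 @ y # l3" and nn: "near G n x y" and no: "\<not> near (cyc_graph p) n x y"
      for x y l1 l2 l3
  proof -
    have xy: "x \<noteq> y" "x \<in> set p" "y \<in> set p" using cp unfolding pl cyc_def by auto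
    obtain w where w: "w \<noteq> []" "hd w = x" "last w = y" "length w \<le> Suc n" "walk G w" "distinct w"
      using near_path[OF nn] by blast
    obtain W where W: "w = x # W @ [y]" using list_ends[OF w(6,1,2,3) xy(1)] by blast
    have lw: "length w = Suc n"
    proof (rule ccontr)
      assume "length w \<noteq> Suc n"
      then have lt: "Suc (length W) < n" using w(4) unfolding W by simp
      have "near G (Suc (length W)) x y" using walk_near[of G x "W @ [y]"] w(5) unfolding W by simp
      then have "near (cyc_graph p) (Suc (length W)) x y" using less.IH[OF lt xy(2,3)] lt less.prems(4)
        by simp
      then show False using no near_mono lt by (metis less_imp_le)
    qed
    have dj: "set W \<inter> set p = {}"
    proof (rule ccontr)
      assume "\<not> ?thesis"
      then obtain z where z: "z \<in> set W" "z \<in> set p" by blast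
      then obtain i where i: "i < length W" "W ! i = z" by (auto simp: in_set_conv_nth)
      have zi: "w ! Suc i = z" "Suc i < n" "w ! 0 = x" "w ! n = y" "n - Suc i < n"
        using i lw unfolding W by (auto simp: nth_append)
      have "near G (Suc i - 0) (w ! 0) (w ! Suc i)"
        by (rule walk_nth_near[OF w(5)]) (use i lw W in auto)
      then have n1: "near (cyc_graph p) (Suc i) x z"
        using less.IH[OF zi(2) xy(2) z(2)] zi less.prems(4) by simp
      have "near G (n - Suc i) (w ! Suc i) (w ! n)"
        by (rule walk_nth_near[OF w(5)]) (use zi lw W in auto)
      then have "near (cyc_graph p) (n - Suc i) z y"
        using less.IH[OF zi(5) z(2) xy(3)] zi less.prems(4) by simp
      from near_trans[OF n1 this] show False using no zi(2) by simp
    qed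
    have lW: "Suc (length W) = n" using lw unfolding W by simp
    have wW: "walk G (x # W @ [y])" using w(5) W by simp
    have dW: "distinct W" using w(6) W by simp
    note th = theta[OF cp[unfolded pl] wW dW dj[unfolded pl]]
    have cc: "cyc (cyc_graph p) (l1 @ x # l2 @ y # l3)" using cyc_cyc_graph[OF cp] pl by simp
    have "walk (cyc_graph p) (x # l2 @ [y])"
      using cc unfolding cyc_def
      by (auto simp: successively_append_iff successively_Cons hd_append split: if_splits)
    then have "near (cyc_graph p) (Suc (length l2)) x y" using walk_near[of "cyc_graph p" x "l2 @ [y]"]
      by simp
    then have l2: "n \<le> length l2" using no near_mono by (metis not_less_eq_eq)
    have "cyc (cyc_graph p) ((y # l3) @ (l1 @ x # l2))"
      using cyc_rotate[of "cyc_graph p" "l1 @ x # l2" "y # l3"] cc by simp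
    then have "walk (cyc_graph p) (y # (l3 @ l1) @ [x])"
      unfolding cyc_def
      by (auto simp: successively_append_iff successively_Cons hd_append split: if_splits)
    then have "near (cyc_graph p) (Suc (length (l3 @ l1))) y x"
      using walk_near[of "cyc_graph p" y "(l3 @ l1) @ [x]"] by simp
    then have "near (cyc_graph p) (Suc (length (l3 @ l1))) x y" by (rule near_sym)
    then have "n \<le> length (l3 @ l1)" using no near_mono by (metis not_less_eq_eq)
    then have l13: "n \<le> length l3 + length l1" by simp
    have n1: "1 \<le> n" using lW by simp
    have ne: "l2 \<noteq> []" "l1 \<noteq> [] \<or> l3 \<noteq> []" using l2 l13 n1 by auto
    have c1: "cyc G (x # l2 @ y # rev W)" and c2: "cyc G (l1 @ x # W @ y # l3)"
      using th ne by auto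
    obtain \<alpha> \<beta> where ab: "p = \<alpha> @ \<beta>" "\<alpha> \<noteq> []" "set \<alpha> \<inter> S = {}" "length \<beta> \<le> 4 * d - 1"
      using m unfolding minimal_admissible_def admissible_def by blast
    have lp: "length p = length l1 + length l2 + length l3 + 2" unfolding pl by simp
    from ab(1) pl have "\<alpha> @ \<beta> = l1 @ x # l2 @ y # l3" by simp
    then show False
    proof (cases rule: split_two_cases)
      case (a \<alpha>3)
      have "length p \<le> length (x # l2 @ [y]) + length (rev W)"
        by (rule minimal_admissible_le[OF m]) (use c1 ab(3) a lW less.prems(4) in auto)
      then show False using lp lW l13 by simp
    next
      case (b \<alpha>2 \<beta>1)
      show False
      proof (cases "length \<beta>1 \<le> length l3")
        case True
        have "length p \<le> length (x # \<alpha>2) + length (\<beta>1 @ y # rev W)"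
          by (rule minimal_admissible_le[OF m]) (use c1 ab(3,4) b lW less.prems(4) True in auto)
        then show False using lp lW l13 b(3) by simp
      next
        case False
        have "length p \<le> length (l1 @ [x]) + length (W @ y # l3)"
          by (rule minimal_admissible_le[OF m]) (use c2 ab(3,4) b lW less.prems(4) False in auto)
        then show False using lp lW l2 by simp
      qed
    next
      case (c \<beta>1)
      have "length p \<le> length \<alpha> + length (\<beta>1 @ x # W @ y # l3)"
        by (rule minimal_admissible_le[OF m]) (use c2 ab(2,3,4) c lW l2 in auto)
      then show False using lp lW l2 c(2) by simp
    qed
  qed
  show ?case
  proof (rule ccontr)
    assume no: "\<not> near (cyc_graph p) n x y"
    then have "x \<noteq> y" by auto
    obtain l1 r where lr: "p = l1 @ x # r" using split_list[OF less.prems(1)] by blast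
    show False
    proof (cases "y \<in> set r")
      case True
      then obtain l2 l3 where "r = l2 @ y # l3" by (meson split_list)
      then show False using key[of l1 x l2 y l3] lr less.prems(3) no by simp
    next
      case False
      then have "y \<in> set l1" using lr less.prems(2) \<open>x \<noteq> y\<close> by auto
      then obtain k1 k2 where "l1 = k1 @ y # k2" by (meson split_list)
      moreover have "\<not> near (cyc_graph p) n y x" using no near_sym[of "cyc_graph p" n y x] by blast
      ultimately show False using key[of k1 y k2 x r] lr near_sym[OF less.prems(3)] by simp
    qed
  qed
qed

text \<open>
The same exchange for a detour \<open>W\<close> that avoids \<open>S\<close>. Such a \<open>W\<close> can be counted to the part outside
of the exceptional segment, which therefore need not grow. So \<open>W\<close> only has to be shorter than an arc
that it replaces, and this holds for one of the two arcs because \<open>p\<close> is long.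
\<close>

lemma minimal_admissible_no_detour:
  assumes m: "minimal_admissible G S q p" and pl: "p = l1 @ x # l2 @ y # l3"
    and w: "walk G (x # W @ [y])" and dW: "distinct W" and dj: "set W \<inter> set p = {}"
    and WS: "set W \<inter> S = {}" and long: "2 * length W + 2 < length p"
    and chord: "W = [] \<Longrightarrow> {x, y} \<notin> edges (cyc_graph p)"
  shows False
proof -
  have cp: "cyc G p" using m unfolding minimal_admissible_def admissible_def by auto
  note th = theta[OF cp[unfolded pl] w dW dj[unfolded pl]]
  have lp: "length p = length l1 + length l2 + length l3 + 2" unfolding pl by simp
  have cc: "cyc (cyc_graph p) (l1 @ x # l2 @ y # l3)" using cyc_cyc_graph[OF cp] pl by simp
  have n1: "l2 \<noteq> [] \<or> W \<noteq> []"
  proof (rule ccontr)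
    assume a: "\<not> ?thesis"
    then have "adj (cyc_graph p) x y" using cc unfolding cyc_def
      by (auto simp: successively_append_iff successively_Cons)
    then show False using chord a by blast
  qed
  have n2: "l1 \<noteq> [] \<or> l3 \<noteq> [] \<or> W \<noteq> []"
  proof (rule ccontr)
    assume a: "\<not> ?thesis"
    then have "adj (cyc_graph p) y x" using cc unfolding cyc_def by auto
    then show False using chord a by (auto simp: insert_commute)
  qed
  have c1: "cyc G (x # l2 @ y # rev W)" and c2: "cyc G (l1 @ x # W @ y # l3)"
    using th n1 n2 by auto
  obtain \<alpha> \<beta> where ab: "p = \<alpha> @ \<beta>" "\<alpha> \<noteq> []" "set \<alpha> \<inter> S = {}" "length \<beta> \<le> q"
    using m unfolding minimal_admissible_def admissible_def by blast
  from ab(1) pl have "\<alpha> @ \<beta> = l1 @ x # l2 @ y # l3" by simp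
  then show False
  proof (cases rule: split_two_cases)
    case (a \<alpha>3)
    show False
    proof (cases "length W < length l1 + length l3")
      case True
      have "length p \<le> length (x # l2 @ y # rev W)"
        using minimal_admissible_le[OF m, of "x # l2 @ y # rev W" "[]"] c1 ab(3) a WS by auto
      then show False using lp True by simp
    next
      case False
      have "length p \<le> length (l1 @ x # W @ y # \<alpha>3) + length \<beta>"
        by (rule minimal_admissible_le[OF m]) (use c2 ab(3,4) a WS in auto)
      then show False using lp False long a(2) by simp
    qed
  next
    case (b \<alpha>2 \<beta>1)
    show False
    proof (cases "length W < length l1 + length l3")
      case True
      have "cyc G ((x # l2 @ [y]) @ rev W)" using c1 by simp
      then have "cyc G (rev W @ x # \<alpha>2 @ \<beta>1 @ [y])" using cyc_rotate b(3) by fastforce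
      then have "length p \<le> length (rev W @ x # \<alpha>2) + length (\<beta>1 @ [y])"
        by (intro minimal_admissible_le[OF m]) (use ab(3,4) b WS in auto)
      then show False using lp True b(3) by simp
    next
      case False
      have "length p \<le> length (l1 @ x # W) + length (y # l3)"
        by (rule minimal_admissible_le[OF m]) (use c2 ab(3,4) b WS in auto)
      then show False using lp False long by simp
    qed
  next
    case (c \<beta>1)
    show False
    proof (cases "length W < length l2")
      case True
      have "length p \<le> length \<alpha> + length (\<beta>1 @ x # W @ y # l3)"
        by (rule minimal_admissible_le[OF m]) (use c2 ab(2,3,4) c True in auto)
      then show False using lp True c(2) by simp
    next
      case False
      then have "W \<noteq> []" using n1 by auto
      have "cyc G ((x # l2 @ [y]) @ rev W)" using c1 by simp
      then have "cyc G (rev W @ x # l2 @ [y])" using cyc_rotate by fastforce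
      then have "length p \<le> length (rev W) + length (x # l2 @ [y])"
        by (intro minimal_admissible_le[OF m]) (use ab(3,4) c WS \<open>W \<noteq> []\<close> in auto)
      then show False using lp False long by simp
    qed
  qed
qed

text \<open>
Every vertex of the exceptional segment is at most \<open>2 d\<close> steps away from the rest of the cycle,
which has distance more than \<open>4 d\<close> from \<open>Q\<close>.
\<close>

lemma minimal_admissible_far:
  assumes m: "minimal_admissible G (nbhd G Q (4 * d)) (4 * d - 1) p" and d1: "1 \<le> d" and x: "x \<in> set p" and y: "y \<in> Q"
  shows "\<not> near G (2 * d) y x"
proof
  assume n: "near G (2 * d) y x"
  obtain \<alpha> \<beta> where ab: "p = \<alpha> @ \<beta>" "\<alpha> \<noteq> []" "set \<alpha> \<inter> nbhd G Q (4 * d) = {}" "length \<beta> \<le> 4 * d - 1"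
    using m unfolding minimal_admissible_def admissible_def by blast
  have cp: "cyc G p" using m unfolding minimal_admissible_def admissible_def by auto
  have "\<exists>a\<in>set \<alpha>. near G (2 * d) x a"
  proof (cases "x \<in> set \<alpha>")
    case False
    then have "x \<in> set \<beta>" using x ab(1) by auto
    then obtain b1 b2 where b: "\<beta> = b1 @ x # b2" by (meson split_list)
    show ?thesis
    proof (cases "length b1 \<le> length b2")
      case True
      obtain \<alpha>' a where a: "\<alpha> = \<alpha>' @ [a]" using ab(2) by (cases \<alpha> rule: rev_cases) auto
      have "walk G (a # b1 @ [x])"
        using cp unfolding ab(1) b a cyc_def
        by (auto simp: successively_append_iff successively_Cons hd_append split: if_splits)
      then have "near G (Suc (length b1)) a x" using walk_near[of G a "b1 @ [x]"] by simp
      then have "near G (2 * d) a x" by (rule near_mono) (use True ab(4) b in simp)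
      then show ?thesis using near_sym a by (intro bexI[of _ a]) auto
    next
      case False
      obtain \<alpha>' a where a: "\<alpha> = a # \<alpha>'" using ab(2) by (cases \<alpha>) auto
      have "cyc G ((x # b2) @ (a # \<alpha>' @ b1))"
        using cyc_rotate[of G "a # \<alpha>' @ b1" "x # b2"] cp unfolding ab(1) b a by simp
      then have "walk G (x # b2 @ [a])"
        unfolding cyc_def
        by (auto simp: successively_append_iff successively_Cons hd_append split: if_splits)
      then have "near G (Suc (length b2)) x a" using walk_near[of G x "b2 @ [a]"] by simp
      then have "near G (2 * d) x a" by (rule near_mono) (use False ab(4) b in simp)
      then show ?thesis using a by (intro bexI[of _ a]) auto
    qed
  qed (auto intro!: bexI[of _ x])
  then obtain a where a: "a \<in> set \<alpha>" "near G (2 * d) x a" by blast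
  have "near G (2 * d + 2 * d) y a" by (rule near_trans[OF n a(2)])
  then have "a \<in> nbhd G Q (4 * d)" using y unfolding nbhd_def by auto
  then show False using a(1) ab(3) by blast
qed

text \<open>
The most recent choice comes first.
\<close>

fun chain :: "'a graph \<Rightarrow> nat \<Rightarrow> 'a list list \<Rightarrow> bool" where
  "chain G d [] \<longleftrightarrow> True"
| "chain G d (p # ps) \<longleftrightarrow> chain G d ps \<and> minimal_admissible G (nbhd G (\<Union> (set ` set ps)) (4 * d)) (4 * d - 1) p"

lemma chain_facts:
  assumes "1 \<le> d" "chain G d ps"
  shows "distinct ps"
    and "p \<in> set ps \<Longrightarrow> \<exists>\<Q>\<subseteq>set ps - {p}. minimal_admissible G (nbhd G (\<Union> (set ` \<Q>)) (4 * d)) (4 * d - 1) p"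
    and "p \<in> set ps \<Longrightarrow> q \<in> set ps \<Longrightarrow> p \<noteq> q \<Longrightarrow> x \<in> set p \<Longrightarrow> y \<in> set q \<Longrightarrow> \<not> near G (2 * d) x y"
proof -
  have "distinct ps \<and> (\<forall>p\<in>set ps. \<exists>\<Q>\<subseteq>set ps - {p}. minimal_admissible G (nbhd G (\<Union> (set ` \<Q>)) (4 * d)) (4 * d - 1) p)
     \<and> (\<forall>p\<in>set ps. \<forall>q\<in>set ps. p \<noteq> q \<longrightarrow> (\<forall>x\<in>set p. \<forall>y\<in>set q. \<not> near G (2 * d) x y))"
    using assms(2)
  proof (induction ps)
    case (Cons r ps)
    then have IH: "distinct ps"
      "\<And>p. p \<in> set ps \<Longrightarrow> \<exists>\<Q>\<subseteq>set ps - {p}. minimal_admissible G (nbhd G (\<Union> (set ` \<Q>)) (4 * d)) (4 * d - 1) p"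
      "\<And>p q x y. p \<in> set ps \<Longrightarrow> q \<in> set ps \<Longrightarrow> p \<noteq> q \<Longrightarrow> x \<in> set p \<Longrightarrow> y \<in> set q \<Longrightarrow> \<not> near G (2 * d) x y"
      by auto
    have m: "minimal_admissible G (nbhd G (\<Union> (set ` set ps)) (4 * d)) (4 * d - 1) r" using Cons.prems
      by simp
    have sp: "\<not> near G (2 * d) y x" if "x \<in> set r" "p \<in> set ps" "y \<in> set p" for x y p
      using minimal_admissible_far[OF m assms(1) that(1)] that(2,3) by blast
    have "r \<noteq> []" using m cyc_nonempty unfolding minimal_admissible_def admissible_def by blast
    have nin: "r \<notin> set ps"
    proof
      assume "r \<in> set ps"
      then show False using sp[of "hd r" r "hd r"] \<open>r \<noteq> []\<close> by simp
    qed
    have "\<exists>\<Q>\<subseteq>set (r # ps) - {p}. minimal_admissible G (nbhd G (\<Union> (set ` \<Q>)) (4 * d)) (4 * d - 1) p"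
      if "p \<in> set (r # ps)" for p
    proof (cases "p = r")
      case True
      then show ?thesis using m nin by (intro exI[of _ "set ps"]) auto
    next
      case False
      then obtain \<Q>
        where "\<Q> \<subseteq> set ps - {p}" "minimal_admissible G (nbhd G (\<Union> (set ` \<Q>)) (4 * d)) (4 * d - 1) p"
        using IH(2)[of p] \<open>p \<in> set (r # ps)\<close> by auto
      then show ?thesis by (intro exI[of _ \<Q>]) auto
    qed
    moreover have "\<not> near G (2 * d) x y"
      if pq: "p \<in> set (r # ps)" "q \<in> set (r # ps)" "p \<noteq> q" "x \<in> set p" "y \<in> set q" for p q x y
    proof -
      consider "p = r" "q \<in> set ps" | "q = r" "p \<in> set ps" | "p \<in> set ps" "q \<in> set ps" using pq by auto
      then show ?thesis
      proof cases
        case 1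
        then show ?thesis using sp[of x q y] pq near_sym[of G "2 * d" x y] by blast
      next
        case 2
        then show ?thesis using sp[of y p x] pq by blast
      next
        case 3
        then show ?thesis using IH(3) pq by blast
      qed
    qed
    ultimately show ?case using IH(1) nin by (intro conjI ballI impI) auto
  qed simp
  then show "distinct ps"
    "p \<in> set ps \<Longrightarrow> \<exists>\<Q>\<subseteq>set ps - {p}. minimal_admissible G (nbhd G (\<Union> (set ` \<Q>)) (4 * d)) (4 * d - 1) p"
    "p \<in> set ps \<Longrightarrow> q \<in> set ps \<Longrightarrow> p \<noteq> q \<Longrightarrow> x \<in> set p \<Longrightarrow> y \<in> set q \<Longrightarrow> \<not> near G (2 * d) x y"
    by blast+
qed

lemma chain_drop: "chain G d ps \<Longrightarrow> chain G d (drop n ps)"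
proof (induction ps arbitrary: n)
  case (Cons p ps)
  then show ?case by (cases n) auto
qed simp

lemma chain_packing:
  assumes "simple_graph G" "1 \<le> d" "chain G d ps"
  shows "\<exists>\<C>. d_packing d G \<C> \<and> card \<C> = length ps"
proof -
  note f = chain_facts[OF assms(2,3)]
  have "cyc G p" if "p \<in> set ps" for p
    using f(2)[OF that] unfolding minimal_admissible_def admissible_def by blast
  moreover have "\<not> near G d x y" if "p \<in> set ps" "q \<in> set ps" "p \<noteq> q" "x \<in> set p" "y \<in> set q"
    for p q x y
    using f(3)[OF that] near_mono[of G d x y "2 * d"] by auto
  ultimately show ?thesis
    using family_packing[OF assms(1), of "set ps" "\<lambda>p. p" d] f(1) by (simp add: distinct_card)
qed

text \<open>
Chains of chosen cycles are packings and therefore shorter than \<open>k\<close>. A longest chain has the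
covering property because a cycle that avoids the neighbourhood of all its members is admissible.
\<close>

lemma cycle_system_exists:
  assumes S: "simple_graph G" and d1: "1 \<le> d"
    and no: "\<not> (\<exists>\<C>. d_packing d G \<C> \<and> card \<C> = k)"
  obtains \<P> where "finite \<P>" "card \<P> < k"
    "\<And>p. p \<in> \<P> \<Longrightarrow> \<exists>\<Q>\<subseteq>\<P> - {p}. minimal_admissible G (nbhd G (\<Union> (set ` \<Q>)) (4 * d)) (4 * d - 1) p"
    "\<And>p q x y. p \<in> \<P> \<Longrightarrow> q \<in> \<P> \<Longrightarrow> p \<noteq> q \<Longrightarrow> x \<in> set p \<Longrightarrow> y \<in> set q \<Longrightarrow> \<not> near G (2 * d) x y"
    "\<And>q. cyc G q \<Longrightarrow> set q \<inter> nbhd G (\<Union> (set ` \<P>)) (4 * d) \<noteq> {}"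
proof -
  have bound: "length ps < k" if "chain G d ps" for ps
  proof (rule ccontr)
    assume "\<not> length ps < k"
    then have "length (drop (length ps - k) ps) = k" by simp
    then show False using chain_packing[OF S d1 chain_drop[OF that]] no by metis
  qed
  have "chain G d []" by simp
  then obtain ps where ps: "chain G d ps" "\<And>ps'. chain G d ps' \<Longrightarrow> length ps' \<le> length ps"
    using ex_has_greatest_nat[of "chain G d" "[]" length k] bound by (metis less_imp_le)
  note f = chain_facts[OF d1 ps(1)]
  have "set q \<inter> nbhd G (\<Union> (set ` set ps)) (4 * d) \<noteq> {}" if q: "cyc G q" for q
  proof
    let ?S = "nbhd G (\<Union> (set ` set ps)) (4 * d)"
    assume e: "set q \<inter> ?S = {}"
    have "admissible G ?S (4 * d - 1) (q @ [])"
      by (rule admissibleI) (use q e cyc_nonempty[OF q] in auto)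
    then obtain p
      where p: "admissible G ?S (4 * d - 1) p" "\<And>p'. admissible G ?S (4 * d - 1) p' \<Longrightarrow> length p \<le> length p'"
      using ex_has_least_nat[of "admissible G ?S (4 * d - 1)" _ length] by blast
    then have "minimal_admissible G ?S (4 * d - 1) p" unfolding minimal_admissible_def by blast
    then have "chain G d (p # ps)" using ps(1) by simp
    from ps(2)[OF this] show False by simp
  qed
  moreover have "card (set ps) < k" using bound[OF ps(1)] f(1) by (simp add: distinct_card)
  ultimately show ?thesis using that[of "set ps"] f(2,3) by blast
qed

section \<open>Breadth-first search from the chosen cycles\<close>

lemma walk_join:
  assumes "walk G (xs @ [u])" "walk G (u # pl @ [v])" "walk G (v # ys)"
  shows "walk G (xs @ u # pl @ v # ys)"
  using assms
  by (auto simp: successively_append_iff successively_Cons hd_append split: if_splits)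

lemma near_crossing:
  assumes "near G n z y" "Q z" "\<not> Q y"
  shows "\<exists>t x' y'. t < n \<and> near G t z x' \<and> Q x' \<and> adj G x' y' \<and> \<not> Q y' \<and> near G (n - t - 1) y' y"
  using assms
proof (induction n arbitrary: y)
  case (Suc n)
  show ?case
  proof (cases "near G n z y")
    case True
    then obtain t x' y'
      where t: "t < n" "near G t z x'" "Q x'" "adj G x' y'" "\<not> Q y'" "near G (n - t - 1) y' y"
      using Suc.IH[OF _ Suc.prems(2,3)] by blast
    have "near G (Suc n - t - 1) y' y" by (rule near_mono[OF t(6)]) simp
    then show ?thesis using t by (intro exI[of _ t] exI[of _ x'] exI[of _ y']) simp
  next
    case False
    then obtain w where w: "near G n z w" "adj G w y" using Suc.prems(1) by auto
    show ?thesis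
    proof (cases "Q w")
      case True
      then show ?thesis using w Suc.prems by (intro exI[of _ n] exI[of _ w] exI[of _ y]) simp
    next
      case False
      then obtain t x' y'
        where t: "t < n" "near G t z x'" "Q x'" "adj G x' y'" "\<not> Q y'" "near G (n - t - 1) y' w"
        using Suc.IH[OF w(1) Suc.prems(2)] by blast
      have "near G (Suc (n - t - 1)) y' y" using t(6) w(2) by auto
      moreover have "Suc (n - t - 1) = Suc n - t - 1" using t(1) by simp
      ultimately have "near G (Suc n - t - 1) y' y" by metis
      then show ?thesis using t by (intro exI[of _ t] exI[of _ x'] exI[of _ y']) simp
    qed
  qed
qed simp

text \<open>
The outcome of the greedy choice, for a fixed distance \<open>d\<close>. The set \<open>\<Q>\<close> stands for the cycles
chosen before \<open>p\<close>.
\<close>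

locale cycle_system =
  fixes G :: "'a graph" and d :: nat and \<P> :: "'a list set"
  assumes S: "simple_graph G" and d1: "1 \<le> d" and finP: "finite \<P>"
    and minP: "p \<in> \<P> \<Longrightarrow> \<exists>\<Q>\<subseteq>\<P> - {p}. minimal_admissible G (nbhd G (\<Union> (set ` \<Q>)) (4 * d)) (4 * d - 1) p"
    and sep: "p \<in> \<P> \<Longrightarrow> q \<in> \<P> \<Longrightarrow> p \<noteq> q \<Longrightarrow> x \<in> set p \<Longrightarrow> y \<in> set q \<Longrightarrow> \<not> near G (2 * d) x y"
    and hits: "cyc G q \<Longrightarrow> set q \<inter> nbhd G (\<Union> (set ` \<P>)) (4 * d) \<noteq> {}"
begin

definition C :: "'a set" where "C = \<Union> (set ` \<P>)"

lemma cycP: "p \<in> \<P> \<Longrightarrow> cyc G p"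
  using minP unfolding minimal_admissible_def admissible_def by blast

lemma iso:
  assumes "p \<in> \<P>" "x \<in> set p" "y \<in> set p" "near G n x y" "n \<le> 2 * d"
  shows "near (cyc_graph p) n x y"
proof -
  obtain Q where m: "minimal_admissible G Q (4 * d - 1) p" using minP[OF assms(1)] by blast
  show ?thesis by (rule minimal_admissible_geodesic[OF m d1 assms(2-5)])
qed

lemma uniqp: "p \<in> \<P> \<Longrightarrow> q \<in> \<P> \<Longrightarrow> x \<in> set p \<Longrightarrow> x \<in> set q \<Longrightarrow> p = q"
  using sep[of p q x x] by auto

lemma C_cases: assumes "v \<in> C" obtains p where "p \<in> \<P>" "v \<in> set p"
  using assms unfolding C_def by blast

lemma C_verts: "C \<subseteq> verts G"
  unfolding C_def using cyc_verts[OF S cycP] by blast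

text \<open>
The distance from \<open>C\<close>, cut off at \<open>5 d + 1\<close>: nothing depends on how far away the vertices
beyond level \<open>5 d\<close> are, and vertices without a path to \<open>C\<close> need no special treatment.
\<close>

definition level :: "'a \<Rightarrow> nat" where
  "level v = (LEAST n. v \<in> nbhd G C n \<or> n = 5 * d + 1)"

lemma nbhd_mono: "v \<in> nbhd G X m \<Longrightarrow> m \<le> n \<Longrightarrow> v \<in> nbhd G X n"
  unfolding nbhd_def using near_mono[of G m _ v n] by auto

lemma level_cases: "v \<in> nbhd G C (level v) \<or> level v = 5 * d + 1"
  unfolding level_def by (rule LeastI[of _ "5 * d + 1"]) simp

lemma level_max: "level v \<le> 5 * d + 1"
  unfolding level_def by (rule Least_le) simp

lemma level_le: "n \<le> 5 * d \<Longrightarrow> level v \<le> n \<longleftrightarrow> v \<in> nbhd G C n"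
proof
  assume n: "n \<le> 5 * d" "level v \<le> n"
  then show "v \<in> nbhd G C n" using level_cases[of v] nbhd_mono by auto
next
  assume "v \<in> nbhd G C n"
  then show "level v \<le> n" unfolding level_def by (intro Least_le) simp
qed

lemma level_0: "level v = 0 \<longleftrightarrow> v \<in> C"
  using level_le[of 0 v] unfolding nbhd_def by auto

lemma level_adj: assumes "adj G u v" shows "level v \<le> Suc (level u)"
proof (cases "level u < 5 * d")
  case True
  then obtain c where "c \<in> C" "near G (level u) c u" using level_cases[of u] unfolding nbhd_def by auto
  then have "v \<in> nbhd G C (Suc (level u))" using assms unfolding nbhd_def by auto
  then show ?thesis using level_le[of "Suc (level u)" v] True by simp
qed (use level_max[of v] in simp)

lemma level_near: "near G n u v \<Longrightarrow> level v \<le> level u + n"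
proof (induction n arbitrary: v)
  case (Suc n)
  show ?case
  proof (cases "near G n u v")
    case True
    then show ?thesis using Suc.IH by force
  next
    case False
    then obtain z where "near G n u z" "adj G z v" using Suc.prems by auto
    then show ?thesis using Suc.IH[of z] level_adj[of z v] by simp
  qed
qed simp

text \<open>
A choice of breadth-first tree. Making the vertices of \<open>C\<close> their own parents lets the
iteration come to rest there.
\<close>

definition parent :: "'a \<Rightarrow> 'a" where
  "parent v = (if 1 \<le> level v \<and> level v \<le> 5 * d then SOME u. adj G v u \<and> Suc (level u) = level v else v)"

lemma parent_step:
  assumes "1 \<le> level v" "level v \<le> 5 * d"
  shows "adj G v (parent v)" "Suc (level (parent v)) = level v"
proof -
  obtain m where m: "level v = Suc m" using assms(1) by (cases "level v") auto
  have "v \<in> nbhd G C (Suc m)" "v \<notin> nbhd G C m"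
    using level_le[of "Suc m" v] level_le[of m v] m assms(2) by auto
  then obtain c z where c: "c \<in> C" "near G m c z" "adj G z v" unfolding nbhd_def by auto
  then have "level z \<le> m" using level_near[OF c(2)] level_0[of c] by simp
  then have "adj G v z \<and> Suc (level z) = level v" using level_adj[OF c(3)] c(3) m
    by (auto simp: insert_commute)
  then have "adj G v (parent v) \<and> Suc (level (parent v)) = level v"
    using assms unfolding parent_def
      by (simp, intro someI[of "\<lambda>u. adj G v u \<and> Suc (level u) = level v"]) simp
  then show "adj G v (parent v)" "Suc (level (parent v)) = level v" by auto
qed

lemma parent_C: "level v = 0 \<Longrightarrow> parent v = v"
  unfolding parent_def by simp

lemma parent_cases: "parent v = v \<or> (1 \<le> level v \<and> level v \<le> 5 * d)"
  unfolding parent_def by auto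

definition up :: "nat \<Rightarrow> 'a \<Rightarrow> 'a" where "up i v = (parent ^^ i) v"

lemma up_0 [simp]: "up 0 v = v" by (simp add: up_def)
lemma up_Suc: "up (Suc i) v = parent (up i v)" by (simp add: up_def)
lemma up_add: "up (i + j) v = up i (up j v)" by (simp add: up_def funpow_add)

lemma level_up: assumes "level v \<le> 5 * d" shows "level (up i v) = level v - i"
proof (induction i)
  case (Suc i)
  show ?case
  proof (cases "level (up i v) = 0")
    case True
    then show ?thesis using Suc parent_C[of "up i v"] by (simp add: up_Suc)
  next
    case False
    then have "1 \<le> level (up i v)" "level (up i v) \<le> 5 * d" using Suc assms by simp_all
    from parent_step(2)[OF this] show ?thesis using Suc by (simp add: up_Suc)
  qed
qed simp

lemma up_adj: assumes "level v \<le> 5 * d" "i < level v" shows "adj G (up i v) (up (Suc i) v)"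
  using parent_step(1)[of "up i v"] level_up[OF assms(1), of i] assms by (simp add: up_Suc)

text \<open>
The place where iterated parents arrive on \<open>C\<close>, for a vertex of level at most \<open>5 d\<close>; the tree path
that leads there is its stem.
\<close>

definition foot :: "'a \<Rightarrow> 'a" where "foot v = up (level v) v"

definition stem :: "'a \<Rightarrow> 'a list" where "stem v = map (\<lambda>i. up i v) [0..<Suc (level v)]"

lemma set_stem: "set (stem v) = (\<lambda>i. up i v) ` {..level v}"
  unfolding stem_def by (auto simp: atLeast0LessThan lessThan_Suc_atMost simp del: upt_Suc)

lemma stem_nonempty [simp]: "stem v \<noteq> []" unfolding stem_def by simp
lemma hd_stem [simp]: "hd (stem v) = v" unfolding stem_def by (simp add: hd_map del: upt_Suc)
lemma last_stem [simp]: "last (stem v) = foot v" unfolding stem_def foot_def by simp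
lemma length_stem [simp]: "length (stem v) = Suc (level v)" unfolding stem_def by simp
lemma self_stem [simp]: "v \<in> set (stem v)" using hd_in_set[of "stem v"] by simp
lemma foot_stem [simp]: "foot v \<in> set (stem v)" using last_in_set[of "stem v"] by simp

lemma stem_up_walk:
  assumes "level v \<le> 5 * d" "n \<le> Suc (level v)"
  shows "walk G (map (\<lambda>i. up i v) [0..<n])" "distinct (map (\<lambda>i. up i v) [0..<n])"
proof -
  show "walk G (map (\<lambda>i. up i v) [0..<n])"
    unfolding successively_conv_nth using up_adj[OF assms(1)] assms(2) by simp
  show "distinct (map (\<lambda>i. up i v) [0..<n])"
    unfolding distinct_map
  proof (intro conjI inj_onI)
    fix i j assume h: "i \<in> set [0..<n]" "j \<in> set [0..<n]" "up i v = up j v"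
    then have "level v - i = level v - j" using level_up[OF assms(1), of i] level_up[OF assms(1), of j]
      by simp
    then show "i = j" using h(1,2) assms(2) by auto
  qed simp
qed

lemma stem_walk: "level v \<le> 5 * d \<Longrightarrow> walk G (stem v)" "level v \<le> 5 * d \<Longrightarrow> distinct (stem v)"
  unfolding stem_def by (rule stem_up_walk; simp)+

lemma foot_C: "level v \<le> 5 * d \<Longrightarrow> foot v \<in> C"
  unfolding foot_def using level_up[of v "level v"] level_0 by simp

lemma foot_of_C: "v \<in> C \<Longrightarrow> foot v = v"
  using level_0[of v] unfolding foot_def by simp

lemma stem_elem:
  assumes "level v \<le> 5 * d" "z \<in> set (stem v)"
  shows "z = up (level v - level z) v" "level z \<le> level v" "foot z = foot v"
proof -
  obtain i where i: "i \<le> level v" "z = up i v" using assms(2) unfolding set_stem by auto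
  have dz: "level z = level v - i" using level_up[OF assms(1)] i by simp
  then show "z = up (level v - level z) v" "level z \<le> level v" using i by auto
  have "up (level z + i) v = up (level z) z" using i by (simp add: up_add)
  then show "foot z = foot v" using dz i unfolding foot_def by simp
qed

lemma stem_eqI:
  assumes "level v \<le> 5 * d" "z \<in> set (stem v)" "z' \<in> set (stem v)" "level z = level z'"
  shows "z = z'"
  using stem_elem(1)[OF assms(1,2)] stem_elem(1)[OF assms(1,3)] assms(4) by simp

lemma foot_parent: "level v \<le> 5 * d \<Longrightarrow> foot (parent v) = foot v"
proof (cases "level v = 0")
  case False
  assume v: "level v \<le> 5 * d"
  have "parent v = up 1 v" using up_Suc[of 0 v] by simp
  moreover have "up 1 v \<in> set (stem v)" unfolding set_stem using False by auto
  ultimately show ?thesis using stem_elem(3)[OF v, of "up 1 v"] by argo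
qed (simp add: parent_C)

lemma stem_near:
  assumes "level v \<le> 5 * d" "z \<in> set (stem v)" "z' \<in> set (stem v)" "level z' \<le> level z"
  shows "near G (level z - level z') z z'"
proof -
  let ?i = "level v - level z" and ?j = "level v - level z'"
  have nth: "stem v ! i = up i v" if "i \<le> level v" for i
    using that unfolding stem_def by (simp del: upt_Suc add: nth_map nth_upt)
  have e: "stem v ! ?i = z" "stem v ! ?j = z'"
    using stem_elem(1)[OF assms(1,2)] stem_elem(1)[OF assms(1,3)] nth by simp_all
  have "near G (?j - ?i) (stem v ! ?i) (stem v ! ?j)"
    by (rule walk_nth_near[OF stem_walk(1)[OF assms(1)]]) (use assms(4) stem_elem(2)[OF assms(1,2)] in auto)
  moreover have "?j - ?i = level z - level z'" using assms(4) stem_elem(2)[OF assms(1,2)] by simp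
  ultimately show ?thesis using e by simp
qed

lemma stem_near_root: "level v \<le> 5 * d \<Longrightarrow> z \<in> set (stem v) \<Longrightarrow> near G (level z) z (foot v)"
  using stem_near[of v z "foot v"] foot_C[of v] level_0[of "foot v"] by simp

lemma stem_near_top: "level v \<le> 5 * d \<Longrightarrow> z \<in> set (stem v) \<Longrightarrow> near G (level v - level z) v z"
  using stem_near[of v v z] stem_elem(2)[of v z] by simp

lemma stem_verts: 
  assumes "level v \<le> 5 * d" shows "set (stem v) \<subseteq> verts G"
proof
  fix z assume z: "z \<in> set (stem v)"
  have "foot v \<in> verts G" using foot_C[OF assms] C_verts by blast
  then show "z \<in> verts G" using near_verts[OF near_sym[OF stem_near_root[OF assms z]] S] by blast
qed

lemma stem_C: "level v \<le> 5 * d \<Longrightarrow> z \<in> set (stem v) \<Longrightarrow> z \<in> C \<Longrightarrow> z = foot v"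
  using stem_eqI[of v z "foot v"] foot_C[of v] level_0[of z] level_0[of "foot v"] by simp

text \<open>
Such an \<open>x\<close> has level at most \<open>d\<close>, so it is also within \<open>d\<close> of its foot. This is what makes
ears ending in stems suitable for \<open>fat_ears\<close>.
\<close>

lemma stem_clean:
  assumes "level v \<le> 5 * d" "x \<in> set (stem v)" "y \<in> C" "near G d x y"
  shows "near G (2 * d) (foot v) y"
proof -
  have "level x \<le> d" using level_near[OF near_sym[OF assms(4)]] level_0[of y] assms(3) by simp
  then have "near G d (foot v) x" by (rule near_mono[OF near_sym[OF stem_near_root[OF assms(1,2)]]])
  from near_trans[OF this assms(4)] show ?thesis by (simp add: mult_2)
qed

text \<open>
Going down from \<open>u\<close> and \<open>v\<close> to the first common vertex \<open>c\<close> of their stems and back along \<open>pl\<close>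
closes a cycle. Apart from \<open>pl\<close>, the vertex \<open>c\<close> is its unique lowest vertex; so if \<open>c\<close> is high, the
cycle is high, and no other stem vertex of the cycle is on \<open>C\<close>.
\<close>

lemma meet_cycle:
  assumes u: "level u \<le> 5 * d" and v: "level v \<le> 5 * d" and uv: "u \<noteq> v" and w: "walk G (u # pl @ [v])"
    and dp: "distinct pl" and dj: "set pl \<inter> (set (stem u) \<union> set (stem v)) = {}"
    and ne: "pl = [] \<Longrightarrow> parent u \<noteq> v \<and> parent v \<noteq> u" and meet: "set (stem u) \<inter> set (stem v) \<noteq> {}"
  obtains \<alpha> c where "cyc G (\<alpha> @ [c])" "c \<in> set (stem u)" "c \<in> set (stem v)"
    "set \<alpha> \<subseteq> set (stem u) \<union> set (stem v) \<union> set pl"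
    "\<And>a. a \<in> set \<alpha> \<Longrightarrow> a \<notin> set pl \<Longrightarrow> level c < level a"
    "\<And>c'. c' \<in> set (stem u) \<Longrightarrow> c' \<in> set (stem v) \<Longrightarrow> level c' \<le> level c"
    "length \<alpha> \<le> level u + level v + length pl"
proof -
  obtain c0 where "c0 \<in> set (stem u) \<inter> set (stem v)" using meet by blast
  then have "\<exists>c. c \<in> set (stem u) \<inter> set (stem v) \<and> (\<forall>c'. c' \<in> set (stem u) \<inter> set (stem v) \<longrightarrow> level c' \<le> level c)"
    by (rule ex_has_greatest_nat[where b = "Suc (5 * d + 1)"]) (use level_max in \<open>simp add: less_Suc_eq_le\<close>)
  then obtain c where c: "c \<in> set (stem u) \<inter> set (stem v)"
      "\<And>c'. c' \<in> set (stem u) \<inter> set (stem v) \<Longrightarrow> level c' \<le> level c" by blast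
  define i where "i = level u - level c"
  define j where "j = level v - level c"
  have cu: "c = up i u" "level c \<le> level u" and cv: "c = up j v" "level c \<le> level v"
    using stem_elem[OF u, of c] stem_elem[OF v, of c] c(1) unfolding i_def j_def by auto
  define A where "A = map (\<lambda>i. up i u) [0..<i]"
  define B where "B = map (\<lambda>i. up i v) [0..<j]"
  have A': "A @ [c] = map (\<lambda>i. up i u) [0..<Suc i]" and B': "B @ [c] = map (\<lambda>i. up i v) [0..<Suc j]"
    unfolding A_def B_def using cu(1) cv(1) by simp_all
  have wA: "walk G (A @ [c])" "distinct (A @ [c])" and wB: "walk G (B @ [c])" "distinct (B @ [c])"
    unfolding A' B' using stem_up_walk[OF u, of "Suc i"] stem_up_walk[OF v, of "Suc j"]
    unfolding i_def j_def by simp_all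
  have hA: "hd (A @ [c]) = u" and hB: "hd (B @ [c]) = v"
    unfolding A' B' by (simp_all add: hd_map del: upt_Suc)
  have subA: "set A \<subseteq> set (stem u)" "\<And>a. a \<in> set A \<Longrightarrow> level c < level a"
    using level_up[OF u] cu(2) unfolding A_def set_stem i_def by auto
  have subB: "set B \<subseteq> set (stem v)" "\<And>a. a \<in> set B \<Longrightarrow> level c < level a"
    using level_up[OF v] cv(2) unfolding B_def set_stem j_def by auto
  define M where "M = rev A @ pl @ B"
  obtain A2 where A2: "A @ [c] = u # A2" using hA by (cases "A @ [c]") auto
  obtain B2 where B2: "B @ [c] = v # B2" using hB by (cases "B @ [c]") auto
  have "walk G (rev (A @ [c]))" using wA(1) by (simp only: walk_rev)
  then have "walk G (rev A2 @ [u])" unfolding A2 by simp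
  then have wj: "walk G (rev A2 @ u # pl @ v # B2)"
    using walk_join[OF _ w] wB(1) unfolding B2 by blast
  have "rev A2 @ u # pl @ v # B2 = rev (A @ [c]) @ pl @ (B @ [c])" unfolding A2 B2 by simp
  also have "\<dots> = c # M @ [c]" unfolding M_def by simp
  finally have wM: "walk G (c # M @ [c])" using wj by simp
  have dM: "distinct (c # M)"
  proof -
    have "set A \<inter> set B = {}"
    proof (rule ccontr)
      assume "\<not> ?thesis"
      then obtain a where a: "a \<in> set A" "a \<in> set B" by blast
      then have "level a \<le> level c" using c(2)[of a] subA(1) subB(1) by blast
      then show False using subA(2)[OF a(1)] by simp
    qed
    moreover have "c \<notin> set pl" using dj c(1) by blast
    moreover have "set A \<inter> set pl = {}" "set B \<inter> set pl = {}" using dj subA(1) subB(1) by blast+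
    ultimately show ?thesis using wA(2) wB(2) dp unfolding M_def by auto
  qed
  have lM: "length M = i + j + length pl" unfolding M_def A_def B_def by simp
  have "2 \<le> length M"
  proof (rule ccontr)
    assume "\<not> ?thesis"
    then have l1: "i + j + length pl \<le> 1" using lM by simp
    have "i + j \<noteq> 0" using uv cu(1) cv(1) by (metis add_is_0 up_0)
    then have "pl = []" "(i = 1 \<and> j = 0) \<or> (i = 0 \<and> j = 1)" using l1
      by (auto simp: add_eq_if split: if_splits)
    then show False using ne cu(1) cv(1) by (auto simp: up_Suc)
  qed
  moreover have "walk G (c # M)" "adj G (last (c # M)) c"
    using wM successively_append_iff[of "adj G" "c # M" "[c]"] by auto
  ultimately have "cyc G (c # M)" using dM unfolding cyc_def by simp
  then have "cyc G (M @ [c])" using cyc_rotate[of G "[c]" M] by simp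
  then show thesis
  proof (rule that)
    show "c \<in> set (stem u)" "c \<in> set (stem v)" using c(1) by auto
    show "set M \<subseteq> set (stem u) \<union> set (stem v) \<union> set pl" using subA(1) subB(1) unfolding M_def by auto
    show "level c < level a" if "a \<in> set M" "a \<notin> set pl" for a using that subA(2) subB(2)
      unfolding M_def by auto
    show "level c' \<le> level c" if "c' \<in> set (stem u)" "c' \<in> set (stem v)" for c' using that c(2) by blast
    show "length M \<le> level u + level v + length pl" unfolding lM i_def j_def by simp
  qed
qed

section \<open>Bad edges and bridges\<close>

text \<open>
The edges of the breadth-first forest and of the chosen cycles. An edge between vertices of level at
most \<open>5 d\<close> that is not good is called bad.
\<close>

definition good :: "'a \<Rightarrow> 'a \<Rightarrow> bool" where
  "good u v \<longleftrightarrow> parent v = u \<or> parent u = v \<or> (\<exists>p\<in>\<P>. {u, v} \<in> edges (cyc_graph p))"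

text \<open>
The stems of the two ends of a bridge, joined by the bridge, form an ear between different
chosen cycles.
\<close>

definition bridge :: "'a \<Rightarrow> 'a \<Rightarrow> bool" where
  "bridge u v \<longleftrightarrow> adj G u v \<and> level u \<le> 5 * d \<and> level v \<le> 5 * d \<and> \<not> (\<exists>p\<in>\<P>. foot u \<in> set p \<and> foot v \<in> set p)"

text \<open>
The stems of \<open>u\<close> and \<open>v\<close> and the edge between them form a detour of \<open>p\<close>, or contain a cycle
that meets \<open>p\<close> at most once. If all their vertices above \<open>C\<close> avoided the forbidden neighbourhood,
then in both cases there would be an admissible cycle shorter than \<open>p\<close>.
\<close>

lemma bad_same_cycle:
  assumes uv: "adj G u v" and u: "level u \<le> 5 * d" and v: "level v \<le> 5 * d" and bad: "\<not> good u v"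
    and p: "p \<in> \<P>" "foot u \<in> set p" "foot v \<in> set p" and long: "20 * d + 2 < length p"
  shows "\<exists>z\<in>set (stem u) \<union> set (stem v). 1 \<le> level z \<and> (\<exists>q\<in>\<P>. q \<noteq> p \<and> (\<exists>y\<in>set q. near G (4 * d) y z))"
proof (rule ccontr)
  assume no: "\<not> ?thesis"
  obtain \<Q>
    where Q: "\<Q> \<subseteq> \<P> - {p}" and m: "minimal_admissible G (nbhd G (\<Union> (set ` \<Q>)) (4 * d)) (4 * d - 1) p"
    using minP[OF p(1)] by blast
  let ?S = "nbhd G (\<Union> (set ` \<Q>)) (4 * d)"
  have out: "z \<notin> ?S" if "z \<in> set (stem u) \<union> set (stem v)" "1 \<le> level z" for z
  proof
    assume "z \<in> ?S"
    then obtain q y where "q \<in> \<Q>" "y \<in> set q" "near G (4 * d) y z" unfolding nbhd_def by blast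
    then show False using no that Q by blast
  qed
  have ne: "u \<noteq> v" using simple_adjD[OF S uv] by blast
  show False
  proof (cases "set (stem u) \<inter> set (stem v) = {}")
    case False
    obtain \<alpha> c where ac: "cyc G (\<alpha> @ [c])" "set \<alpha> \<subseteq> set (stem u) \<union> set (stem v) \<union> set []"
      "\<And>a. a \<in> set \<alpha> \<Longrightarrow> a \<notin> set [] \<Longrightarrow> level c < level a" "length \<alpha> \<le> level u + level v + length ([]::'a list)"
      by (rule meet_cycle[OF u v ne, of "[]"]) (use uv bad False in \<open>auto simp: good_def\<close>)
    have "length p \<le> length \<alpha> + length [c]"
    proof (rule minimal_admissible_le[OF m ac(1)])
      show "\<alpha> \<noteq> []" using ac(1) by (auto simp: cyc_def)
      show "set \<alpha> \<inter> ?S = {}"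
      proof (rule ccontr)
        assume "\<not> ?thesis"
        then obtain a where a: "a \<in> set \<alpha>" "a \<in> ?S" by blast
        then have "1 \<le> level a" using ac(3)[OF a(1)] by simp
        then show False using out[of a] a ac(2) by auto
      qed
      show "length [c] \<le> 4 * d - 1" using d1 by simp
    qed
    then show False using ac(4) u v long by simp
  next
    case True
    define W where "W = rev (butlast (stem u)) @ butlast (stem v)"
    have ru: "stem u = butlast (stem u) @ [foot u]" and rv: "stem v = butlast (stem v) @ [foot v]"
      using append_butlast_last_id[of "stem u"] append_butlast_last_id[of "stem v"] by simp_all
    have "rev (stem u) @ stem v = rev (butlast (stem u) @ [foot u]) @ (butlast (stem v) @ [foot v])"
      using ru rv by metis
    then have eq: "rev (stem u) @ stem v = foot u # W @ [foot v]" unfolding W_def by simp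
    have "walk G (rev (stem u) @ stem v)"
      using stem_walk(1)[OF u] stem_walk(1)[OF v] uv
      by (simp add: successively_append_iff last_rev del: successively_rev)
    then have wW: "walk G (foot u # W @ [foot v])" using eq by simp
    have "distinct (rev (stem u) @ stem v)" using stem_walk(2)[OF u] stem_walk(2)[OF v] True by auto
    then have dW: "distinct (foot u # W @ [foot v])" using eq by simp
    have subW: "set W \<subseteq> set (stem u) \<union> set (stem v)" unfolding W_def using in_set_butlastD by fastforce
    have dlW: "1 \<le> level z" if "z \<in> set W" for z
    proof (rule ccontr)
      assume "\<not> 1 \<le> level z"
      then have "z \<in> C" using level_0[of z] by simp
      then have "z = foot u \<or> z = foot v" using that subW stem_C[OF u] stem_C[OF v] by blast
      then show False using that dW by auto
    qed
    have djp: "set W \<inter> set p = {}"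
    proof (rule ccontr)
      assume "\<not> ?thesis"
      then obtain z where z: "z \<in> set W" "z \<in> set p" by blast
      then have "level z = 0" using p(1) level_0[of z] unfolding C_def by blast
      then show False using dlW[OF z(1)] by simp
    qed
    have WS: "set W \<inter> ?S = {}" using out dlW subW by blast
    have lW: "2 * length W + 2 < length p" using u v long unfolding W_def by simp
    have chord: "{foot u, foot v} \<notin> edges (cyc_graph p)" if "W = []"
    proof -
      have "rev (stem u) @ stem v = [foot u, foot v]" using eq that by simp
      then have "length (rev (stem u) @ stem v) = length [foot u, foot v]" by (simp only:)
      then have "level u = 0" "level v = 0" by auto
      then have "foot u = u" "foot v = v" using foot_of_C level_0 by auto
      then show ?thesis using bad p(1) unfolding good_def by auto
    qed
    have ne': "foot u \<noteq> foot v" using dW by auto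
    obtain l1 r where lr: "p = l1 @ foot u # r" using split_list[OF p(2)] by blast
    show False
    proof (cases "foot v \<in> set r")
      case True
      then obtain l2 l3 where "r = l2 @ foot v # l3" by (meson split_list)
      then show False using minimal_admissible_no_detour[OF m _ wW _ djp WS lW chord] lr dW by auto
    next
      case False
      then have "foot v \<in> set l1" using lr p(3) ne' by auto
      then obtain k1 k2 where "l1 = k1 @ foot v # k2" by (meson split_list)
      then have pl: "p = k1 @ foot v # k2 @ foot u # r" using lr by simp
      have "walk G (rev (foot u # W @ [foot v]))" using wW by (simp only: walk_rev)
      then have w': "walk G (foot v # rev W @ [foot u])" by simp
      show False
        by (rule minimal_admissible_no_detour[OF m pl w']) (use dW djp WS lW chord in \<open>auto simp: insert_commute\<close>)
    qed
  qed
qed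

text \<open>
In the third case, a vertex \<open>z\<close> above \<open>C\<close> on the stem of \<open>u\<close> or \<open>v\<close> is within \<open>4 d\<close> of another chosen
cycle. Along a path from \<open>z\<close> to that cycle, the feet eventually change to a different cycle, and
the edge where they leave \<open>p\<close> is a bridge. Its stems are within \<open>4 d\<close> of \<open>z\<close>, because its
far end is not higher than the rest of the path is long; and \<open>z\<close> is at most \<open>5 d - 1\<close> below the bad
edge.
\<close>

lemma bad_cover:
  assumes uv: "adj G u v" and u: "level u \<le> 5 * d" and v: "level v \<le> 5 * d" and bad: "\<not> good u v"
  obtains "bridge u v" | p where "p \<in> \<P>" "foot u \<in> set p" "length p \<le> 20 * d + 2"
  | x y a where "bridge x y" "a \<in> {u, v}" "\<And>w. w \<in> set (stem x) \<union> set (stem y) \<Longrightarrow> near G (9 * d - 1) a w"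
proof (cases "bridge u v")
  case True
  then show thesis by (rule that(1))
next
  case False
  then obtain p where p: "p \<in> \<P>" "foot u \<in> set p" "foot v \<in> set p" using uv u v unfolding bridge_def
    by blast
  show thesis
  proof (cases "length p \<le> 20 * d + 2")
    case True
    then show thesis using that(2) p by blast
  next
    case False
    then obtain z q y
      where z: "z \<in> set (stem u) \<union> set (stem v)" "1 \<le> level z" "q \<in> \<P>" "q \<noteq> p" "y \<in> set q" "near G (4 * d) y z"
      using bad_same_cycle[OF uv u v bad p] by auto
    obtain a where a: "a \<in> {u, v}" "z \<in> set (stem a)" using z(1) by blast
    have da: "level a \<le> 5 * d" "foot a \<in> set p" using a(1) u v p by auto
    have "near G (level a - level z) a z" by (rule stem_near_top[OF da(1) a(2)])
    then have az: "near G (5 * d - 1) a z" by (rule near_mono) (use da(1) z(2) in simp)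
    have rz: "foot z \<in> set p" using stem_elem(3)[OF da(1) a(2)] da(2) by simp
    have yC: "y \<in> C" using z(3,5) unfolding C_def by blast
    have ry: "foot y \<notin> set p" using foot_of_C[OF yC] uniqp[OF z(3) p(1) z(5)] z(4) by auto
    obtain t x' y'
      where t: "t < 4 * d" "near G t z x'" "foot x' \<in> set p" "adj G x' y'" "foot y' \<notin> set p"
        "near G (4 * d - t - 1) y' y"
      using near_crossing[where Q = "\<lambda>w. foot w \<in> set p", OF near_sym[OF z(6)] rz ry] by blast
    have dy: "level y' \<le> 4 * d - t - 1" using level_near[OF near_sym[OF t(6)]] yC level_0[of y] by simp
    have dx: "level x' \<le> 4 * d - t" using level_adj[of y' x'] t(1,4) dy by (simp add: insert_commute)
    have dl5: "level x' \<le> 5 * d" "level y' \<le> 5 * d" using dx dy by simp_all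
    have br: "bridge x' y'"
      using t(3,4,5) dl5 uniqp[OF _ p(1) _ t(3)] unfolding bridge_def by blast
    show thesis
    proof (rule that(3)[OF br a(1)])
      fix w assume w: "w \<in> set (stem x') \<union> set (stem y')"
      have "near G (4 * d) z w"
      proof (cases "w \<in> set (stem x')")
        case True
        have "near G (level x' - level w) x' w" by (rule stem_near_top[OF dl5(1) True])
        from near_trans[OF t(2) this] show ?thesis by (rule near_mono) (use dx t(1) in simp)
      next
        case False
        then have "near G (level y' - level w) y' w" using stem_near_top[OF dl5(2)] w by blast
        from near_trans[OF near_adj[OF t(4)] this] have "near G (1 + (level y' - level w)) x' w" .
        from near_trans[OF t(2) this] show ?thesis by (rule near_mono) (use dy t(1) in simp)
      qed
      from near_trans[OF az this] show "near G (9 * d - 1) a w" by (rule near_mono) simp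
    qed
  qed
qed

section \<open>Ears formed by tree paths\<close>

lemma ear_list:
  assumes v: "level v \<le> 5 * d" and w: "level w \<le> 5 * d" and wk: "walk G (v # pl @ [w])" and dp: "distinct pl"
    and dj: "set pl \<inter> (set (stem v) \<union> set (stem w)) = {}" and pC: "set pl \<inter> C = {}"
    and dis: "set (stem v) \<inter> set (stem w) = {}"
  defines "L \<equiv> rev (stem v) @ pl @ stem w"
  shows "distinct L" "walk G L" "2 \<le> length L" "hd L = foot v" "last L = foot w"
    "set L \<inter> C \<subseteq> {foot v, foot w}" "set L = set (stem v) \<union> set pl \<union> set (stem w)"
proof -
  show "distinct L" unfolding L_def using stem_walk(2)[OF v] stem_walk(2)[OF w] dp dj dis by auto
  obtain v2 where v2: "stem v = v # v2" using hd_stem[of v] by (cases "stem v") auto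
  obtain w2 where w2: "stem w = w # w2" using hd_stem[of w] by (cases "stem w") auto
  have "walk G (rev (stem v))" using stem_walk(1)[OF v] by (simp only: walk_rev)
  then have "walk G (rev v2 @ [v])" unfolding v2 by simp
  from walk_join[OF this wk] stem_walk(1)[OF w] show "walk G L" unfolding L_def v2 w2 by simp
  show "2 \<le> length L" unfolding L_def by simp
  show "hd L = foot v" unfolding L_def using hd_append2[of "rev (stem v)"] by (simp add: hd_rev)
  show "last L = foot w" unfolding L_def by simp
  show "set L = set (stem v) \<union> set pl \<union> set (stem w)" unfolding L_def by auto
  then show "set L \<inter> C \<subseteq> {foot v, foot w}" using pC stem_C[OF v] stem_C[OF w] by blast
qed

fun ear_verts :: "'a \<times> 'a list \<times> 'a \<Rightarrow> 'a set" where
  "ear_verts (v, pl, w) = set (stem v) \<union> set pl \<union> set (stem w)"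

fun feet :: "'a \<times> 'a list \<times> 'a \<Rightarrow> 'a set" where
  "feet (v, pl, w) = {foot v, foot w}"

fun far_feet :: "'a \<times> 'a list \<times> 'a \<Rightarrow> bool" where
  "far_feet (v, pl, w) \<longleftrightarrow> \<not> near G (2 * d) (foot v) (foot w)"

text \<open>
A triple \<open>(v, pl, w)\<close> stands for the ear that consists of the stem of \<open>v\<close>, the path \<open>pl\<close>, and
the stem of \<open>w\<close>; \<open>pl\<close> is empty for bridges. The level condition says that \<open>pl\<close> does not come
within distance \<open>d\<close> of \<open>C\<close>.
\<close>

fun stem_ear :: "'a \<times> 'a list \<times> 'a \<Rightarrow> bool" where
  "stem_ear (v, pl, w) \<longleftrightarrow> level v \<le> 5 * d \<and> level w \<le> 5 * d \<and> walk G (v # pl @ [w]) \<and> distinct pl \<and>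
     set pl \<inter> (set (stem v) \<union> set (stem w)) = {} \<and> (\<forall>z\<in>set pl. d < level z)"

lemma feet_ear_verts: "feet t \<subseteq> ear_verts t"
  by (cases t) auto

lemma ear_verts_clean:
  assumes "stem_ear t" "x \<in> ear_verts t" "y \<in> C" "near G d x y"
  shows "\<exists>a\<in>feet t. near G (2 * d) a y"
proof -
  obtain v pl w where t: "t = (v, pl, w)" by (cases t)
  have "level x \<le> d" using level_near[OF near_sym[OF assms(4)]] level_0[of y] assms(3) by simp
  then have "x \<in> set (stem v) \<or> x \<in> set (stem w)" using assms(1,2) unfolding t by auto
  then show ?thesis
    using stem_clean[OF _ _ assms(3,4)] assms(1) unfolding t by auto
qed

text \<open>
An instance of \<open>fat_ears\<close>: the stems of an ear are disjoint because its feet differ, and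
cleanness is \<open>ear_verts_clean\<close>.
\<close>

lemma stem_ears_packing:
  assumes fin: "finite T" and ears: "\<And>t. t \<in> T \<Longrightarrow> stem_ear t \<and> far_feet t"
    and far: "\<And>t t' x y. t \<in> T \<Longrightarrow> t' \<in> T \<Longrightarrow> t \<noteq> t' \<Longrightarrow> x \<in> ear_verts t \<Longrightarrow> y \<in> ear_verts t' \<Longrightarrow> \<not> near G d x y"
    and ff: "\<And>t t' x y. t \<in> T \<Longrightarrow> t' \<in> T \<Longrightarrow> t \<noteq> t' \<Longrightarrow> x \<in> feet t \<Longrightarrow> y \<in> feet t' \<Longrightarrow> \<not> near G (2 * d) x y"
    and k1: "1 \<le> k" and many: "s_fun k \<le> 2 * card T"
  shows "\<exists>\<C>. d_packing d G \<C> \<and> card \<C> = k"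
proof -
  define L where "L t = rev (stem (fst t)) @ fst (snd t) @ stem (snd (snd t))"
    for t :: "'a \<times> 'a list \<times> 'a"
  have Lf: "distinct (L t)" "walk G (L t)" "2 \<le> length (L t)" "{hd (L t), last (L t)} = feet t" "feet t \<subseteq> C"
    "set (L t) \<inter> C \<subseteq> feet t" "set (L t) = ear_verts t" "\<not> near G (2 * d) (hd (L t)) (last (L t))"
      if tT: "t \<in> T" for t
  proof -
    obtain v pl w where t: "t = (v, pl, w)" by (cases t)
    have e: "level v \<le> 5 * d" "level w \<le> 5 * d" "walk G (v # pl @ [w])" "distinct pl"
      "set pl \<inter> (set (stem v) \<union> set (stem w)) = {}" "\<And>z. z \<in> set pl \<Longrightarrow> d < level z" "\<not> near G (2 * d) (foot v) (foot w)"
      using ears[OF tT] unfolding t by auto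
    have pC: "set pl \<inter> C = {}" using e(6) level_0 by force
    have dis: "set (stem v) \<inter> set (stem w) = {}"
    proof (rule ccontr)
      assume "\<not> ?thesis"
      then obtain z where "z \<in> set (stem v)" "z \<in> set (stem w)" by blast
      then have "foot v = foot w" using stem_elem(3)[OF e(1)] stem_elem(3)[OF e(2)] by metis
      then show False using e(7) by simp
    qed
    have L: "L t = rev (stem v) @ pl @ stem w" unfolding L_def t by simp
    note l = ear_list[OF e(1-5) pC dis, folded L]
    show "distinct (L t)" "walk G (L t)" "2 \<le> length (L t)" "{hd (L t), last (L t)} = feet t" "feet t \<subseteq> C"
      "set (L t) \<inter> C \<subseteq> feet t" "set (L t) = ear_verts t" "\<not> near G (2 * d) (hd (L t)) (last (L t))"
      using l e(7) foot_C e(1,2) unfolding t by simp_all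
  qed
  have inj: "inj_on L T"
  proof (rule inj_onI, rule ccontr)
    fix t t' assume h: "t \<in> T" "t' \<in> T" "L t = L t'" "t \<noteq> t'"
    then have "hd (L t) \<in> ear_verts t" "hd (L t) \<in> ear_verts t'"
      using Lf(4)[OF h(1)] feet_ear_verts[of t] Lf(7)[OF h(1)] Lf(7)[OF h(2)] by auto
    from far[OF h(1,2,4) this] show False by simp
  qed
  show ?thesis
  proof (rule fat_ears[OF S d1 k1 finP cycP sep iso C_def, where \<E> = "L ` T"])
    show "finite (L ` T)" using fin by simp
    show "s_fun k \<le> 2 * card (L ` T)" using many by (simp add: card_image[OF inj])
  next
    fix P assume "P \<in> L ` T"
    then obtain t where t: "t \<in> T" "P = L t" by blast
    note f = Lf[OF t(1)]
    show "distinct P \<and> walk G P \<and> 2 \<le> length P \<and> hd P \<in> C \<and> last P \<in> C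
        \<and> set P \<inter> C \<subseteq> {hd P, last P} \<and> \<not> near G (2 * d) (hd P) (last P)"
      unfolding t(2) using f by blast
    fix x y assume "x \<in> set P" "y \<in> C" "near G d x y"
    then show "\<exists>a\<in>{hd P, last P}. near G (2 * d) a y"
      using ear_verts_clean[of t x y] ears[OF t(1)] f(4,7) t(2) by simp
  next
    fix P Q x y assume h: "P \<in> L ` T" "Q \<in> L ` T" "P \<noteq> Q"
    then obtain t t' where t: "t \<in> T" "t' \<in> T" "P = L t" "Q = L t'" "t \<noteq> t'" by blast
    show "\<not> near G d x y" if "x \<in> set P" "y \<in> set Q"
      using far[OF t(1,2,5)] that Lf(7)[OF t(1)] Lf(7)[OF t(2)] t(3,4) by blast
    show "\<not> near G (2 * d) x y" if "x \<in> {hd P, last P}" "y \<in> {hd Q, last Q}"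
      using ff[OF t(1,2,5)] that Lf(4)[OF t(1)] Lf(4)[OF t(2)] t(3,4) by blast
  qed
qed

definition bridge_verts :: "'a \<times> 'a \<Rightarrow> 'a set" where
  "bridge_verts e = set (stem (fst e)) \<union> set (stem (snd e))"

lemma bridgeD:
  assumes "bridge u v"
  shows "adj G u v" "level u \<le> 5 * d" "level v \<le> 5 * d"
    "p \<in> \<P> \<Longrightarrow> foot u \<in> set p \<Longrightarrow> foot v \<notin> set p"
  using assms unfolding bridge_def by auto

lemma bridge_roots:
  assumes "bridge u v"
  shows "\<not> near G (2 * d) (foot u) (foot v)" "set (stem u) \<inter> set (stem v) = {}"
proof -
  note b = bridgeD[OF assms]
  obtain p where p: "p \<in> \<P>" "foot u \<in> set p" using foot_C[OF b(2)] C_cases by metis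
  obtain q where q: "q \<in> \<P>" "foot v \<in> set q" using foot_C[OF b(3)] C_cases by metis
  have "p \<noteq> q" using b(4)[OF p] q(2) by blast
  then show n: "\<not> near G (2 * d) (foot u) (foot v)" using sep[OF p(1) q(1) _ p(2) q(2)] by blast
  show "set (stem u) \<inter> set (stem v) = {}"
  proof (rule ccontr)
    assume "\<not> ?thesis"
    then obtain z where "z \<in> set (stem u)" "z \<in> set (stem v)" by blast
    then have "foot u = foot v" using stem_elem(3)[OF b(2)] stem_elem(3)[OF b(3)] by metis
    then show False using n by simp
  qed
qed

definition far_bridges :: "('a \<times> 'a) set \<Rightarrow> bool" where
  "far_bridges \<M> \<longleftrightarrow> (\<forall>e\<in>\<M>. bridge (fst e) (snd e)) \<and>
     (\<forall>e\<in>\<M>. \<forall>e'\<in>\<M>. e \<noteq> e' \<longrightarrow> (\<forall>x\<in>bridge_verts e. \<forall>y\<in>bridge_verts e'. \<not> near G (2 * d) x y))"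

lemma bridge_family:
  obtains \<M> where "finite \<M>" "far_bridges \<M>"
    "\<forall>u v. bridge u v \<longrightarrow> (\<exists>e\<in>\<M>. \<exists>x\<in>bridge_verts (u, v). \<exists>y\<in>bridge_verts e. near G (2 * d) x y)"
proof -
  have finV: "finite (verts G)" using S by (simp add: simple_graph_def)
  have sub: "\<M> \<subseteq> verts G \<times> verts G" if "far_bridges \<M>" for \<M>
  proof
    fix e assume "e \<in> \<M>"
    then have "adj G (fst e) (snd e)" using that bridgeD(1) unfolding far_bridges_def by blast
    then show "e \<in> verts G \<times> verts G" using simple_adjD[OF S] by (metis mem_Times_iff)
  qed
  have bnd: "card \<M> \<le> card (verts G \<times> verts G)" if "far_bridges \<M>" for \<M>
    using sub[OF that] finV by (intro card_mono) auto
  have "far_bridges {}" unfolding far_bridges_def by simp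
  then have "\<exists>\<M>. far_bridges \<M> \<and> (\<forall>\<N>. far_bridges \<N> \<longrightarrow> card \<N> \<le> card \<M>)"
    by (rule ex_has_greatest_nat[where b = "Suc (card (verts G \<times> verts G))"])
       (use bnd in \<open>auto simp: less_Suc_eq_le\<close>)
  then obtain \<M> where M: "far_bridges \<M>" "\<And>\<N>. far_bridges \<N> \<Longrightarrow> card \<N> \<le> card \<M>" by blast
  have finM: "finite \<M>" using sub[OF M(1)] finV finite_subset by blast
  have "\<exists>e\<in>\<M>. \<exists>x\<in>bridge_verts (u, v). \<exists>y\<in>bridge_verts e. near G (2 * d) x y" if br: "bridge u v" for u v
  proof (rule ccontr)
    assume no: "\<not> ?thesis"
    have no': "\<not> near G (2 * d) x y" "\<not> near G (2 * d) y x"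
      if "e \<in> \<M>" "x \<in> bridge_verts (u, v)" "y \<in> bridge_verts e" for e x y
      using no that near_sym[of G "2 * d"] by blast+
    have "u \<in> bridge_verts (u, v)" unfolding bridge_verts_def by simp
    then have "(u, v) \<notin> \<M>" using no'(1)[of "(u, v)" u u] by auto
    moreover have "far_bridges (insert (u, v) \<M>)"
      unfolding far_bridges_def
    proof (intro conjI ballI impI)
      fix e assume "e \<in> insert (u, v) \<M>"
      then show "bridge (fst e) (snd e)" using M(1) br unfolding far_bridges_def by auto
    next
      fix e e' x y assume h: "e \<in> insert (u, v) \<M>" "e' \<in> insert (u, v) \<M>" "e \<noteq> e'" "x \<in> bridge_verts e" "y \<in> bridge_verts e'"
      consider "e \<in> \<M>" "e' \<in> \<M>" | "e = (u, v)" "e' \<in> \<M>" | "e' = (u, v)" "e \<in> \<M>" using h by blast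
      then show "\<not> near G (2 * d) x y"
      proof cases
        case 1
        then show ?thesis using M(1) h unfolding far_bridges_def by blast
      next
        case 2
        then show ?thesis using no'(1)[of e' x y] h by simp
      next
        case 3
        then show ?thesis using no'(2)[of e y x] h by simp
      qed
    qed
    from M(2)[OF this] show False using finM \<open>(u, v) \<notin> \<M>\<close> by simp
  qed
  then show thesis using that finM M(1) by blast
qed

lemma bridges_packing:
  assumes finM: "finite \<M>" and M: "far_bridges \<M>" and k1: "1 \<le> k" and many: "s_fun k \<le> 2 * card \<M>"
  shows "\<exists>\<C>. d_packing d G \<C> \<and> card \<C> = k"
proof -
  define t where "t e = (fst e, [] :: 'a list, snd e)" for e :: "'a \<times> 'a"
  have ear_verts_t: "ear_verts (t e) = bridge_verts e" for e unfolding t_def bridge_verts_def by simp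
  have far: "\<not> near G (2 * d) x y"
    if "e \<in> \<M>" "e' \<in> \<M>" "t e \<noteq> t e'" "x \<in> ear_verts (t e)" "y \<in> ear_verts (t e')" for e e' x y
  proof -
    have "e \<noteq> e'" using that(3) by auto
    then show ?thesis using M that unfolding far_bridges_def ear_verts_t by blast
  qed
  show ?thesis
  proof (rule stem_ears_packing[where T = "t ` \<M>"])
    show "finite (t ` \<M>)" using finM by simp
    have "inj_on t \<M>" unfolding t_def by (auto intro: inj_onI prod_eqI)
    then show "s_fun k \<le> 2 * card (t ` \<M>)" using many by (simp add: card_image)
    fix x assume "x \<in> t ` \<M>"
    then obtain e where e: "e \<in> \<M>" "x = t e" by blast
    have b: "bridge (fst e) (snd e)" using M e(1) unfolding far_bridges_def by blast
    show "stem_ear x \<and> far_feet x" using bridgeD(1-3)[OF b] bridge_roots[OF b] unfolding e(2) t_def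
      by simp
  next
    fix a b x y assume h: "a \<in> t ` \<M>" "b \<in> t ` \<M>" "a \<noteq> b"
    have n: "\<not> near G (2 * d) x y" if "x \<in> ear_verts a" "y \<in> ear_verts b" using h that far by blast
    show "\<not> near G d x y" if "x \<in> ear_verts a" "y \<in> ear_verts b"
      using n[OF that] near_mono[of G d x y "2 * d"] by auto
    show "\<not> near G (2 * d) x y" if "x \<in> feet a" "y \<in> feet b" using n feet_ear_verts that by blast
  qed (rule k1)
qed

section \<open>Hitting the bad edges\<close>

text \<open>
A stem has levels from 0 to at most \<open>5 d\<close>, so its top is within \<open>2 d\<close> of the levels
above \<open>3 d\<close>, and its vertex of level \<open>2 d\<close> is within \<open>2 d\<close> of the others, if the stem is that
long.
\<close>

lemma stem_cover:
  assumes v: "level v \<le> 5 * d" and z: "z \<in> set (stem v)"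
  shows "\<exists>c\<in>{v, up (level v - 2 * d) v}. near G (2 * d) c z"
proof (cases "level v - level z \<le> 2 * d")
  case True
  then show ?thesis using near_mono[OF stem_near_top[OF v z]] by blast
next
  case False
  let ?c = "up (level v - 2 * d) v"
  have c: "?c \<in> set (stem v)" unfolding set_stem by auto
  have dc: "level ?c = 2 * d" using level_up[OF v] False by simp
  have "near G (2 * d) ?c z"
  proof (cases "level z \<le> 2 * d")
    case True
    then show ?thesis using near_mono[OF stem_near[OF v c z]] dc by simp
  next
    case False
    then have "near G (level z - 2 * d) z ?c" using stem_near[OF v z c] dc by simp
    then have "near G (2 * d) z ?c" by (rule near_mono) (use \<open>\<not> level v - level z \<le> 2 * d\<close> v in simp)
    then show ?thesis by (rule near_sym)
  qed
  then show ?thesis by blast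
qed

text \<open>
The first vertex of \<open>p\<close> also serves to hit the closing edge of \<open>p\<close>, which is missing in the
spanning forest. The other two matter for cycles of length at most \<open>20 d + 2\<close>.
\<close>

definition cycle_pts :: "'a list \<Rightarrow> 'a set" where
  "cycle_pts p = {p ! 0, p ! min (8 * d) (length p - 1), p ! min (16 * d) (length p - 1)}"

definition bridge_pts :: "'a \<times> 'a \<Rightarrow> 'a set" where
  "bridge_pts e = {fst e, up (level (fst e) - 2 * d) (fst e), snd e, up (level (snd e) - 2 * d) (snd e)}"

definition hitting_pts :: "('a \<times> 'a) set \<Rightarrow> 'a set" where
  "hitting_pts \<M> = (\<Union>p\<in>\<P>. cycle_pts p) \<union> (\<Union>e\<in>\<M>. bridge_pts e)"

lemma cycle_pts_cover:
  assumes p: "p \<in> \<P>" and len: "length p \<le> 20 * d + 2" and x: "x \<in> set p"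
  shows "\<exists>c\<in>cycle_pts p. near G (8 * d) c x"
proof -
  obtain t where t: "t < length p" "p ! t = x" using x by (auto simp: in_set_conv_nth)
  have w: "walk G p" using cycP[OF p] by (simp add: cyc_def)
  have nn: "near G (8 * d) (p ! i) x" if "i \<le> t" "t \<le> i + 8 * d" for i
    using near_mono[OF walk_nth_near[OF w that(1) t(1)], of "8 * d"] t(2) that(2) by simp
  consider "t \<le> 8 * d" | "8 * d < t" "t \<le> 16 * d" | "16 * d < t" by linarith
  then show ?thesis
  proof cases
    case 1
    then show ?thesis using nn[of 0] unfolding cycle_pts_def by auto
  next
    case 2
    then have "min (8 * d) (length p - 1) = 8 * d" using t by simp
    then show ?thesis using nn[of "8 * d"] 2 unfolding cycle_pts_def by auto
  next
    case 3
    then have "min (16 * d) (length p - 1) = 16 * d" using t by simp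
    then show ?thesis using nn[of "16 * d"] 3 t len d1 unfolding cycle_pts_def by auto
  qed
qed

lemma hitting_pts_card:
  assumes "finite \<M>"
  shows "card (hitting_pts \<M>) \<le> 3 * card \<P> + 4 * card \<M>"
proof -
  have c3: "card (cycle_pts p) \<le> 3" for p
    unfolding cycle_pts_def by (rule order_trans[OF card_insert_Suc]) (simp add: card_insert_if)
  have c4: "card (bridge_pts e) \<le> 4" for e
    unfolding bridge_pts_def
    by (rule order_trans[OF card_insert_Suc], simp, rule order_trans[OF card_insert_Suc]) (simp add: card_insert_if)
  have "card (hitting_pts \<M>) \<le> card (\<Union>p\<in>\<P>. cycle_pts p) + card (\<Union>e\<in>\<M>. bridge_pts e)"
    unfolding hitting_pts_def by (rule card_Un_le)
  also have "\<dots> \<le> (\<Sum>p\<in>\<P>. card (cycle_pts p)) + (\<Sum>e\<in>\<M>. card (bridge_pts e))"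
    by (intro add_mono card_UN_le finP assms)
  also have "\<dots> \<le> (\<Sum>p\<in>\<P>. 3) + (\<Sum>e\<in>\<M>. 4)" by (intro add_mono sum_mono c3 c4)
  finally show ?thesis by (simp add: mult.commute)
qed

lemma hitting_pts_verts:
  assumes "far_bridges \<M>"
  shows "hitting_pts \<M> \<subseteq> verts G"
proof -
  have "cycle_pts p \<subseteq> verts G" if "p \<in> \<P>" for p
  proof -
    have l: "0 < length p" using cyc_nonempty[OF cycP[OF that]] by simp
    then have "min a (length p - 1) < length p" for a by linarith
    then have "cycle_pts p \<subseteq> set p" using l unfolding cycle_pts_def by auto
    then show ?thesis using that C_verts unfolding C_def by blast
  qed
  moreover have "bridge_pts e \<subseteq> verts G" if "e \<in> \<M>" for e
  proof -
    have b: "bridge (fst e) (snd e)" using assms that unfolding far_bridges_def by blast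
    have "up (level v - 2 * d) v \<in> set (stem v)" for v unfolding set_stem by auto
    then have "bridge_pts e \<subseteq> set (stem (fst e)) \<union> set (stem (snd e))" unfolding bridge_pts_def by auto
    then show ?thesis using stem_verts[OF bridgeD(2)[OF b]] stem_verts[OF bridgeD(3)[OF b]] by blast
  qed
  ultimately show ?thesis unfolding hitting_pts_def by blast
qed

text \<open>
The distances add up as follows: from a bridge, at most \<open>5 d\<close> along its stem to a vertex close to
a chosen bridge, \<open>2 d\<close> to the stem of that one, and \<open>2 d\<close> to a point; for a short cycle, \<open>5 d\<close> down
the stem and \<open>8 d\<close> along the cycle; in the remaining case of \<open>bad_cover\<close>, \<open>9 d - 1\<close> to the stem
of a bridge, and again \<open>2 d\<close> and \<open>2 d\<close>.
\<close>

lemma hitting_pts_cover: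
  assumes M: "far_bridges \<M>"
    and max: "\<forall>u v. bridge u v \<longrightarrow> (\<exists>e\<in>\<M>. \<exists>x\<in>bridge_verts (u, v). \<exists>y\<in>bridge_verts e. near G (2 * d) x y)"
    and uv: "adj G u v" and u: "level u \<le> 5 * d" and v: "level v \<le> 5 * d" and bad: "\<not> good u v"
  shows "\<exists>c\<in>hitting_pts \<M>. \<exists>a\<in>{u, v}. near G (13 * d) c a"
proof -
  have near_bridge: "\<exists>c\<in>hitting_pts \<M>. \<exists>w\<in>bridge_verts (x, y). near G (4 * d) c w" if "bridge x y"
    for x y
  proof -
    obtain e w z where e: "e \<in> \<M>" "w \<in> bridge_verts (x, y)" "z \<in> bridge_verts e" "near G (2 * d) w z"
      using max \<open>bridge x y\<close> by blast
    have b: "bridge (fst e) (snd e)" using M e(1) unfolding far_bridges_def by blast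
    have "\<exists>c\<in>bridge_pts e. near G (2 * d) c z"
    proof (cases "z \<in> set (stem (fst e))")
      case True
      then show ?thesis using stem_cover[OF bridgeD(2)[OF b]] unfolding bridge_pts_def by blast
    next
      case False
      then show ?thesis using stem_cover[OF bridgeD(3)[OF b]] e(3)
        unfolding bridge_pts_def bridge_verts_def by blast
    qed
    then obtain c where c: "c \<in> bridge_pts e" "near G (2 * d) c z" by blast
    have "near G (2 * d + 2 * d) c w" by (rule near_trans[OF c(2) near_sym[OF e(4)]])
    then have "near G (4 * d) c w" by simp
    then show ?thesis using c(1) e(1,2) unfolding hitting_pts_def by blast
  qed
  show ?thesis
  proof (rule bad_cover[OF uv u v bad])
    assume br: "bridge u v"
    obtain c w where c: "c \<in> hitting_pts \<M>" "w \<in> bridge_verts (u, v)" "near G (4 * d) c w"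
      using near_bridge[OF br] by blast
    have "\<exists>a\<in>{u, v}. near G (5 * d) w a"
    proof (cases "w \<in> set (stem u)")
      case True
      have "near G (5 * d) u w" by (rule near_mono[OF stem_near_top[OF u True]]) (use u in simp)
      then have "near G (5 * d) w u" by (rule near_sym)
      then show ?thesis by blast
    next
      case False
      then have wv: "w \<in> set (stem v)" using c(2) unfolding bridge_verts_def by simp
      have "near G (5 * d) v w" by (rule near_mono[OF stem_near_top[OF v wv]]) (use v in simp)
      then have "near G (5 * d) w v" by (rule near_sym)
      then show ?thesis by blast
    qed
    then obtain a where a: "a \<in> {u, v}" "near G (5 * d) w a" by blast
    have "near G (13 * d) c a" by (rule near_mono[OF near_trans[OF c(3) a(2)]]) simp
    then show ?thesis using c(1) a(1) by blast
  next
    fix p assume p: "p \<in> \<P>" "foot u \<in> set p" "length p \<le> 20 * d + 2"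
    obtain c where c: "c \<in> cycle_pts p" "near G (8 * d) c (foot u)" using cycle_pts_cover[OF p(1,3,2)]
      by blast
    have "near G (5 * d) u (foot u)"
      by (rule near_mono[OF stem_near_root[OF u self_stem]]) (use u in simp)
    then have "near G (8 * d + 5 * d) c u" by (rule near_trans[OF c(2) near_sym])
    then have "near G (13 * d) c u" by simp
    then show ?thesis using c(1) p(1) unfolding hitting_pts_def by blast
  next
    fix x y a assume h: "bridge x y" "a \<in> {u, v}" "\<And>w. w \<in> set (stem x) \<union> set (stem y) \<Longrightarrow> near G (9 * d - 1) a w"
    obtain c w where c: "c \<in> hitting_pts \<M>" "w \<in> bridge_verts (x, y)" "near G (4 * d) c w"
      using near_bridge[OF h(1)] by blast
    have "near G (9 * d - 1) a w" using h(3) c(2) unfolding bridge_verts_def by simp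
    then have "near G (4 * d + (9 * d - 1)) c a" by (rule near_trans[OF c(3) near_sym])
    then have "near G (13 * d) c a" by (rule near_mono) simp
    then show ?thesis using c(1) h(2) by blast
  qed
qed

end

section \<open>The Gyarfas-Lehel property for arbitrary vertex types\<close>

definition map_graph :: "('a \<Rightarrow> 'b) \<Rightarrow> 'a graph \<Rightarrow> 'b graph" where
  "map_graph f A = \<lparr>verts = f ` verts A, edges = (\<lambda>e. f ` e) ` edges A\<rparr>"

lemma map_graph_simps [simp]: "verts (map_graph f A) = f ` verts A" "edges (map_graph f A) = (\<lambda>e. f ` e) ` edges A"
  by (simp_all add: map_graph_def)

lemma simple_map_graph:
  assumes "simple_graph A" "inj_on f (verts A)"
  shows "simple_graph (map_graph f A)"
  unfolding simple_graph_def map_graph_def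
proof (simp, intro conjI ballI)
  show "finite (f ` verts A)" using assms(1) by (simp add: simple_graph_def)
  fix e assume e: "e \<in> edges A"
  then have "e \<subseteq> verts A" "card e = 2" using assms(1) by (auto simp: simple_graph_def)
  then show "f ` e \<subseteq> f ` verts A" "card (f ` e) = 2"
    using inj_on_subset[OF assms(2)] by (auto simp: card_image)
qed

lemma near_map_graph: "near A n x y \<Longrightarrow> near (map_graph f A) n (f x) (f y)"
proof (induction n arbitrary: y)
  case (Suc n)
  show ?case
  proof (cases "near A n x y")
    case False
    then obtain z where z: "near A n x z" "adj A z y" using Suc.prems by auto
    from z(2) have "f ` {z, y} \<in> edges (map_graph f A)" unfolding map_graph_simps by (rule imageI)
    then have "adj (map_graph f A) (f z) (f y)" by simp
    then show ?thesis using Suc.IH[OF z(1)] by auto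
  qed (use Suc.IH in auto)
qed simp

lemma near_map_graph_inv:
  assumes "simple_graph A" "inj_on f (verts A)" "x \<in> verts A"
  shows "near (map_graph f A) n (f x) y' \<Longrightarrow> \<exists>y. y' = f y \<and> near A n x y"
proof (induction n arbitrary: y')
  case (Suc n)
  show ?case
  proof (cases "near (map_graph f A) n (f x) y'")
    case True
    then show ?thesis using Suc.IH by fastforce
  next
    case False
    then obtain z' where z': "near (map_graph f A) n (f x) z'" "adj (map_graph f A) z' y'"
      using Suc.prems by auto
    then obtain z where z: "z' = f z" "near A n x z" using Suc.IH by blast
    obtain e where e: "e \<in> edges A" "{f z, y'} = f ` e" using z'(2) z(1) unfolding map_graph_simps
      by blast
    have zV: "z \<in> verts A" by (rule near_verts[OF z(2) assms(1,3)])
    have eV: "e \<subseteq> verts A" using edge_in_verts(1)[OF assms(1) e(1)] .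
    have "f z \<in> f ` e" using e(2) by blast
    then have ze: "z \<in> e" using inj_on_image_mem_iff[OF assms(2) zV eV] by blast
    have "card e = 2" using assms(1) e(1) by (simp add: simple_graph_def)
    then obtain y where y: "e = {z, y}" "z \<noteq> y" using ze by (auto simp: card_2_iff)
    then have "{f z, y'} = {f z, f y}" using e(2) by simp
    moreover have "f z \<noteq> f y" using inj_onD[OF assms(2)] eV y by blast
    ultimately have "y' = f y" by (auto simp: doubleton_eq_iff)
    then show ?thesis using z(2) e(1) y(1) by auto
  qed
qed simp

lemma components_eq:
  assumes "simple_graph A"
  shows "components A = (\<lambda>x. {y. \<exists>n. near A n x y}) ` verts A"
  unfolding components_def quotient_def using connected_iff_near[OF assms] by auto

lemma components_map_graph:
  assumes "simple_graph A" "inj_on f (verts A)"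
  shows "card (components (map_graph f A)) \<le> card (components A)"
proof -
  have "components (map_graph f A) \<subseteq> (\<lambda>K. f ` K) ` components A"
  proof
    fix K assume "K \<in> components (map_graph f A)"
    then obtain x where x: "x \<in> verts A" "K = {y. \<exists>n. near (map_graph f A) n (f x) y}"
      unfolding components_eq[OF simple_map_graph[OF assms]] by (auto simp: map_graph_def)
    have "K = f ` {y. \<exists>n. near A n x y}"
      unfolding x(2) using near_map_graph near_map_graph_inv[OF assms x(1)] by fast
    then show "K \<in> (\<lambda>K. f ` K) ` components A" unfolding components_eq[OF assms(1)] using x(1) by blast
  qed
  moreover have "finite (components A)"
    unfolding components_eq[OF assms(1)] using assms(1) by (simp add: simple_graph_def)
  ultimately show ?thesis by (metis card_image_le card_mono finite_imageI le_trans)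
qed

text \<open>
The property is stated for forests on natural numbers; it is transported along an injection of
the vertices of \<open>F\<close>.
\<close>

lemma gyarfas_lehel_any:
  fixes F :: "'a graph"
  assumes gl: "gyarfas_lehel l" and k: "1 \<le> k" and c: "1 \<le> c" and F: "forest F"
    and A: "\<And>A. A \<in> \<A> \<Longrightarrow> subgraph A F \<and> verts A \<noteq> {} \<and> card (components A) \<le> c"
  shows "(\<exists>\<B>\<subseteq>\<A>. card \<B> = k \<and> (\<forall>A\<in>\<B>. \<forall>B\<in>\<B>. A \<noteq> B \<longrightarrow> verts A \<inter> verts B = {})) \<or>
         (\<exists>X\<subseteq>verts F. card X \<le> l k c \<and> (\<forall>A\<in>\<A>. X \<inter> verts A \<noteq> {}))"
proof -
  have SF: "simple_graph F" using F by (simp add: forest_def)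
  then have "finite (verts F)" by (simp add: simple_graph_def)
  then obtain f :: "'a \<Rightarrow> nat" where f: "inj_on f (verts F)" using finite_imp_inj_to_nat_seg by metis
  define g where "g = inv_into (verts F) f"
  have gf: "g (f x) = x" if "x \<in> verts F" for x unfolding g_def using f that by simp
  have SF': "simple_graph (map_graph f F)" by (rule simple_map_graph[OF SF f])
  have gadj: "adj F (g a) (g b)" if ab: "adj (map_graph f F) a b" for a b
  proof -
    obtain e where e: "e \<in> edges F" "{a, b} = f ` e" using ab unfolding map_graph_simps by blast
    have "g ` f ` e = e" using edge_in_verts(1)[OF SF e(1)] gf by (force simp: image_image)
    then have "{g a, g b} = e" unfolding e(2)[symmetric] by simp
    then show ?thesis using e(1) by simp
  qed
  have FF: "forest (map_graph f F)"
    unfolding forest_iff[OF SF']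
  proof (intro allI notI)
    fix q assume q: "cyc (map_graph f F) q"
    have sub: "set q \<subseteq> f ` verts F" using cyc_verts[OF SF' q] by (simp add: map_graph_def)
    have "inj_on g (f ` verts F)" unfolding g_def by (rule inj_on_inv_into) simp
    then have "distinct (map g q)" using q sub by (simp add: distinct_map cyc_def inj_on_subset)
    moreover have "walk F (map g q)"
      using q gadj unfolding cyc_def successively_map by (auto elim: successively_mono)
    moreover have "adj F (last (map g q)) (hd (map g q))"
      using q gadj cyc_nonempty[OF q] unfolding cyc_def by (simp add: last_map hd_map)
    ultimately have "cyc F (map g q)" using q unfolding cyc_def by simp
    then show False using F forest_iff[OF SF] by blast
  qed
  have AF: "verts A \<subseteq> verts F" "simple_graph A" if "A \<in> \<A>" for A using A[OF that] unfolding subgraph_def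
    by auto
  have A': "\<forall>A\<in>map_graph f ` \<A>. subgraph A (map_graph f F) \<and> verts A \<noteq> {} \<and> card (components A) \<le> c"
  proof
    fix A' assume "A' \<in> map_graph f ` \<A>"
    then obtain A where AA: "A \<in> \<A>" "A' = map_graph f A" by blast
    have inj: "inj_on f (verts A)" using f AF(1)[OF AA(1)] inj_on_subset by blast
    have "subgraph A' (map_graph f F)"
      unfolding subgraph_def AA(2) using simple_map_graph[OF AF(2)[OF AA(1)] inj] A[OF AA(1)]
      by (auto simp: map_graph_def subgraph_def)
    moreover have "verts A' \<noteq> {}" unfolding AA(2) using A[OF AA(1)] by (simp add: map_graph_def)
    moreover have "card (components A') \<le> c"
      unfolding AA(2) using components_map_graph[OF AF(2)[OF AA(1)] inj] A[OF AA(1)] by simp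
    ultimately show "subgraph A' (map_graph f F) \<and> verts A' \<noteq> {} \<and> card (components A') \<le> c" by blast
  qed
  have "(\<exists>\<B>\<subseteq>map_graph f ` \<A>. card \<B> = k \<and> pairwise (\<lambda>A B. disjnt (verts A) (verts B)) \<B>) \<or>
       (\<exists>X\<subseteq>verts (map_graph f F). card X \<le> l k c \<and> (\<forall>A\<in>map_graph f ` \<A>. X \<inter> verts A \<noteq> {}))"
    by (rule gl[unfolded gyarfas_lehel_def, THEN spec, of k, THEN spec, of c, THEN mp, OF k, THEN mp, OF c,
          THEN spec, of "map_graph f F", THEN spec, of "map_graph f ` \<A>", THEN mp, OF FF, THEN mp, OF A'])
  then show ?thesis
  proof
    assume "\<exists>\<B>\<subseteq>map_graph f ` \<A>. card \<B> = k \<and> pairwise (\<lambda>A B. disjnt (verts A) (verts B)) \<B>"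
    then obtain \<B>
      where B: "\<B> \<subseteq> map_graph f ` \<A>" "card \<B> = k" "pairwise (\<lambda>A B. disjnt (verts A) (verts B)) \<B>"
        by blast
    obtain \<U> where U: "\<U> \<subseteq> \<A>" "inj_on (map_graph f) \<U>" "\<B> = map_graph f ` \<U>"
      using B(1) by (auto simp: subset_image_inj)
    have cU: "card \<U> = k" using B(2) U(2,3) by (simp add: card_image)
    have dU: "verts A \<inter> verts B = {}" if "A \<in> \<U>" "B \<in> \<U>" "A \<noteq> B" for A B
    proof -
      have "map_graph f A \<noteq> map_graph f B" using U(2) that by (meson inj_onD)
      then have "disjnt (f ` verts A) (f ` verts B)"
        using B(3) that U(3) unfolding pairwise_def by (auto simp: map_graph_def)
      then show ?thesis unfolding disjnt_def by auto
    qed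
    show ?thesis
      by (rule disjI1, rule exI[of _ \<U>]) (intro conjI ballI impI U(1) cU dU)
  next
    assume "\<exists>X\<subseteq>verts (map_graph f F). card X \<le> l k c \<and> (\<forall>A\<in>map_graph f ` \<A>. X \<inter> verts A \<noteq> {})"
    then obtain X
      where X0: "X \<subseteq> verts (map_graph f F)" "card X \<le> l k c" "\<forall>A\<in>map_graph f ` \<A>. X \<inter> verts A \<noteq> {}"
      by blast
    have X: "X \<subseteq> f ` verts F" "card X \<le> l k c" "\<And>A. A \<in> \<A> \<Longrightarrow> X \<inter> f ` verts A \<noteq> {}"
      using X0 by simp_all
    have "finite X" using X(1) \<open>finite (verts F)\<close> finite_subset by blast
    then have c1: "card (g ` X) \<le> l k c" by (rule order_trans[OF card_image_le X(2)])
    have c2: "g ` X \<subseteq> verts F" using X(1) gf by auto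
    have c3: "g ` X \<inter> verts A \<noteq> {}" if AA: "A \<in> \<A>" for A
    proof -
      obtain x where "x \<in> verts A" "f x \<in> X" using X(3)[OF AA] by auto
      then show ?thesis using gf AF(1)[OF AA] by force
    qed
    show ?thesis
      by (rule disjI2, rule exI[of _ "g ` X"]) (intro conjI ballI c1 c2 c3)
  qed
qed

section \<open>A spanning forest\<close>

lemma card_components_le:
  assumes S: "simple_graph A" and R: "finite R"
    and reach: "\<And>y. y \<in> verts A \<Longrightarrow> \<exists>r\<in>R. \<exists>n. near A n y r"
  shows "card (components A) \<le> card R"
proof -
  have "components A \<subseteq> (\<lambda>x. {y. \<exists>n. near A n x y}) ` R"
  proof
    fix K assume "K \<in> components A"
    then obtain x where x: "x \<in> verts A" "K = {y. \<exists>n. near A n x y}" unfolding components_eq[OF S]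
      by blast
    obtain r n where r: "r \<in> R" "near A n x r" using reach[OF x(1)] by blast
    have "K = {y. \<exists>n. near A n r y}"
      unfolding x(2)
    proof (intro Collect_cong iffI)
      fix y assume "\<exists>m. near A m x y"
      then obtain m where "near A m x y" by blast
      from near_trans[OF near_sym[OF r(2)] this] show "\<exists>m. near A m r y" by blast
    next
      fix y assume "\<exists>m. near A m r y"
      then obtain m where "near A m r y" by blast
      from near_trans[OF r(2) this] show "\<exists>m. near A m x y" by blast
    qed
    then show "K \<in> (\<lambda>x. {y. \<exists>n. near A n x y}) ` R" using r(1) by blast
  qed
  then have "card (components A) \<le> card ((\<lambda>x. {y. \<exists>n. near A n x y}) ` R)" using R
    by (intro card_mono) auto
  also have "\<dots> \<le> card R" by (rule card_image_le[OF R])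
  finally show ?thesis .
qed

text \<open>
A set \<open>X\<close> that comes close to all bad edges. In the neighbourhood of vertices far from \<open>X\<close>,
the levels up to \<open>5 d\<close> are cycles with trees attached.
\<close>

locale hit_system = cycle_system +
  fixes X :: "'a set"
  assumes cov: "adj G u v \<Longrightarrow> level u \<le> 5 * d \<Longrightarrow> level v \<le> 5 * d \<Longrightarrow> \<not> good u v \<Longrightarrow>
      \<exists>c\<in>X. \<exists>a\<in>{u, v}. near G (13 * d) c a"
    and hdX: "p \<in> \<P> \<Longrightarrow> hd p \<in> X"
begin

definition far :: "nat \<Rightarrow> 'a \<Rightarrow> bool" where
  "far n v \<longleftrightarrow> (\<forall>c\<in>X. \<not> near G n c v)"

lemma far_near: "far (m + n) v \<Longrightarrow> near G n w v \<Longrightarrow> far m w"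
  unfolding far_def using near_trans by metis

lemma far_near': "far (m + n) v \<Longrightarrow> near G n v w \<Longrightarrow> far m w"
  using far_near near_sym by metis

lemma far_mono: "far n v \<Longrightarrow> m \<le> n \<Longrightarrow> far m v"
  unfolding far_def using near_mono by metis

lemma far_good:
  assumes "adj G u v" "level u \<le> 5 * d" "level v \<le> 5 * d" "far (13 * d) u" "far (13 * d) v"
  shows "good u v"
  using cov[OF assms(1-3)] assms(4,5) unfolding far_def by blast

lemma not_closing:
  assumes "p \<in> \<P>" "far 0 u" "far 0 v" shows "{u, v} \<noteq> {last p, hd p}"
proof
  assume "{u, v} = {last p, hd p}"
  then have "hd p = u \<or> hd p = v" by (auto simp: doubleton_eq_iff)
  then show False using hdX[OF assms(1)] assms(2,3) unfolding far_def by auto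
qed

definition low_edges :: "'a set set" where
  "low_edges = {{v, parent v} | v. parent v \<noteq> v} \<union> (\<Union>p\<in>\<P>. edges (cyc_graph p) - {{last p, hd p}})"

text \<open>
Order the vertices on \<open>C\<close> by their position along their cycles, and put the others above them,
ordered by level. Then a vertex has at most one neighbour that is not higher than itself: its parent,
or its predecessor on the cycle, as the closing edge is missing. The highest vertex of a cycle
would have two.
\<close>

lemma low_edges_acyclic:
  assumes cq: "cyc H q" and low: "edges (cyc_graph q) \<subseteq> low_edges"
  shows False
proof -
  have cc: "cyc (cyc_graph q) q" by (rule cyc_cyc_graph[OF cq])
  have qne: "q \<noteq> []" by (rule cyc_nonempty[OF cq])
  have sg: "simple_graph (cyc_graph p)" if "p \<in> \<P>" for p by (rule simple_cyc_graph[OF cycP[OF that]])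
  have lowD: "(a = parent v \<and> parent v \<noteq> v) \<or> (v = parent a \<and> parent a \<noteq> a) \<or> (\<exists>p\<in>\<P>. {v, a} \<in> edges (cyc_graph p) - {{last p, hd p}})"
    if "{v, a} \<in> low_edges" for v a
    using that unfolding low_edges_def by (auto simp: doubleton_eq_iff)
  have nbrs: "\<exists>a\<in>set q. \<exists>b\<in>set q. a \<noteq> b \<and> {v, a} \<in> low_edges \<and> {v, b} \<in> low_edges" if v: "v \<in> set q"
    for v
  proof -
    obtain a b where "a \<in> set q" "b \<in> set q" "a \<noteq> b" "adj (cyc_graph q) v a" "adj (cyc_graph q) v b"
      using cyc_two_nbrs[OF cc v] by blast
    then show ?thesis using low by blast
  qed
  have sub: "z \<in> C" if "p \<in> \<P>" "e \<in> edges (cyc_graph p)" "z \<in> e" for p e z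
    using edge_in_verts(1)[OF sg[OF that(1)] that(2)] that unfolding C_def by auto
  \<comment> \<open>Off \<open>C\<close>, only the edge to the parent remains at a vertex of \<open>q\<close> of highest level.\<close>
  have qC: "v \<in> C" if "v \<in> set q" for v
  proof -
    have "\<exists>v. v \<in> set q \<and> (\<forall>u. u \<in> set q \<longrightarrow> level u \<le> level v)"
      by (rule ex_has_greatest_nat[where b = "Suc (5 * d + 1)" and k = "hd q"])
         (use qne level_max in \<open>auto simp: less_Suc_eq_le\<close>)
    then obtain m where m: "m \<in> set q" "\<And>u. u \<in> set q \<Longrightarrow> level u \<le> level m" by blast
    have "level m = 0"
    proof (rule ccontr)
      assume m0: "level m \<noteq> 0"
      obtain a b where ab: "a \<in> set q" "b \<in> set q" "a \<noteq> b" "{m, a} \<in> low_edges" "{m, b} \<in> low_edges"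
        using nbrs[OF m(1)] by blast
      have "x = parent m" if "x \<in> set q" "{m, x} \<in> low_edges" for x
        using lowD[OF that(2)]
      proof (elim disjE)
        assume h: "m = parent x \<and> parent x \<noteq> x"
        then have "1 \<le> level x" "level x \<le> 5 * d" using parent_cases[of x] by auto
        then have "Suc (level m) = level x" using parent_step(2)[of x] h by simp
        then show ?thesis using m(2)[OF that(1)] by simp
      next
        assume "\<exists>p\<in>\<P>. {m, x} \<in> edges (cyc_graph p) - {{last p, hd p}}"
        then have "m \<in> C" using sub by blast
        then show ?thesis using m0 level_0[of m] by simp
      qed auto
      then show False using ab by metis
    qed
    then show ?thesis using m(2)[OF that] level_0[of v] by simp
  qed
  define idx where "idx v = (SOME i. \<exists>p\<in>\<P>. i < length p \<and> p ! i = v)" for v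
  have idx: "idx v = i" if p: "p \<in> \<P>" and i: "i < length p" "p ! i = v" for p i v
  proof -
    have "\<exists>i. \<exists>p\<in>\<P>. i < length p \<and> p ! i = v" using p i by blast
    then have "\<exists>p'\<in>\<P>. idx v < length p' \<and> p' ! (idx v) = v" unfolding idx_def by (rule someI_ex)
    then obtain p' where p': "p' \<in> \<P>" "idx v < length p'" "p' ! (idx v) = v" by blast
    have "p' = p" using uniqp[OF p'(1) p, of v] p'(2,3) i by (metis nth_mem)
    moreover have "distinct p" using cycP[OF p] by (simp add: cyc_def)
    ultimately show ?thesis using p'(2,3) i nth_eq_iff_index_eq[of p "idx v" i] by metis
  qed
  obtain M where M: "M \<in> set q" "\<And>u. u \<in> set q \<Longrightarrow> idx u \<le> idx M"
  proof -
    have "\<exists>v. v \<in> set q \<and> (\<forall>u. u \<in> set q \<longrightarrow> idx u \<le> idx v)"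
      by (rule ex_has_greatest_nat[where b = "Suc (Max (idx ` set q))" and k = "hd q"])
         (use qne in \<open>auto simp: less_Suc_eq_le\<close>)
    then show thesis using that by blast
  qed
  obtain a b where ab: "a \<in> set q" "b \<in> set q" "a \<noteq> b" "{M, a} \<in> low_edges" "{M, b} \<in> low_edges"
    using nbrs[OF M(1)] by blast
  have lower: "\<exists>p\<in>\<P>. \<exists>j. Suc j < length p \<and> M = p ! Suc j \<and> x = p ! j"
    if x: "x \<in> set q" "{M, x} \<in> low_edges" for x
    using lowD[OF x(2)]
  proof (elim disjE)
    assume "x = parent M \<and> parent M \<noteq> M"
    then show ?thesis using parent_C[of M] qC[OF M(1)] level_0[of M] by simp
  next
    assume "M = parent x \<and> parent x \<noteq> x"
    then show ?thesis using parent_C[of x] qC[OF x(1)] level_0[of x] by simp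
  next
    assume "\<exists>p\<in>\<P>. {M, x} \<in> edges (cyc_graph p) - {{last p, hd p}}"
    then obtain p where p: "p \<in> \<P>" "{M, x} \<in> edges (cyc_graph p)" "{M, x} \<noteq> {last p, hd p}" by blast
    then obtain j where j: "Suc j < length p" "{M, x} = {p ! j, p ! Suc j}"
      unfolding cyc_graph_edges[OF cyc_nonempty[OF cycP[OF p(1)]]] by blast
    then consider "M = p ! j" "x = p ! Suc j" | "M = p ! Suc j" "x = p ! j"
      by (auto simp: doubleton_eq_iff)
    then show ?thesis
    proof cases
      case 1
      then have "idx M = j" "idx x = Suc j" using idx[OF p(1)] j(1) by simp_all
      then show ?thesis using M(2)[OF x(1)] by simp
    next
      case 2
      then show ?thesis using p(1) j(1) by blast
    qed
  qed
  obtain p j where p: "p \<in> \<P>" "Suc j < length p" "M = p ! Suc j" "a = p ! j" using lower[OF ab(1,4)]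
    by blast
  obtain p' j' where p': "p' \<in> \<P>" "Suc j' < length p'" "M = p' ! Suc j'" "b = p' ! j'"
    using lower[OF ab(2,5)] by blast
  have "p = p'" using uniqp[OF p(1) p'(1), of M] p(2,3) p'(2,3) by (metis nth_mem)
  moreover have "Suc j = Suc j'" using idx[OF p(1,2)] idx[OF p'(1,2)] p(3) p'(3) by metis
  ultimately show False using p(4) p'(4) ab(3) by simp
qed

text \<open>
Closing edges are left out to turn the chosen cycles into paths; their ends are hit by \<open>X\<close>, so
nothing is lost near ears.
\<close>

definition F :: "'a graph" where
  "F = \<lparr>verts = verts G,
        edges = {e \<in> edges G. \<forall>v\<in>e. 4 * d < level v} \<union> {{v, parent v} | v. 1 \<le> level v \<and> level v \<le> 4 * d}
          \<union> (\<Union>p\<in>\<P>. edges (cyc_graph p) - {{last p, hd p}})\<rparr>"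

lemma F_verts [simp]: "verts F = verts G" by (simp add: F_def)

lemma F_edges: "edges F \<subseteq> edges G"
proof -
  have "{v, parent v} \<in> edges G" if "1 \<le> level v" "level v \<le> 4 * d" for v
    using parent_step(1)[of v] that by simp
  moreover have "edges (cyc_graph p) \<subseteq> edges G" if "p \<in> \<P>" for p using cycP[OF that]
    by (simp add: cyc_iff_edges)
  ultimately show ?thesis unfolding F_def by auto
qed

lemma simple_F: "simple_graph F"
  unfolding simple_graph_def
proof (intro conjI ballI)
  show "finite (verts F)" using S by (simp add: simple_graph_def)
  fix e assume "e \<in> edges F"
  then have "e \<in> edges G" using F_edges by blast
  then show "e \<subseteq> verts F" "card e = 2" using S by (simp_all add: simple_graph_def)
qed

lemma F_side: assumes "adj F u v" shows "4 * d < level u \<longleftrightarrow> 4 * d < level v"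
proof -
  consider "4 * d < level u \<and> 4 * d < level v" | z
    where "{u, v} = {z, parent z}" "1 \<le> level z" "level z \<le> 4 * d"
    | p where "p \<in> \<P>" "{u, v} \<in> edges (cyc_graph p)"
    using assms unfolding F_def by auto
  then show ?thesis
  proof cases
    case 2
    then have "Suc (level (parent z)) = level z" using parent_step(2)[of z] by simp
    then have "level u \<le> 4 * d" "level v \<le> 4 * d" using 2 by (auto simp: doubleton_eq_iff)
    then show ?thesis by simp
  next
    case 3
    then have "u \<in> C" "v \<in> C" using edge_in_verts(1)[OF simple_cyc_graph[OF cycP[OF 3(1)]] 3(2)]
      unfolding C_def by auto
    then show ?thesis using level_0[of u] level_0[of v] by simp
  qed auto
qed

lemma F_side_near: "near F n u v \<Longrightarrow> 4 * d < level u \<longleftrightarrow> 4 * d < level v"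
proof (induction n arbitrary: v)
  case (Suc n)
  then show ?case using F_side by (metis near.simps(2))
qed simp

lemma F_low: assumes "adj F u v" "\<not> 4 * d < level u" shows "{u, v} \<in> low_edges"
proof -
  have "parent z \<noteq> z" if "1 \<le> level z" "level z \<le> 4 * d" for z
  proof
    assume "parent z = z"
    then show False using parent_step(2)[of z] that by simp
  qed
  then show ?thesis using assms unfolding F_def low_edges_def by auto
qed

text \<open>
No edge of \<open>F\<close> crosses from the levels up to \<open>4 d\<close> to those above. A cycle in the upper part
would avoid the \<open>4 d\<close>-neighbourhood of \<open>C\<close>, which no cycle of \<open>G\<close> does; the lower part consists of
low edges.
\<close>

lemma forest_F: "forest F"
  unfolding forest_iff[OF simple_F]
proof (intro allI notI)
  fix q assume q: "cyc F q"
  have qne: "q \<noteq> []" by (rule cyc_nonempty[OF q])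
  have side: "4 * d < level z \<longleftrightarrow> 4 * d < level (hd q)" if zq: "z \<in> set q" for z
  proof -
    obtain i where i: "i < length q" "q ! i = z" using zq by (auto simp: in_set_conv_nth)
    have "near F (i - 0) (q ! 0) (q ! i)" by (rule walk_nth_near) (use q i in \<open>auto simp: cyc_def\<close>)
    then show ?thesis using F_side_near[of i "q ! 0" z] i qne by (simp add: hd_conv_nth)
  qed
  show False
  proof (cases "4 * d < level (hd q)")
    case True
    have "cyc G q" by (rule cyc_subset[OF q F_edges])
    from hits[OF this] obtain z where z: "z \<in> set q" "z \<in> nbhd G C (4 * d)" unfolding C_def by blast
    then have "level z \<le> 4 * d" using level_le[of "4 * d" z] by simp
    then show False using side[OF z(1)] True by simp
  next
    case False
    have "edges (cyc_graph q) \<subseteq> low_edges"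
    proof
      fix e assume e: "e \<in> edges (cyc_graph q)"
      then obtain u v where uv: "e = {u, v}" using simple_cyc_graph[OF q]
        by (auto simp: simple_graph_def card_2_iff)
      have "e \<subseteq> set q" using edge_in_verts(1)[OF simple_cyc_graph[OF q] e] by simp
      then have "u \<in> set q" using uv by auto
      then have "\<not> 4 * d < level u" using side False by blast
      moreover have "adj F u v" using e uv q by (auto simp: cyc_iff_edges)
      ultimately show "e \<in> low_edges" using F_low uv by blast
    qed
    from low_edges_acyclic[OF q this] show False .
  qed
qed

lemma near_cyc_graph_F:
  assumes "p \<in> \<P>" shows "near (cyc_graph p) n a b \<Longrightarrow> far n a \<Longrightarrow> near F n a b"
proof (induction n arbitrary: b)
  case (Suc n)
  have fn: "far n a" by (rule far_mono[OF Suc.prems(2)]) simp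
  show ?case
  proof (cases "near (cyc_graph p) n a b")
    case True
    then show ?thesis using Suc.IH[OF True fn] by simp
  next
    case False
    then obtain z where z: "near (cyc_graph p) n a z" "adj (cyc_graph p) z b" using Suc.prems(1) by auto
    have sub: "edges (cyc_graph p) \<subseteq> edges G" using cycP[OF assms] by (simp add: cyc_iff_edges)
    have "near G (Suc n) a b" by (rule near_subgraph[OF Suc.prems(1) sub])
    then have "far 0 b" using far_near'[of 0 "Suc n" a b] Suc.prems(2) by simp
    moreover have "near G n a z" by (rule near_subgraph[OF z(1) sub])
    then have "far 0 z" using far_near'[of 0 n a z] fn by simp
    ultimately have "{z, b} \<noteq> {last p, hd p}" using not_closing[OF assms] by blast
    then have "adj F z b" using z(2) assms unfolding F_def by auto
    then show ?thesis using Suc.IH[OF z(1) fn] by auto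
  qed
qed simp

text \<open>
Away from \<open>X\<close>, short distances between vertices of \<open>C\<close> are realised on the chosen cycles, and
the closing edges are not involved.
\<close>

lemma C_near_F:
  assumes "a \<in> C" "b \<in> C" "near G n a b" "n \<le> 2 * d" "far n a"
  shows "near F n a b"
proof -
  obtain p where p: "p \<in> \<P>" "a \<in> set p" using assms(1) C_cases by metis
  obtain q where q: "q \<in> \<P>" "b \<in> set q" using assms(2) C_cases by metis
  have "near G (2 * d) a b" by (rule near_mono[OF assms(3,4)])
  then have "p = q" using sep[OF p(1) q(1) _ p(2) q(2)] by blast
  then have "near (cyc_graph p) n a b" using iso[OF p(1,2) _ assms(3,4)] q(2) by simp
  then show ?thesis by (rule near_cyc_graph_F[OF p(1) _ assms(5)])
qed

section \<open>Excursions above the search\<close>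

text \<open>
The model is a maximal segment \<open>pl\<close> above level \<open>5 d\<close> of a cycle far from \<open>X\<close>, with its neighbours
\<open>v\<close> and \<open>w\<close> on that cycle. The stems of \<open>v\<close> and \<open>w\<close> complete it to an ear on \<open>C\<close>. The distance \<open>19 d\<close> leaves \<open>5 d\<close>
for the stems and \<open>d\<close> for short connections between ears before the range \<open>13 d\<close> of the bad edges
is reached.
\<close>

fun ear :: "'a \<times> 'a list \<times> 'a \<Rightarrow> bool" where
  "ear (v, pl, w) \<longleftrightarrow> level v = 5 * d \<and> level w = 5 * d \<and> v \<noteq> w \<and> pl \<noteq> [] \<and> distinct pl \<and> walk G (v # pl @ [w])
     \<and> (\<forall>z\<in>set pl. 5 * d < level z) \<and> (\<forall>z\<in>insert v (insert w (set pl)). far (19 * d) z)"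

declare ear.simps [simp del] ear_verts.simps [simp del]

lemma earD:
  assumes "ear (v, pl, w)"
  shows "level v = 5 * d" "level w = 5 * d" "v \<noteq> w" "pl \<noteq> []" "distinct pl" "walk G (v # pl @ [w])"
    "z \<in> set pl \<Longrightarrow> 5 * d < level z" "z \<in> insert v (insert w (set pl)) \<Longrightarrow> far (19 * d) z"
    "level v \<le> 5 * d" "level w \<le> 5 * d"
  using assms unfolding ear.simps by auto

lemma ear_disj:
  assumes "ear (v, pl, w)"
  shows "set pl \<inter> (set (stem v) \<union> set (stem w)) = {}" "set pl \<inter> C = {}"
proof -
  note e = earD[OF assms]
  show "set pl \<inter> (set (stem v) \<union> set (stem w)) = {}"
    using e(7) stem_elem(2)[OF e(9)] stem_elem(2)[OF e(10)] e(1,2) by force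
  show "set pl \<inter> C = {}" using e(7) level_0 by force
qed

lemma ear_verts_near:
  assumes "ear (v, pl, w)" "z \<in> ear_verts (v, pl, w)"
  obtains o' where "o' \<in> insert v (insert w (set pl))" "near G (5 * d) o' z"
proof -
  note e = earD[OF assms(1)]
  consider "z \<in> set (stem v)" | "z \<in> set (stem w)" | "z \<in> set pl" using assms(2)
    unfolding ear_verts.simps by blast
  then show thesis
  proof cases
    case 1
    have "near G (5 * d) v z" by (rule near_mono[OF stem_near_top[OF e(9) 1]]) (use e(1) in simp)
    then show thesis using that by blast
  next
    case 2
    have "near G (5 * d) w z" by (rule near_mono[OF stem_near_top[OF e(10) 2]]) (use e(2) in simp)
    then show thesis using that by blast
  next
    case 3
    then show thesis using that[of z] by simp
  qed
qed

lemma ear_verts_far: assumes "ear t" "z \<in> ear_verts t" shows "far (14 * d) z"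
proof -
  obtain v pl w where t: "t = (v, pl, w)" by (cases t)
  note assms = assms[unfolded t]
  obtain o' where o': "o' \<in> insert v (insert w (set pl))" "near G (5 * d) o' z"
    by (rule ear_verts_near[OF assms])
  have "far (14 * d + 5 * d) o'" using earD(8)[OF assms(1) o'(1)] by simp
  then show ?thesis by (rule far_near'[OF _ o'(2)])
qed

lemma ear_verts_verts: assumes "ear (v, pl, w)" shows "ear_verts (v, pl, w) \<subseteq> verts G"
proof -
  note e = earD[OF assms]
  have "set (v # pl @ [w]) \<subseteq> verts G"
    by (rule walk_verts[OF e(6) S]) (use stem_verts[OF e(9)] in auto)
  then show ?thesis using stem_verts[OF e(9)] stem_verts[OF e(10)] unfolding ear_verts.simps by auto
qed

lemma ear_stem_ear:
  assumes "ear t" shows "stem_ear t"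
proof -
  obtain v pl w where t: "t = (v, pl, w)" by (cases t)
  note e = earD[OF assms[unfolded t]]
  have "\<forall>z\<in>set pl. d < level z" using e(7) by fastforce
  then show ?thesis using e ear_disj(1)[OF assms[unfolded t]] unfolding t by simp
qed

text \<open>
Every cycle comes down to level \<open>4 d\<close>. If it never rises above level \<open>5 d\<close>, all its edges are good,
being far from \<open>X\<close>, and none is a closing edge, contradicting \<open>low_edges_acyclic\<close>. So it
crosses level \<open>5 d\<close> in both directions.
\<close>

lemma cycle_has_ear:
  assumes q: "cyc G q" and fq: "\<And>z. z \<in> set q \<Longrightarrow> far (19 * d) z"
  shows "\<exists>v pl w. ear (v, pl, w) \<and> insert v (insert w (set pl)) \<subseteq> set q"
proof -
  have qV: "set q \<subseteq> verts G" by (rule cyc_verts[OF S q])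
  have "\<exists>z0\<in>set q. 5 * d < level z0"
  proof (rule ccontr)
    assume no: "\<not> ?thesis"
    have "edges (cyc_graph q) \<subseteq> low_edges"
    proof
      fix e assume e: "e \<in> edges (cyc_graph q)"
      then obtain u v where uv: "e = {u, v}" using simple_cyc_graph[OF q]
        by (auto simp: simple_graph_def card_2_iff)
      have "e \<subseteq> set q" using edge_in_verts(1)[OF simple_cyc_graph[OF q] e] by simp
      then have m: "u \<in> set q" "v \<in> set q" using uv by auto
      have d5: "level u \<le> 5 * d" "level v \<le> 5 * d" using no m by (auto simp: not_less)
      have a: "adj G u v" using e uv q by (auto simp: cyc_iff_edges)
      have "good u v" by (rule far_good[OF a d5]) (use fq m far_mono[of "19 * d"] in auto)
      moreover have f0: "far 0 u" "far 0 v" using fq m far_mono[of "19 * d"] by auto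
      moreover have "u \<noteq> v" using simple_adjD[OF S a] by blast
      ultimately show "e \<in> low_edges"
        using not_closing[OF _ f0] unfolding good_def low_edges_def uv by (auto simp: insert_commute)
    qed
    from low_edges_acyclic[OF q this] show False .
  qed
  then obtain z0 where z0: "z0 \<in> set q" "5 * d < level z0" by blast
  obtain z1 where z1: "z1 \<in> set q" "z1 \<in> nbhd G C (4 * d)" using hits[OF q] unfolding C_def by blast
  have dz1: "level z1 \<le> 4 * d" using z1(2) level_le[of "4 * d" z1] by simp
  obtain a b where ab: "q = a @ z1 # b" using split_list[OF z1(1)] by blast
  define r where "r = z1 # b @ a"
  have cr: "cyc G r" using cyc_rotate[of G a "z1 # b"] q ab unfolding r_def by simp
  have sr: "set r = set q" unfolding r_def ab by auto
  define A where "A = takeWhile (\<lambda>z. level z \<le> 5 * d) r"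
  define B0 where "B0 = dropWhile (\<lambda>z. level z \<le> 5 * d) r"
  define B where "B = takeWhile (\<lambda>z. 5 * d < level z) B0"
  define R where "R = dropWhile (\<lambda>z. 5 * d < level z) B0"
  have r3: "r = A @ B @ R" unfolding A_def B_def R_def B0_def by simp
  have Ane: "A \<noteq> []" unfolding A_def r_def using dz1 by simp
  have B0ne: "B0 \<noteq> []" unfolding B0_def dropWhile_eq_Nil_conv using z0 sr by (metis not_le)
  have hB0: "5 * d < level (hd B0)" using hd_dropWhile[of "\<lambda>z. level z \<le> 5 * d" r] B0ne unfolding B0_def
    by simp
  have Bne: "B \<noteq> []" unfolding B_def using B0ne hB0 by (cases B0) auto
  have Bhi: "5 * d < level z" if "z \<in> set B" for z using that unfolding B_def by (meson set_takeWhileD)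
  have Alo: "level z \<le> 5 * d" if "z \<in> set A" for z using that unfolding A_def by (meson set_takeWhileD)
  have wr: "walk G r" "distinct r" "adj G (last r) (hd r)" using cr by (auto simp: cyc_def)
  have Rne: "R \<noteq> []"
  proof
    assume "R = []"
    then have "last r \<in> set B" using r3 Bne by simp
    then have "5 * d < level (last r)" by (rule Bhi)
    moreover have "level (last r) \<le> Suc (level (hd r))" using level_adj wr(3)
      by (simp add: insert_commute)
    moreover have "hd r = z1" unfolding r_def by simp
    ultimately show False using dz1 d1 by simp
  qed
  define v where "v = last A"
  define w where "w = hd R"
  have vA: "v \<in> set A" unfolding v_def using Ane by simp
  have wR: "w \<in> set R" unfolding w_def using Rne by simp
  have dw: "level w \<le> 5 * d" using hd_dropWhile[of "\<lambda>z. 5 * d < level z" B0] Rne unfolding R_def w_def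
    by simp
  have AB: "walk G A" "walk G B" "walk G R" "adj G v (hd B)" "adj G (last B) w"
    using wr(1) Ane Bne Rne unfolding r3 v_def w_def by (auto simp: successively_append_iff hd_append)
  have "level (hd B) \<le> Suc (level v)" by (rule level_adj[OF AB(4)])
  then have dv: "level v = 5 * d" using Alo[OF vA] Bhi[of "hd B"] Bne by simp
  have "level (last B) \<le> Suc (level w)" using level_adj AB(5) by (simp add: insert_commute)
  then have dw': "level w = 5 * d" using dw Bhi[of "last B"] Bne by simp
  have vw: "v \<noteq> w" using wr(2) vA wR unfolding r3 by auto
  have wk: "walk G (v # B @ [w])"
    using AB(2,4,5) Bne by (auto simp: successively_append_iff successively_Cons hd_append)
  have sub: "insert v (insert w (set B)) \<subseteq> set q" using vA wR sr unfolding r3 by auto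
  have "ear (v, B, w)"
    unfolding ear.simps using dv dw' vw Bne wk Bhi wr(2) fq sub unfolding r3 by auto
  then show ?thesis using sub by blast
qed

text \<open>
A path of length at most \<open>d\<close> between two ears either stays above level \<open>4 d\<close>, where \<open>F\<close> contains
all edges of \<open>G\<close>, or stays within level \<open>5 d\<close>. In the second case all its edges are good, and
taking feet turns it into a walk along \<open>C\<close> between feet of the two ears: a tree edge is contracted,
an edge of a chosen cycle is kept, and it is not a closing edge because it is far from \<open>X\<close>.
\<close>

lemma ears_near_F:
  assumes e: "ear t" and e': "ear t'" and x: "x \<in> ear_verts t" and y: "y \<in> ear_verts t'" and xy: "near G d x y"
  shows "\<exists>x'\<in>ear_verts t. \<exists>y'\<in>ear_verts t'. near F d x' y'"
proof -
  obtain q where q: "q \<noteq> []" "hd q = x" "last q = y" "length q \<le> Suc d" "walk G q"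
    using near_walk[OF xy] by blast
  have xi: "q ! 0 = x" "q ! (length q - 1) = y" using q by (auto simp: hd_conv_nth last_conv_nth)
  have adjq: "adj G (q ! i) (q ! Suc i)" if "Suc i < length q" for i
    using q(5) that by (auto simp: successively_conv_nth)
  show ?thesis
  proof (cases "\<forall>z\<in>set q. 4 * d < level z")
    case True
    have "adj F (q ! i) (q ! Suc i)" if "Suc i < length q" for i
      using adjq[OF that] True that unfolding F_def by auto
    then have "walk F q" by (simp add: successively_conv_nth)
    then have "near F (length q - 1 - 0) (q ! 0) (q ! (length q - 1))"
      by (rule walk_nth_near) (use q(1) in auto)
    then have "near F d x y" using near_mono[of F "length q - 1" x y d] xi q(4) by auto
    then show ?thesis using x y by blast
  next
    case False
    then obtain z where z: "z \<in> set q" "level z \<le> 4 * d" by auto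
    then obtain i where i: "i < length q" "q ! i = z" by (auto simp: in_set_conv_nth)
    have dq: "level (q ! j) \<le> 5 * d" if "j < length q" for j
    proof -
      have "near G (if i \<le> j then j - i else i - j) (q ! i) (q ! j)"
        using walk_nth_near[OF q(5), of i j] near_sym[OF walk_nth_near[OF q(5), of j i]] that i by auto
      then have "near G d (q ! i) (q ! j)" by (rule near_mono) (use that i q(4) in auto)
      then show ?thesis using level_near z(2) i(2) by fastforce
    qed
    have farq: "far (13 * d) (q ! j)" if "j < length q" for j
    proof -
      have "near G (j - 0) (q ! 0) (q ! j)" by (rule walk_nth_near[OF q(5)]) (use that in auto)
      then have "near G d x (q ! j)" using near_mono[of G j x "q ! j" d] xi that q(4) by auto
      moreover have "far (13 * d + d) x" using ear_verts_far[OF e x] by simp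
      ultimately show ?thesis using far_near' by blast
    qed
    have step: "near F 1 (foot (q ! j)) (foot (q ! Suc j))" if j: "Suc j < length q" for j
    proof -
      have g: "good (q ! j) (q ! Suc j)"
        by (rule far_good[OF adjq[OF j]]) (use dq farq j in auto)
      consider "parent (q ! Suc j) = q ! j" | "parent (q ! j) = q ! Suc j" | p
        where "p \<in> \<P>" "adj (cyc_graph p) (q ! j) (q ! Suc j)"
        using g unfolding good_def by blast
      then show ?thesis
      proof cases
        case 1
        then have "foot (q ! j) = foot (q ! Suc j)" using foot_parent[OF dq[OF j]] by simp
        then show ?thesis by (metis near_refl)
      next
        case 2
        then have "foot (q ! Suc j) = foot (q ! j)" using foot_parent[of "q ! j"] dq[of j] j by simp
        then show ?thesis by (metis near_refl)
      next
        case 3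
        then have C2: "q ! j \<in> C" "q ! Suc j \<in> C"
          using edge_in_verts(1)[OF simple_cyc_graph[OF cycP[OF 3(1)]] 3(2)] unfolding C_def by auto
        have "far 0 (q ! j)" "far 0 (q ! Suc j)"
          using farq[of j] farq[of "Suc j"] j far_mono[of "13 * d"] by auto
        then have "{q ! j, q ! Suc j} \<noteq> {last p, hd p}" by (rule not_closing[OF 3(1)])
        then have "adj F (q ! j) (q ! Suc j)" using 3 unfolding F_def by auto
        then show ?thesis unfolding foot_of_C[OF C2(1)] foot_of_C[OF C2(2)] by (rule near_adj)
      qed
    qed
    have chain: "j < length q \<Longrightarrow> near F j (foot x) (foot (q ! j))" for j
    proof (induction j)
      case (Suc j)
      then show ?case using near_trans[OF Suc.IH step[of j]] by simp
    qed (use xi in simp)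
    have "near F (length q - 1) (foot x) (foot y)" using chain[of "length q - 1"] xi q(1) by simp
    then have n: "near F d (foot x) (foot y)" by (rule near_mono) (use q(4) in simp)
    have root: "foot z \<in> ear_verts t" if t: "ear t" "z \<in> ear_verts t" "level z \<le> 5 * d" for t z
    proof -
      obtain a b c where abc: "t = (a, b, c)" by (cases t)
      note f = earD[OF t(1)[unfolded abc]]
      have "z \<notin> set b" using f(7)[of z] t(3) by auto
      then have "z \<in> set (stem a) \<or> z \<in> set (stem c)" using t(2) unfolding abc ear_verts.simps by blast
      then have "foot z = foot a \<or> foot z = foot c" using stem_elem(3)[OF f(9)] stem_elem(3)[OF f(10)]
        by blast
      then show ?thesis unfolding abc ear_verts.simps by auto
    qed
    have "level x \<le> 5 * d" "level y \<le> 5 * d" using dq[of 0] dq[of "length q - 1"] xi q(1) by auto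
    then show ?thesis using n root[OF e x] root[OF e' y] by blast
  qed
qed

section \<open>Balls around ears in the forest\<close>

definition ear_ball :: "'a set \<Rightarrow> 'a graph" where
  "ear_ball Z = \<lparr>verts = nbhd F Z (2 * d), edges = {e \<in> edges F. e \<subseteq> nbhd F Z (2 * d)}\<rparr>"

lemma ear_ball_verts [simp]: "verts (ear_ball Z) = nbhd F Z (2 * d)" by (simp add: ear_ball_def)

lemma ear_ball_subgraph:
  assumes "Z \<subseteq> verts G" shows "subgraph (ear_ball Z) F"
proof -
  have "nbhd F Z (2 * d) \<subseteq> verts G"
    unfolding nbhd_def using near_verts[OF _ simple_F] assms by auto
  then show ?thesis
    using simple_F finite_subset unfolding subgraph_def simple_graph_def ear_ball_def by auto
qed

lemma ear_ball_near:
  assumes "x \<in> Z" shows "near F n x y \<Longrightarrow> n \<le> 2 * d \<Longrightarrow> near (ear_ball Z) n x y"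
proof (induction n arbitrary: y)
  case (Suc n)
  show ?case
  proof (cases "near F n x y")
    case True
    then show ?thesis using Suc by simp
  next
    case False
    then obtain z where z: "near F n x z" "adj F z y" using Suc.prems by auto
    have "near F (2 * d) x z" by (rule near_mono[OF z(1)]) (use Suc.prems(2) in simp)
    moreover have "near F (2 * d) x y" by (rule near_mono[OF Suc.prems])
    ultimately have "adj (ear_ball Z) z y" using z(2) assms unfolding ear_ball_def nbhd_def by auto
    moreover have "near (ear_ball Z) n x z" using Suc.IH[OF z(1)] Suc.prems(2) by simp
    ultimately show ?thesis by auto
  qed
qed simp

lemma ear_ball_adj: "u \<in> Z \<Longrightarrow> v \<in> Z \<Longrightarrow> adj F u v \<Longrightarrow> adj (ear_ball Z) u v"
  using near_refl[of F "2 * d"] unfolding ear_ball_def nbhd_def by (auto simp del: near_refl)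

lemma stem_parent:
  assumes "level v \<le> 5 * d" "z \<in> set (stem v)" "1 \<le> level z" shows "parent z \<in> set (stem v)"
proof -
  have "z = up (level v - level z) v" "level z \<le> level v" using stem_elem[OF assms(1,2)] by auto
  then have "parent z = up (Suc (level v - level z)) v" by (simp add: up_Suc)
  moreover have "Suc (level v - level z) \<le> level v" using assms(3) \<open>level z \<le> level v\<close> by simp
  ultimately show ?thesis unfolding set_stem by auto
qed

lemma ear_ball_stem_low:
  assumes v: "level v \<le> 5 * d" and sub: "set (stem v) \<subseteq> Z"
  shows "z \<in> set (stem v) \<Longrightarrow> level z \<le> 4 * d \<Longrightarrow> \<exists>n. near (ear_ball Z) n z (foot v)"
proof (induction "level z" arbitrary: z)
  case 0
  then have "z = foot v" using stem_C[OF v] level_0[of z] by simp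
  then have "near (ear_ball Z) 0 z (foot v)" by simp
  then show ?case by (rule exI)
next
  case (Suc n)
  have p: "parent z \<in> set (stem v)" by (rule stem_parent[OF v Suc.prems(1)]) (use Suc.hyps(2) in simp)
  have dp: "Suc (level (parent z)) = level z" using parent_step(2)[of z] Suc.hyps(2) Suc.prems(2)
    by simp
  have "n = level (parent z)" "level (parent z) \<le> 4 * d" using dp Suc.hyps(2) Suc.prems(2) by auto
  from Suc.hyps(1)[OF this(1) p this(2)] obtain m where m: "near (ear_ball Z) m (parent z) (foot v)"
    by blast
  have "adj F z (parent z)" using Suc.hyps(2) Suc.prems(2) unfolding F_def by auto
  then have "adj (ear_ball Z) z (parent z)" using ear_ball_adj[of z Z "parent z"] Suc.prems(1) p sub
    by blast
  from near_trans[OF near_adj[OF this] m] show ?case by blast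
qed

lemma ear_ball_walk_high:
  assumes "walk G q" "\<And>z. z \<in> set q \<Longrightarrow> 4 * d < level z" "set q \<subseteq> Z"
  shows "walk (ear_ball Z) q"
proof -
  have "adj (ear_ball Z) (q ! i) (q ! Suc i)" if i: "Suc i < length q" for i
  proof (rule ear_ball_adj)
    show "q ! i \<in> Z" "q ! Suc i \<in> Z" using assms(3) i by auto
    have "adj G (q ! i) (q ! Suc i)" using assms(1) i by (auto simp: successively_conv_nth)
    then show "adj F (q ! i) (q ! Suc i)" using assms(2) i unfolding F_def by auto
  qed
  then show ?thesis by (simp add: successively_conv_nth)
qed

lemma walk_connects:
  assumes "walk H q" "a \<in> set q" "b \<in> set q" shows "\<exists>n. near H n a b"
proof -
  obtain i j where ij: "i < length q" "q ! i = a" "j < length q" "q ! j = b"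
    using assms(2,3) by (auto simp: in_set_conv_nth)
  show ?thesis
    using walk_nth_near[OF assms(1), of i j] near_sym[OF walk_nth_near[OF assms(1), of j i]] ij
    by (cases "i \<le> j") auto
qed

lemma ear_ball_stem_high:
  assumes v: "level v \<le> 5 * d" and sub: "set (stem v) \<subseteq> Z" and z: "z \<in> set (stem v)" "4 * d < level z"
  shows "\<exists>n. near (ear_ball Z) n v z"
proof -
  let ?q = "map (\<lambda>i. up i v) [0..<Suc (level v - level z)]"
  have dz: "z = up (level v - level z) v" "level z \<le> level v" using stem_elem[OF v z(1)] by auto
  have "walk G ?q" by (rule stem_up_walk(1)[OF v]) simp
  moreover have "4 * d < level y" if "y \<in> set ?q" for y
    using that level_up[OF v] z(2) dz(2) by auto
  moreover have "set ?q \<subseteq> Z" using sub unfolding set_stem by (auto simp del: upt_Suc)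
  ultimately have w: "walk (ear_ball Z) ?q" by (rule ear_ball_walk_high)
  have "v \<in> set ?q" by (auto simp del: upt_Suc intro!: image_eqI[of _ _ 0])
  moreover have "z \<in> set ?q" using dz(1)
    by (auto simp del: upt_Suc intro!: image_eqI[of _ _ "level v - level z"])
  ultimately show ?thesis using walk_connects[OF w] by blast
qed

text \<open>
The part of the ear above level \<open>4 d\<close> is a path of \<open>F\<close>, and so are the lower parts of its two
stems. Everything else in the ball is connected to one of these three inside the ball.
\<close>

lemma ear_ball_components:
  assumes "ear (v, pl, w)"
  shows "card (components (ear_ball (ear_verts (v, pl, w)))) \<le> 3"
proof -
  note e = earD[OF assms]
  let ?Z = "ear_verts (v, pl, w)"
  have SA: "simple_graph (ear_ball ?Z)" using ear_ball_subgraph[OF ear_verts_verts[OF assms]]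
    by (simp add: subgraph_def)
  have sub: "set (stem v) \<subseteq> ?Z" "set (stem w) \<subseteq> ?Z" "set pl \<subseteq> ?Z" unfolding ear_verts.simps by auto
  have hi: "4 * d < level z" if "z \<in> set (v # pl @ [w])" for z
  proof -
    have "5 * d \<le> level z" using that e(1,2) e(7)[of z] by auto
    then show ?thesis using d1 by simp
  qed
  have w: "walk (ear_ball ?Z) (v # pl @ [w])"
    by (rule ear_ball_walk_high[OF e(6) hi]) (use sub self_stem in auto)
  have reach: "\<exists>r\<in>{v, foot v, foot w}. \<exists>n. near (ear_ball ?Z) n z r" if z: "z \<in> ?Z" for z
  proof -
    consider "z \<in> set (stem v)" "level z \<le> 4 * d" | "z \<in> set (stem w)" "level z \<le> 4 * d"
      | "z \<in> set (stem v)" "4 * d < level z" | "z \<in> set (stem w)" "4 * d < level z" | "z \<in> set pl"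
      using z unfolding ear_verts.simps by fastforce
    then show ?thesis
    proof cases
      case 1
      then show ?thesis using ear_ball_stem_low[OF e(9) sub(1)] by blast
    next
      case 2
      then show ?thesis using ear_ball_stem_low[OF e(10) sub(2)] by blast
    next
      case 3
      then obtain n where "near (ear_ball ?Z) n v z" using ear_ball_stem_high[OF e(9) sub(1)] by blast
      from near_sym[OF this] show ?thesis by blast
    next
      case 4
      then obtain n where n: "near (ear_ball ?Z) n w z" using ear_ball_stem_high[OF e(10) sub(2)]
        by blast
      obtain m where "near (ear_ball ?Z) m w v" using walk_connects[OF w, of w v] by auto
      from near_trans[OF near_sym[OF n] this] show ?thesis by blast
    next
      case 5
      then obtain m where "near (ear_ball ?Z) m z v" using walk_connects[OF w, of z v] by auto
      then show ?thesis by blast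
    qed
  qed
  have "card (components (ear_ball ?Z)) \<le> card {v, foot v, foot w}"
  proof (rule card_components_le[OF SA])
    fix y assume "y \<in> verts (ear_ball ?Z)"
    then obtain z where z: "z \<in> ?Z" "near F (2 * d) z y" unfolding ear_ball_verts nbhd_def by blast
    have n: "near (ear_ball ?Z) (2 * d) z y" by (rule ear_ball_near[OF z]) simp
    obtain r m where r: "r \<in> {v, foot v, foot w}" "near (ear_ball ?Z) m z r" using reach[OF z(1)]
      by blast
    from near_trans[OF near_sym[OF n] r(2)] show "\<exists>r\<in>{v, foot v, foot w}. \<exists>n. near (ear_ball ?Z) n y r"
      using r(1) by blast
  qed simp
  also have "\<dots> \<le> 3" by (simp add: card_insert_if)
  finally show ?thesis .
qed

section \<open>Packing or hitting the ears\<close>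

text \<open>
If the stems meet, \<open>meet_cycle\<close> closes the ear. Otherwise its feet are different vertices of
one chosen cycle, and an arc of at most \<open>2 d\<close> edges between them closes it; the vertices of this arc
are within \<open>d\<close> of one of the feet.
\<close>

lemma ear_cycle:
  assumes e: "ear (v, pl, w)" and close: "near G (2 * d) (foot v) (foot w)"
  shows "\<exists>q. cyc G q \<and> (\<forall>z\<in>set q. z \<in> ear_verts (v, pl, w) \<or> (z \<in> C \<and> (\<exists>a\<in>{foot v, foot w}. near F d a z)))"
proof -
  note f = earD[OF e]
  show ?thesis
  proof (cases "set (stem v) \<inter> set (stem w) = {}")
    case False
    obtain \<alpha> c
      where ac: "cyc G (\<alpha> @ [c])" "c \<in> set (stem v)" "set \<alpha> \<subseteq> set (stem v) \<union> set (stem w) \<union> set pl"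
      by (rule meet_cycle[OF f(9,10,3,6,5) ear_disj(1)[OF e] _ False]) (use f(4) in auto)
    then show ?thesis by (intro exI[of _ "\<alpha> @ [c]"]) (auto simp: ear_verts.simps)
  next
    case True
    define L where "L = rev (stem v) @ pl @ stem w"
    note L = ear_list[OF f(9,10,6,5) ear_disj[OF e] True, folded L_def]
    have rC: "foot v \<in> C" "foot w \<in> C" using foot_C f by auto
    obtain p where p: "p \<in> \<P>" "foot v \<in> set p" using rC(1) C_cases by metis
    obtain q where q: "q \<in> \<P>" "foot w \<in> set q" using rC(2) C_cases by metis
    have "p = q" using sep[OF p(1) q(1) _ p(2) q(2)] close by blast
    then have n: "near (cyc_graph p) (2 * d) (foot v) (foot w)" using iso[OF p(1,2) _ close] q(2)
      by simp
    obtain arc where arc: "arc \<noteq> []" "hd arc = foot v" "last arc = foot w" "length arc \<le> Suc (2 * d)"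
      "walk (cyc_graph p) arc" "distinct arc" using near_path[OF n] by blast
    have ne: "foot v \<noteq> foot w" using True foot_stem[of v] foot_stem[of w] by (metis disjoint_iff)
    obtain I where I: "arc = foot v # I @ [foot w]" using list_ends[OF arc(6,1,2,3) ne] by blast
    have sg: "simple_graph (cyc_graph p)" by (rule simple_cyc_graph[OF cycP[OF p(1)]])
    have sub: "edges (cyc_graph p) \<subseteq> edges G" using cycP[OF p(1)] by (simp add: cyc_iff_edges)
    have arcp: "set arc \<subseteq> set p" using walk_verts[OF arc(5) sg arc(1)] arc(2) p(2) by simp
    have IC: "set I \<subseteq> C" using arcp p(1) unfolding I C_def by auto
    have djI: "set I \<inter> set L = {}"
      using IC L(6) arc(6) unfolding I by auto
    have wa: "walk G arc" using arc(5) sub by (auto elim: successively_mono)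
    have "walk G (rev arc)" using wa by (simp only: walk_rev)
    then have wI: "walk G (foot w # rev I @ [foot v])" unfolding I by simp
    have Lne: "L \<noteq> []" using L(3) by auto
    have "walk G (L @ rev I)"
      unfolding successively_append_iff[of _ L]
      using L(2,5) wI
      by (cases "I = []") (auto simp: successively_Cons successively_append_iff hd_append simp del: successively_rev)
    moreover have "adj G (last (L @ rev I)) (hd (L @ rev I))"
    proof (cases "I = []")
      case True
      then show ?thesis using wI L(4,5) Lne by (simp add: successively_Cons)
    next
      case False
      then show ?thesis using wI L(4) Lne
        by (auto simp: successively_Cons successively_append_iff hd_append simp del: successively_rev)
    qed
    moreover have "distinct (L @ rev I)" using L(1) arc(6) djI unfolding I by auto
    moreover have "3 \<le> length (L @ rev I)" unfolding L_def using f(1,2) d1 by simp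
    ultimately have c: "cyc G (L @ rev I)" by (simp add: cyc_def)
    have fr: "far (14 * d) (foot v)" "far (14 * d) (foot w)"
      by (rule ear_verts_far[OF e], simp add: ear_verts.simps)+
    have arcn: "\<exists>a\<in>{foot v, foot w}. near F d a z" if z: "z \<in> set I" for z
    proof -
      have "z \<in> set arc" using z unfolding I by simp
      then obtain i where i: "i < length arc" "arc ! i = z" by (auto simp: in_set_conv_nth)
      have e0: "arc ! 0 = foot v" "arc ! (length arc - 1) = foot w"
        using arc(1,2,3) by (auto simp: hd_conv_nth last_conv_nth)
      show ?thesis
      proof (cases "i \<le> d")
        case True
        have "near (cyc_graph p) (i - 0) (arc ! 0) (arc ! i)"
          by (rule walk_nth_near[OF arc(5)]) (use i in auto)
        then have "near (cyc_graph p) d (foot v) z" using near_mono[of "cyc_graph p" i _ z d] e0 i True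
          by simp
        then have "near F d (foot v) z"
          by (rule near_cyc_graph_F[OF p(1)]) (rule far_mono[OF fr(1)], simp)
        then show ?thesis by blast
      next
        case False
        have "near (cyc_graph p) (length arc - 1 - i) (arc ! i) (arc ! (length arc - 1))"
          by (rule walk_nth_near[OF arc(5)]) (use i in auto)
        then have "near (cyc_graph p) d z (foot w)"
          using near_mono[of "cyc_graph p" "length arc - 1 - i" z _ d] e0 i False arc(4) by simp
        then have "near (cyc_graph p) d (foot w) z" by (rule near_sym)
        then have "near F d (foot w) z"
          by (rule near_cyc_graph_F[OF p(1)]) (rule far_mono[OF fr(2)], simp)
        then show ?thesis by blast
      qed
    qed
    have "z \<in> ear_verts (v, pl, w) \<or> (z \<in> C \<and> (\<exists>a\<in>{foot v, foot w}. near F d a z))"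
      if "z \<in> set (L @ rev I)" for z
    proof -
      have "z \<in> set L \<or> z \<in> set I" using that by auto
      then show ?thesis using L(7) arcn IC unfolding ear_verts.simps by blast
    qed
    then show ?thesis using c by blast
  qed
qed

lemma ear_feet:
  assumes "ear t"
  shows "feet t \<subseteq> C" "\<And>a. a \<in> ear_verts t \<Longrightarrow> far (14 * d) a"
proof -
  obtain v pl w where t: "t = (v, pl, w)" by (cases t)
  show "feet t \<subseteq> C" using foot_C earD[OF assms[unfolded t]] unfolding t by auto
  show "\<And>a. a \<in> ear_verts t \<Longrightarrow> far (14 * d) a" by (rule ear_verts_far[OF assms])
qed

text \<open>
Ears with disjoint balls have distance more than \<open>4 d\<close> in \<open>F\<close>, and by \<open>ears_near_F\<close> distance
more than \<open>d\<close> in \<open>G\<close>. If at least \<open>k\<close> ears have close feet, \<open>ear_cycle\<close> turns them into cycles. These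
are distant as well: if two of them come within \<open>d\<close> of each other with at least one of the arcs
involved, then some feet of the two ears are within \<open>3 d\<close> in \<open>F\<close>. If fewer than \<open>k\<close> ears have
close feet, more than \<open>h\<close> have distant feet, and \<open>stem_ears_packing\<close> applies.
\<close>

lemma ears_packing:
  assumes ears: "\<And>t. t \<in> \<U> \<Longrightarrow> ear t"
    and disj: "\<And>t t'. t \<in> \<U> \<Longrightarrow> t' \<in> \<U> \<Longrightarrow> t \<noteq> t' \<Longrightarrow> nbhd F (ear_verts t) (2 * d) \<inter> nbhd F (ear_verts t') (2 * d) = {}"
    and fin: "finite \<U>" and card: "card \<U> = k + h" and h: "s_fun k \<le> 2 * h" and k1: "1 \<le> k"
  shows "\<exists>\<C>. d_packing d G \<C> \<and> card \<C> = k"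
proof -
  have F4: "\<not> near F n x y"
    if t: "t \<in> \<U>" "t' \<in> \<U>" "t \<noteq> t'" "x \<in> ear_verts t" "y \<in> ear_verts t'" and n: "n \<le> 4 * d"
      for t t' x y n
  proof
    assume "near F n x y"
    then have "near F (2 * d + 2 * d) x y" by (rule near_mono) (use n in simp)
    from near_split[OF this] obtain z where z: "near F (2 * d) x z" "near F (2 * d) z y" by blast
    then have "z \<in> nbhd F (ear_verts t) (2 * d)" "z \<in> nbhd F (ear_verts t') (2 * d)"
      using t(4,5) near_sym[OF z(2)] unfolding nbhd_def by blast+
    then show False using disj[OF t(1-3)] by blast
  qed
  have ear_verts_far_G: "\<not> near G d x y"
    if t: "t \<in> \<U>" "t' \<in> \<U>" "t \<noteq> t'" "x \<in> ear_verts t" "y \<in> ear_verts t'" for t t' x y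
  proof
    assume n: "near G d x y"
    obtain x' y' where xy: "x' \<in> ear_verts t" "y' \<in> ear_verts t'" "near F d x' y'"
      using ears_near_F[OF ears[OF t(1)] ears[OF t(2)] t(4,5) n] by blast
    have "d \<le> 4 * d" by simp
    from F4[OF t(1-3) xy(1,2) this] show False using xy(3) by blast
  qed
  have foot_F: "near F (2 * d) a y" if t: "t \<in> \<U>" "a \<in> feet t" and y: "y \<in> C" "near G (2 * d) a y"
    for t a y
  proof (rule C_near_F[OF _ y])
    note f = ear_feet[OF ears[OF t(1)]]
    show "a \<in> C" using f(1) t(2) by blast
    have "a \<in> ear_verts t" using feet_ear_verts t(2) by blast
    then show "far (2 * d) a" by (rule far_mono[OF f(2)]) simp
  qed simp
  have feet_far_G: "\<not> near G (2 * d) a b" if t: "t \<in> \<U>" "t' \<in> \<U>" "t \<noteq> t'" "a \<in> feet t" "b \<in> feet t'"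
    for t t' a b
  proof
    assume n: "near G (2 * d) a b"
    have "b \<in> C" using ear_feet(1)[OF ears[OF t(2)]] t(5) by blast
    then have "near F (2 * d) a b" using foot_F[OF t(1,4)] n by blast
    moreover have "a \<in> ear_verts t" "b \<in> ear_verts t'" using t(4,5) feet_ear_verts by blast+
    ultimately show False using F4[OF t(1-3)] by simp
  qed
  define Uc where "Uc = {t \<in> \<U>. \<not> far_feet t}"
  define Up where "Up = {t \<in> \<U>. far_feet t}"
  have "\<U> = Uc \<union> Up" "Uc \<inter> Up = {}" unfolding Uc_def Up_def by auto
  then have cUU: "card \<U> = card Uc + card Up" using fin by (metis card_Un_disjoint finite_Un)
  show ?thesis
  proof (cases "k \<le> card Uc")
    case False
    then have many: "s_fun k \<le> 2 * card Up" using cUU card h by simp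
    have Up: "t \<in> \<U> \<and> far_feet t" if "t \<in> Up" for t using that unfolding Up_def by blast
    show ?thesis
    proof (rule stem_ears_packing[OF _ _ _ _ k1 many])
      show "finite Up" using fin unfolding Up_def by simp
      show "stem_ear t \<and> far_feet t" if "t \<in> Up" for t using Up[OF that] ear_stem_ear[OF ears] by blast
      show "\<not> near G d x y" if "t \<in> Up" "t' \<in> Up" "t \<noteq> t'" "x \<in> ear_verts t" "y \<in> ear_verts t'"
        for t t' x y
        using ear_verts_far_G[OF _ _ that(3-5)] Up that(1,2) by blast
      show "\<not> near G (2 * d) x y" if "t \<in> Up" "t' \<in> Up" "t \<noteq> t'" "x \<in> feet t" "y \<in> feet t'" for t t' x y
        using feet_far_G[OF _ _ that(3-5)] Up that(1,2) by blast
    qed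
  next
    case True
    then obtain K where K: "K \<subseteq> Uc" "card K = k" using obtain_subset_with_card_n by blast
    have KU: "t \<in> \<U>" "\<not> far_feet t" if "t \<in> K" for t using that K(1) unfolding Uc_def by blast+
    define q
      where "q t = (SOME q. cyc G q \<and> (\<forall>z\<in>set q. z \<in> ear_verts t \<or> (z \<in> C \<and> (\<exists>a\<in>feet t. near F d a z))))" for t
    have q: "cyc G (q t)" "\<And>z. z \<in> set (q t) \<Longrightarrow> z \<in> ear_verts t \<or> (z \<in> C \<and> (\<exists>a\<in>feet t. near F d a z))"
      if t: "t \<in> K" for t
    proof -
      have "\<exists>q. cyc G q \<and> (\<forall>z\<in>set q. z \<in> ear_verts t \<or> (z \<in> C \<and> (\<exists>a\<in>feet t. near F d a z)))"
        using ear_cycle ears[OF KU(1)[OF t]] KU(2)[OF t] by (cases t) simp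
      from someI_ex[OF this] show "cyc G (q t)"
        "\<And>z. z \<in> set (q t) \<Longrightarrow> z \<in> ear_verts t \<or> (z \<in> C \<and> (\<exists>a\<in>feet t. near F d a z))" unfolding q_def
          by blast+
    qed
    have no_arc: False
      if t: "t \<in> K" "t' \<in> K" "t \<noteq> t'" and a: "a \<in> feet t" "near F (2 * d) a y" and b: "b \<in> feet t'" "near F d b y"
      for t t' a b y
    proof -
      have "near F (2 * d + d) a b" by (rule near_trans[OF a(2) near_sym[OF b(2)]])
      moreover have "a \<in> ear_verts t" "b \<in> ear_verts t'" using a(1) b(1) feet_ear_verts by blast+
      ultimately show False using F4[OF KU(1)[OF t(1)] KU(1)[OF t(2)] t(3)] by simp
    qed
    have mixed: False
      if t: "t \<in> K" "t' \<in> K" "t \<noteq> t'" and x: "x \<in> ear_verts t" and y: "y \<in> C" "b \<in> feet t'" "near F d b y" and n: "near G d x y"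
      for t t' x y b
    proof -
      obtain a where a: "a \<in> feet t" "near G (2 * d) a y"
        using ear_verts_clean[OF ear_stem_ear[OF ears[OF KU(1)[OF t(1)]]] x y(1) n] by blast
      show False by (rule no_arc[OF t a(1) foot_F[OF KU(1)[OF t(1)] a(1) y(1) a(2)] y(2,3)])
    qed
    have "\<not> near G d x y" if t: "t \<in> K" "t' \<in> K" "t \<noteq> t'" and xy: "x \<in> set (q t)" "y \<in> set (q t')"
      for t t' x y
    proof
      assume n: "near G d x y"
      consider "x \<in> ear_verts t" "y \<in> ear_verts t'" | b
        where "x \<in> ear_verts t" "y \<in> C" "b \<in> feet t'" "near F d b y"
        | a where "y \<in> ear_verts t'" "x \<in> C" "a \<in> feet t" "near F d a x"
        | a b where "x \<in> C" "a \<in> feet t" "near F d a x" "y \<in> C" "b \<in> feet t'" "near F d b y"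
        using q(2)[OF t(1) xy(1)] q(2)[OF t(2) xy(2)] by blast
      then show False
      proof cases
        case 1
        then show ?thesis using ear_verts_far_G[OF KU(1)[OF t(1)] KU(1)[OF t(2)] t(3)] n by blast
      next
        case 2
        from mixed[OF t this n] show ?thesis .
      next
        case 3
        from mixed[OF t(2,1) t(3)[symmetric] this near_sym[OF n]] show ?thesis .
      next
        case 4
        have "near G (d + d) a y" by (rule near_trans[OF near_subgraph[OF 4(3) F_edges] n])
        then have "near F (2 * d) a y" using foot_F[OF KU(1)[OF t(1)] 4(2,4)] by (simp add: mult_2)
        from no_arc[OF t 4(2) this 4(5,6)] show ?thesis .
      qed
    qed
    then show ?thesis using family_packing[where K = K and q = q, OF S q(1)] unfolding K(2) by simp
  qed
qed

lemma pack_or_hit_ears: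
  assumes gl: "gyarfas_lehel l" and k1: "1 \<le> k" and h: "s_fun k \<le> 2 * h"
  shows "(\<exists>\<C>. d_packing d G \<C> \<and> card \<C> = k) \<or>
    (\<exists>X2\<subseteq>verts G. card X2 \<le> l (k + h) 3 \<and> (\<forall>t. ear t \<longrightarrow> X2 \<inter> nbhd F (ear_verts t) (2 * d) \<noteq> {}))"
proof -
  let ?A = "(\<lambda>t. ear_ball (ear_verts t)) ` {t. ear t}"
  have A: "subgraph A F \<and> verts A \<noteq> {} \<and> card (components A) \<le> 3" if AA: "A \<in> ?A" for A
  proof -
    obtain v pl w where e: "ear (v, pl, w)" "A = ear_ball (ear_verts (v, pl, w))" using AA by force
    have "v \<in> nbhd F (ear_verts (v, pl, w)) (2 * d)"
      using near_refl[of F "2 * d" v] unfolding nbhd_def ear_verts.simps by (auto simp del: near_refl)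
    then show ?thesis
      unfolding e(2) using ear_ball_subgraph[OF ear_verts_verts[OF e(1)]] ear_ball_components[OF e(1)]
        by auto
  qed
  have "(\<exists>\<B>\<subseteq>?A. card \<B> = k + h \<and> (\<forall>A\<in>\<B>. \<forall>B\<in>\<B>. A \<noteq> B \<longrightarrow> verts A \<inter> verts B = {})) \<or>
        (\<exists>X\<subseteq>verts F. card X \<le> l (k + h) 3 \<and> (\<forall>A\<in>?A. X \<inter> verts A \<noteq> {}))"
    by (rule gyarfas_lehel_any[OF gl _ _ forest_F A]) (use k1 in auto)
  then show ?thesis
  proof
    assume "\<exists>\<B>\<subseteq>?A. card \<B> = k + h \<and> (\<forall>A\<in>\<B>. \<forall>B\<in>\<B>. A \<noteq> B \<longrightarrow> verts A \<inter> verts B = {})"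
    then obtain \<B> where B: "\<B> \<subseteq> ?A" "card \<B> = k + h" "\<forall>A\<in>\<B>. \<forall>B\<in>\<B>. A \<noteq> B \<longrightarrow> verts A \<inter> verts B = {}"
      by blast
    obtain \<U>
      where U: "\<U> \<subseteq> {t. ear t}" "inj_on (\<lambda>t. ear_ball (ear_verts t)) \<U>" "\<B> = (\<lambda>t. ear_ball (ear_verts t)) ` \<U>"
      using subset_image_inj[THEN iffD1, OF B(1)] by blast
    have c: "card \<U> = k + h" using B(2) U(2,3) by (simp add: card_image)
    have "\<exists>\<C>. d_packing d G \<C> \<and> card \<C> = k"
    proof (rule ears_packing[OF _ _ _ c h k1])
      show "finite \<U>" using c k1 by (intro card_ge_0_finite) simp
      show "ear t" if "t \<in> \<U>" for t using that U(1) by blast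
      fix t t' assume t: "t \<in> \<U>" "t' \<in> \<U>" "t \<noteq> t'"
      have "ear_ball (ear_verts t) \<noteq> ear_ball (ear_verts t')" using inj_onD[OF U(2) _ t(1,2)] t(3)
        by blast
      then have "verts (ear_ball (ear_verts t)) \<inter> verts (ear_ball (ear_verts t')) = {}"
        using B(3) U(3) t(1,2) by blast
      then show "nbhd F (ear_verts t) (2 * d) \<inter> nbhd F (ear_verts t') (2 * d) = {}" by simp
    qed
    then show ?thesis by (rule disjI1)
  next
    assume "\<exists>X\<subseteq>verts F. card X \<le> l (k + h) 3 \<and> (\<forall>A\<in>?A. X \<inter> verts A \<noteq> {})"
    then obtain X2 where X2: "X2 \<subseteq> verts F" "card X2 \<le> l (k + h) 3" "\<forall>A\<in>?A. X2 \<inter> verts A \<noteq> {}" by blast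
    have hit: "X2 \<inter> nbhd F (ear_verts t) (2 * d) \<noteq> {}" if "ear t" for t
    proof -
      have "ear_ball (ear_verts t) \<in> ?A" using that by blast
      then have "X2 \<inter> verts (ear_ball (ear_verts t)) \<noteq> {}" using X2(3) by blast
      then show ?thesis by simp
    qed
    show ?thesis
      by (rule disjI2, rule exI[of _ X2]) (use X2(1,2) hit in simp)
  qed
qed

end

section \<open>The theorem\<close>

lemma ball_set_iff:
  assumes "simple_graph G" "X \<subseteq> verts G"
  shows "z \<in> ball_set G X r \<longleftrightarrow> z \<in> verts G \<and> (\<exists>c\<in>X. near G r c z)"
  unfolding ball_set_def ball_vertex_def using dist_le_iff[OF assms(1) subsetD[OF assms(2)]] by auto

lemma cyc_delete:
  assumes "simple_graph G" "cyc (delete_verts G Z) q"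
  shows "cyc G q" "set q \<inter> Z = {}"
proof -
  have "edges (delete_verts G Z) \<subseteq> edges G" unfolding delete_verts_def by auto
  then show "cyc G q" by (rule cyc_subset[OF assms(2)])
  show "set q \<inter> Z = {}"
    using cyc_verts[OF simple_delete[OF assms(1)] assms(2)] by (auto simp: delete_verts_def)
qed

theorem theorem8:
  fixes G :: "'a graph" and l :: "nat \<Rightarrow> nat \<Rightarrow> nat" and k d :: nat
  assumes "gyarfas_lehel l"
    and "k \<ge> 1" and "d \<ge> 1"
    and "simple_graph G"
  shows "(\<exists>\<C>. d_packing d G \<C> \<and> card \<C> = k) \<or>
         (\<exists>X\<subseteq>verts G. card X \<le> f_bound l k \<and> forest (delete_verts G (ball_set G X (g_radius d))))"
proof (unfold disj_imp, rule impI)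
  assume no: "\<not> (\<exists>\<C>. d_packing d G \<C> \<and> card \<C> = k)"
  note gl = assms(1) and k1 = assms(2) and d1 = assms(3) and S = assms(4)
  show "\<exists>X\<subseteq>verts G. card X \<le> f_bound l k \<and> forest (delete_verts G (ball_set G X (g_radius d)))"
  proof (cases "k = 1")
    \<comment> \<open>A single cycle is a packing; the count of vertices in the other case needs \<open>(k choose 2) + k \<ge> 2\<close>.\<close>
    case True
    have nocyc: "\<not> cyc G q" for q
      using family_packing[OF S, of "{()}" "\<lambda>_. q" d] no True by auto
    have "forest (delete_verts G (ball_set G {} (g_radius d)))"
      unfolding forest_iff[OF simple_delete[OF S]] using cyc_delete(1)[OF S] nocyc by blast
    then show ?thesis by (intro exI[of _ "{}"]) simp
  next
    case False
    then have k2: "2 \<le> k" using k1 by simp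
    have "\<exists>\<P>. cycle_system G d \<P> \<and> card \<P> < k"
    proof (rule cycle_system_exists[OF S d1 no])
      fix \<P> :: "'a list set"
      assume P: "finite \<P>" "card \<P> < k"
        "\<And>p. p \<in> \<P> \<Longrightarrow> \<exists>\<Q>\<subseteq>\<P> - {p}. minimal_admissible G (nbhd G (\<Union> (set ` \<Q>)) (4 * d)) (4 * d - 1) p"
        "\<And>p q x y. p \<in> \<P> \<Longrightarrow> q \<in> \<P> \<Longrightarrow> p \<noteq> q \<Longrightarrow> x \<in> set p \<Longrightarrow> y \<in> set q \<Longrightarrow> \<not> near G (2 * d) x y"
        "\<And>q. cyc G q \<Longrightarrow> set q \<inter> nbhd G (\<Union> (set ` \<P>)) (4 * d) \<noteq> {}"
      have "cycle_system G d \<P>" by unfold_locales (fact S d1 P)+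
      then show ?thesis using P(2) by blast
    qed
    then obtain \<P> where sys: "cycle_system G d \<P>" and P: "card \<P> < k" by blast
    interpret cycle_system G d \<P> by (rule sys)
    obtain \<M> where M: "finite \<M>" "far_bridges \<M>"
      "\<forall>u v. bridge u v \<longrightarrow> (\<exists>e\<in>\<M>. \<exists>x\<in>bridge_verts (u, v). \<exists>y\<in>bridge_verts e. near G (2 * d) x y)"
      by (rule bridge_family)
    have few: "2 * card \<M> < s_fun k" using bridges_packing[OF M(1,2) k1] no by (meson not_le)
    interpret hit_system G d \<P> "hitting_pts \<M>"
    proof unfold_locales
      fix u v assume "adj G u v" "level u \<le> 5 * d" "level v \<le> 5 * d" "\<not> good u v"
      then show "\<exists>c\<in>hitting_pts \<M>. \<exists>a\<in>{u, v}. near G (13 * d) c a"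
        by (rule hitting_pts_cover[OF M(2,3)])
    next
      fix p assume p: "p \<in> \<P>"
      have "hd p = p ! 0" using cyc_nonempty[OF cycP[OF p]] by (simp add: hd_conv_nth)
      then show "hd p \<in> hitting_pts \<M>" using p unfolding hitting_pts_def cycle_pts_def by auto
    qed
    define h where "h = nat \<lceil>1 / 2 * real (s_fun k)\<rceil>"
    have h: "s_fun k \<le> 2 * h" unfolding h_def by linarith
    obtain X2 where X2: "X2 \<subseteq> verts G" "card X2 \<le> l (k + h) 3"
      "\<And>t. ear t \<Longrightarrow> X2 \<inter> nbhd F (ear_verts t) (2 * d) \<noteq> {}"
      using pack_or_hit_ears[OF gl k1 h] no by blast
    define X where "X = hitting_pts \<M> \<union> X2"
    have XV: "X \<subseteq> verts G" unfolding X_def using hitting_pts_verts[OF M(2)] X2(1) by blast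
    have "card X \<le> card (hitting_pts \<M>) + card X2" unfolding X_def by (rule card_Un_le)
    also have "\<dots> \<le> 3 * card \<P> + 4 * card \<M> + l (k + h) 3" using hitting_pts_card[OF M(1)] X2(2) by simp
    also have "\<dots> \<le> f_bound l k"
    proof -
      have "k \<le> 2 * k\<^sup>2" by (simp add: power2_eq_square)
      then have a: "3 * card \<P> \<le> 2 * k + 2 * k\<^sup>2" using P by linarith
      have "4 * card \<M> \<le> 2 * s_fun k" using few by simp
      also have "\<dots> \<le> ((k choose 2) + k) * s_fun k" using k2 by (intro mult_le_mono1) simp
      finally show ?thesis using a unfolding f_bound_def h_def by simp
    qed
    finally have card: "card X \<le> f_bound l k" .
    have "forest (delete_verts G (ball_set G X (g_radius d)))"
      unfolding forest_iff[OF simple_delete[OF S]]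
    proof (intro allI notI)
      fix q assume q: "cyc (delete_verts G (ball_set G X (g_radius d))) q"
      have cq: "cyc G q" by (rule cyc_delete(1)[OF S q])
      have out: "\<not> near G (19 * d) c z" if "c \<in> X" "z \<in> set q" for c z
      proof -
        have "z \<notin> ball_set G X (19 * d)" using cyc_delete(2)[OF S q] that(2) unfolding g_radius_def
          by blast
        moreover have "z \<in> verts G" using cyc_verts[OF S cq] that(2) by blast
        ultimately show ?thesis using ball_set_iff[OF S XV] that(1) by blast
      qed
      have "\<exists>v pl w. ear (v, pl, w) \<and> insert v (insert w (set pl)) \<subseteq> set q"
        by (rule cycle_has_ear[OF cq]) (use out in \<open>auto simp: far_def X_def\<close>)
      then obtain v pl w where e: "ear (v, pl, w)" "insert v (insert w (set pl)) \<subseteq> set q" by blast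
      \<comment> \<open>\<open>X2\<close> is within \<open>2 d\<close> of the ear, and the ear within \<open>5 d\<close> of its part on \<open>q\<close>.\<close>
      obtain x z where x: "x \<in> X2" "z \<in> ear_verts (v, pl, w)" "near F (2 * d) z x"
        using X2(3)[OF e(1)] unfolding nbhd_def by blast
      obtain y where y: "y \<in> insert v (insert w (set pl))" "near G (5 * d) y z"
        by (rule ear_verts_near[OF e(1) x(2)])
      have "near G (2 * d) z x" by (rule near_subgraph[OF x(3) F_edges])
      from near_trans[OF y(2) this] have "near G (5 * d + 2 * d) x y" by (rule near_sym)
      then have "near G (19 * d) x y" by (rule near_mono) simp
      then show False using out[of x y] x(1) y(1) e(2) unfolding X_def by blast
    qed
    then show ?thesis using card XV by blast
  qed
qed

end
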